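(* Let $\{X_n;n\ge1\}$ be a sequence of identically distributed random variables in a sub-linear expectation space $(\Omega,\mathscr H,\widehat{\mathbb E})$. Put $S_n=\sum_{k=1}^nX_k$, $\overline\sigma^2=\widehat{\mathbb E}[X_1^2]$ (with $\overline\sigma\ge 0$) and $a_n=\sqrt{2n\log\log n}$, where $\log x=\ln(x\vee e)$. (a) Suppose that $X_1,X_2,\ldots$ are negatively dependent with $\widehat{\mathbb E}[X_1]=\widehat{\mathbb E}[-X_1]=0$, $\lim_{c\to\infty}\widehat{\mathbb E}[(X_1^2-c)^+]=0$ and $$C_{\mathbb V}\left[\frac{X_1^2}{\log\log|X_1|}\right]<\infty.\qquad(1)$$ Then $$\mathbb V^{\ast}\left(\Big\{\liminf_{n\to\infty}\frac{S_n}{a_n}<-\overline\sigma\Big\}\bigcup\Big\{\limsup_{n\to\infty}\frac{S_n}{a_n}>\overline\sigma\Big\}\right)=0.$$ (b) Suppose that $X_1,X_2,\ldots$ are independent, $\mathbb V^{\ast}$ is continuous and $\widehat{\mathbb E}$ is countably sub-additive. If $$\mathbb V^{\ast}\left(\limsup_{n\to\infty}\frac{|S_n|}{a_n}=+\infty\right)<1,\qquad(2)$$ then $\widehat{\mathbb E}[X_1]=\widehat{\mathbb E}[-X_1]=0$, and (1) holds. (c) Suppose that $X_1,X_2,\ldots$ are independent and $\mathbb V$ is continuous. Assume that (2) holds. Then (1) holds. Further, if $\lim_{c\to\infty}\widehat{\mathbb E}[(|X_1|-c)^+]=0$, then $\widehat{\mathbb E}[X_1]=\widehat{\mathbb E}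[-X_1]=0$.
   Context: Let $(\Omega,\mathcal F)$ be a measurable space and $\mathscr H$ a linear space of real-valued $\mathcal F$-measurable functions on $\Omega$ such that $\varphi(X_1,\ldots,X_n)\in\mathscr H$ whenever $X_1,\ldots,X_n\in\mathscr H$ and $\varphi\in C_{l,Lip}(\mathbb R^n)$, where $C_{l,Lip}(\mathbb R^n)$ is the space of functions $\varphi:\mathbb R^n\to\mathbb R$ with $|\varphi(x)-\varphi(y)|\le C(1+|x|^m+|y|^m)|x-y|$ for all $x,y\in\mathbb R^n$, for some $C>0$, $m\in\mathbb N$ depending on $\varphi$. Elements of $\mathscr H$ are called random variables. A sub-linear expectation is a map $\widehat{\mathbb E}:\mathscr H\to[-\infty,\infty]$ such that for all $X,Y\in\mathscr H$: $X\ge Y$ implies $\widehat{\mathbb E}[X]\ge\widehat{\mathbb E}[Y]$; $\widehat{\mathbb E}[c]=c$ for constants $c$; $\widehat{\mathbb E}[X+Y]\le\widehat{\mathbb E}[X]+\widehat{\mathbb E}[Y]$ whenever the right side is not of the form $+\infty-\infty$ or $-\infty+\infty$; $\widehat{\mathbb E}[\lambda X]=\lambda\widehat{\mathbb E}[X]$ for $\lambda\ge0$. The triple $(\Omega,\mathscr H,\widehat{\mathbb E})$ is a sub-linear expectation space. $\widehat{\mathbb E}$ is countably sub-additive if $\widehat{\mathbb E}[X]\le\sum_{n=1}^\infty\widehat{\mathbb E}[X_n]$ whenever $X\le\sum_{n=1}^\infty X_n$, $X,X_n\in\mathscr H$, $X\ge0$, $X_n\ge0$. Capacities: $\mathbb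 V(A)=\inf\{\widehat{\mathbb E}[\xi]: I_A\le\xi,\ \xi\in\mathscr H\}$ for $A\in\mathcal F$, and the outer capacity is $\mathbb V^{\ast}(A)=\inf\{\sum_{n=1}^\infty\mathbb V(A_n): A\subset\bigcup_{n=1}^\infty A_n,\ A_n\in\mathcal F\}$ for $A\in\mathcal F$. A capacity $V:\mathcal F\to[0,1]$ is continuous if $V(A_n)\uparrow V(A)$ whenever $A_n\uparrow A$ and $V(A_n)\downarrow V(A)$ whenever $A_n\downarrow A$ ($A_n,A\in\mathcal F$). Choquet expectation: $C_{\mathbb V}[X]=\int_0^\infty\mathbb V(X\ge t)\,dt+\int_{-\infty}^0[\mathbb V(X\ge t)-1]\,dt$. Identical distribution: $\{X_n\}$ is identically distributed if for each $i$, $\widehat{\mathbb E}[\varphi(X_i)]=\widehat{\mathbb E}[\varphi(X_1)]$ for all $\varphi\in C_{l,Lip}(\mathbb R)$ whenever the sub-linear expectations are finite. Independence: a random vector $\boldsymbol Y=(Y_1,\ldots,Y_n)$ (with $Y_i\in\mathscr H$) is independent to $\boldsymbol X=(X_1,\ldots,X_m)$ (with $X_i\in\mathscr H$) if for each $\varphi\in C_{l,Lip}(\mathbb R^m\times\mathbb R^n)$, $\widehat{\mathbb E}[\varphi(\boldsymbol X,\boldsymbol Y)]=\widehat{\mathbb E}\big[\widehat{\mathbb E}[\varphi(\boldsymbol x,\boldsymbol Y)]\big|_{\boldsymbol x=\boldsymbol X}\big]$ whenever $\overline\varphi(\boldsymbol x):=\widehat{\mathbb E}[|\varphi(\boldsymbol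 x,\boldsymbol Y)|]<\infty$ for all $\boldsymbol x$ and $\widehat{\mathbb E}[|\overline\varphi(\boldsymbol X)|]<\infty$. Random variables $X_1,X_2,\ldots$ are independent if $X_{i+1}$ is independent to $(X_1,\ldots,X_i)$ for each $i\ge1$. Negative dependence: $\boldsymbol Y=(Y_1,\ldots,Y_n)$ is negatively dependent to $\boldsymbol X=(X_1,\ldots,X_m)$ if for each $\varphi_1\in C_{l,Lip}(\mathbb R^m)$, $\varphi_2\in C_{l,Lip}(\mathbb R^n)$, $\widehat{\mathbb E}[\varphi_1(\boldsymbol X)\varphi_2(\boldsymbol Y)]\le\widehat{\mathbb E}[\varphi_1(\boldsymbol X)]\,\widehat{\mathbb E}[\varphi_2(\boldsymbol Y)]$ whenever $\varphi_1,\varphi_2$ are both coordinatewise nondecreasing or both coordinatewise non-increasing, and $\varphi_1(\boldsymbol X)\ge0$, $\widehat{\mathbb E}[\varphi_2(\boldsymbol Y)]\ge0$, $\widehat{\mathbb E}[|\varphi_1(\boldsymbol X)\varphi_2(\boldsymbol Y)|]<\infty$, $\widehat{\mathbb E}[|\varphi_1(\boldsymbol X)|]<\infty$, $\widehat{\mathbb E}[|\varphi_2(\boldsymbol Y)|]<\infty$. Random variables $X_1,X_2,\ldots$ are negatively dependent if $X_{i+1}$ is negatively dependent to $(X_1,\ldots,X_i)$ for each $i\ge1$. *)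

theory Defs
  imports "HOL-Analysis.Analysis"
begin

text \<open>
  A vector of \<open>\<real>\<^sup>n\<close> is a list of length \<open>n\<close>, so that the dimension can vary inside a formula and
  the point \<open>(x, y)\<close> of \<open>\<real>\<^sup>m \<times> \<real>\<^sup>n\<close> is \<open>x @ y\<close>. Functions on \<open>\<real>\<^sup>n\<close> have type
  \<open>real list \<Rightarrow> real\<close>; their values on lists of other lengths are irrelevant.
\<close>

definition vec_norm :: "real list \<Rightarrow> real" where
  "vec_norm x = L2_set (\<lambda>i. x ! i) {..<length x}"

definition C_l_Lip :: "nat \<Rightarrow> (real list \<Rightarrow> real) set" where
  "C_l_Lip n = {\<phi>. \<exists>C>0. \<exists>m::nat. \<forall>x y. length x = n \<longrightarrow> length y = n \<longrightarrow>
     \<bar>\<phi> x - \<phi> y\<bar> \<le> C * (1 + vec_norm x ^ m + vec_norm y ^ m) * vec_norm (map2 (-) x y)}"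

definition eval_vec :: "('a \<Rightarrow> real) list \<Rightarrow> 'a \<Rightarrow> real list" where
  "eval_vec Xs \<omega> = map (\<lambda>X. X \<omega>) Xs"

text \<open>
  Only the measurable space underlying \<open>M\<close> is used: \<open>\<Omega> = space M\<close> and \<open>\<F> = sets M\<close>.
  All pointwise relations are required on \<open>space M\<close> only, and \<open>H_cong\<close> makes membership in \<open>H\<close>
  (hence, with \<open>E_mono\<close>, the value of \<open>E\<close>) depend only on the restriction of a function to
  \<open>space M\<close>: \<open>H\<close> represents a set of functions on \<open>\<Omega>\<close>. The values of \<open>E\<close> outside \<open>H\<close> are
  unspecified.
\<close>

locale sublinear_expectation_space =
  fixes M :: "'a measure" and H :: "('a \<Rightarrow> real) set" and E :: "('a \<Rightarrow> real) \<Rightarrow> ereal"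
  assumes H_measurable: "\<And>X. X \<in> H \<Longrightarrow> X \<in> borel_measurable M"
    and H_cong: "\<And>X Y. X \<in> H \<Longrightarrow> (\<And>\<omega>. \<omega> \<in> space M \<Longrightarrow> Y \<omega> = X \<omega>) \<Longrightarrow> Y \<in> H"
    and H_zero: "(\<lambda>\<omega>. 0) \<in> H"
    and H_add: "\<And>X Y. X \<in> H \<Longrightarrow> Y \<in> H \<Longrightarrow> (\<lambda>\<omega>. X \<omega> + Y \<omega>) \<in> H"
    and H_scale: "\<And>c X. X \<in> H \<Longrightarrow> (\<lambda>\<omega>. c * X \<omega>) \<in> H"
    and H_comp: "\<And>Xs \<phi>. Xs \<noteq> [] \<Longrightarrow> set Xs \<subseteq> H \<Longrightarrow> \<phi> \<in> C_l_Lip (length Xs) \<Longrightarrow>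
        (\<lambda>\<omega>. \<phi> (eval_vec Xs \<omega>)) \<in> H"
    and E_mono: "\<And>X Y. X \<in> H \<Longrightarrow> Y \<in> H \<Longrightarrow> (\<And>\<omega>. \<omega> \<in> space M \<Longrightarrow> Y \<omega> \<le> X \<omega>) \<Longrightarrow> E Y \<le> E X"
    and E_const: "\<And>c. E (\<lambda>\<omega>. c) = ereal c"
    and E_subadd: "\<And>X Y. X \<in> H \<Longrightarrow> Y \<in> H \<Longrightarrow>
        \<not> (E X = \<infinity> \<and> E Y = -\<infinity>) \<Longrightarrow> \<not> (E X = -\<infinity> \<and> E Y = \<infinity>) \<Longrightarrow>
        E (\<lambda>\<omega>. X \<omega> + Y \<omega>) \<le> E X + E Y"
    and E_scale: "\<And>c X. X \<in> H \<Longrightarrow> 0 \<le> c \<Longrightarrow> E (\<lambda>\<omega>. c * X \<omega>) = ereal c * E X"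

definition countably_subadd_exp ::
    "'a measure \<Rightarrow> ('a \<Rightarrow> real) set \<Rightarrow> (('a \<Rightarrow> real) \<Rightarrow> ereal) \<Rightarrow> bool" where
  "countably_subadd_exp M H E \<longleftrightarrow>
     (\<forall>X Xs. X \<in> H \<longrightarrow> (\<forall>n::nat. Xs n \<in> H) \<longrightarrow>
        (\<forall>\<omega>\<in>space M. 0 \<le> X \<omega>) \<longrightarrow> (\<forall>n. \<forall>\<omega>\<in>space M. 0 \<le> Xs n \<omega>) \<longrightarrow>
        (\<forall>\<omega>\<in>space M. ereal (X \<omega>) \<le> (\<Sum>n. ereal (Xs n \<omega>))) \<longrightarrow>
        E X \<le> (\<Sum>n. E (Xs n)))"

definition upper_cap ::
    "'a measure \<Rightarrow> ('a \<Rightarrow> real) set \<Rightarrow> (('a \<Rightarrow> real) \<Rightarrow> ereal) \<Rightarrow> 'a set \<Rightarrow> ereal" where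
  "upper_cap M H E A = Inf {E \<xi> | \<xi>. \<xi> \<in> H \<and> (\<forall>\<omega>\<in>space M. indicator A \<omega> \<le> \<xi> \<omega>)}"

definition outer_cap ::
    "'a measure \<Rightarrow> ('a \<Rightarrow> real) set \<Rightarrow> (('a \<Rightarrow> real) \<Rightarrow> ereal) \<Rightarrow> 'a set \<Rightarrow> ereal" where
  "outer_cap M H E A =
     Inf {(\<Sum>n. upper_cap M H E (B n)) | B :: nat \<Rightarrow> 'a set. (\<forall>n. B n \<in> sets M) \<and> A \<subseteq> (\<Union>n. B n)}"

definition continuous_cap :: "'a measure \<Rightarrow> ('a set \<Rightarrow> ereal) \<Rightarrow> bool" where
  "continuous_cap M V \<longleftrightarrow>
     (\<forall>A :: nat \<Rightarrow> 'a set. (\<forall>n. A n \<in> sets M) \<longrightarrow>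
        (incseq A \<longrightarrow> (\<lambda>n. V (A n)) \<longlonglongrightarrow> V (\<Union>n. A n)) \<and>
        (decseq A \<longrightarrow> (\<lambda>n. V (A n)) \<longlonglongrightarrow> V (\<Inter>n. A n)))"

text \<open>
  For \<open>V\<close> with values in \<open>[0,1]\<close>, both integrands below are nonnegative, and monotone in \<open>t\<close> if
  \<open>V\<close> is. The second term is the negative of \<open>\<integral>\<^bsub>-\<infinity>\<^esub>\<^sup>0 (V(f \<ge> t) - 1) dt\<close>. If both are infinite, the
  Choquet expectation does not exist (here \<open>\<infinity> - \<infinity> = \<infinity>\<close>); for \<open>f \<ge> 0\<close> and
  \<open>V \<Omega> = 1\<close> the second term vanishes.
\<close>

definition choquet :: "'a measure \<Rightarrow> ('a set \<Rightarrow> ereal) \<Rightarrow> ('a \<Rightarrow> real) \<Rightarrow> ereal" where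
  "choquet M V f =
     enn2ereal (\<integral>\<^sup>+t\<in>{0..}. e2ennreal (V {\<omega>\<in>space M. t \<le> f \<omega>}) \<partial>lborel)
     - enn2ereal (\<integral>\<^sup>+t\<in>{..0}. e2ennreal (1 - V {\<omega>\<in>space M. t \<le> f \<omega>}) \<partial>lborel)"

text \<open>
  Sequences of random variables are indexed from 1; the value at index 0 is never used.
\<close>

definition identically_distributed ::
    "(('a \<Rightarrow> real) \<Rightarrow> ereal) \<Rightarrow> (nat \<Rightarrow> 'a \<Rightarrow> real) \<Rightarrow> bool" where
  "identically_distributed E X \<longleftrightarrow>
     (\<forall>i\<ge>1. \<forall>\<phi>\<in>C_l_Lip 1.
        \<bar>E (\<lambda>\<omega>. \<phi> [X i \<omega>])\<bar> \<noteq> \<infinity> \<longrightarrow> \<bar>E (\<lambda>\<omega>. \<phi> [X 1 \<omega>])\<bar> \<noteq> \<infinity> \<longrightarrow>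
        E (\<lambda>\<omega>. \<phi> [X i \<omega>]) = E (\<lambda>\<omega>. \<phi> [X 1 \<omega>]))"

text \<open>
  \<open>indep_to H E Ys Xs\<close>: the vector \<open>Ys\<close> is independent to the vector \<open>Xs\<close>. For
  \<open>\<phi> \<in> C_l_Lip (m + n)\<close>, the functions \<open>x \<mapsto> E[|\<phi>(x,Y)|]\<close> and \<open>x \<mapsto> E[\<phi>(x,Y)]\<close>, finite under the
  first premise, need not be in \<open>C_l_Lip m\<close> if \<open>Y\<close> lacks moments. Their composition with \<open>X\<close> is
  therefore required to be in \<open>H\<close>, the domain of \<open>E\<close>, for the identity to be claimed.
\<close>

definition indep_to ::
    "('a \<Rightarrow> real) set \<Rightarrow> (('a \<Rightarrow> real) \<Rightarrow> ereal) \<Rightarrow> ('a \<Rightarrow> real) list \<Rightarrow> ('a \<Rightarrow> real) list \<Rightarrow> bool" where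
  "indep_to H E Ys Xs \<longleftrightarrow>
     (\<forall>\<phi> \<in> C_l_Lip (length Xs + length Ys).
        let g = (\<lambda>x. E (\<lambda>\<omega>. \<phi> (x @ eval_vec Ys \<omega>)));
            g' = (\<lambda>x. E (\<lambda>\<omega>. \<bar>\<phi> (x @ eval_vec Ys \<omega>)\<bar>));
            G = (\<lambda>\<omega>. real_of_ereal (g (eval_vec Xs \<omega>)));
            G' = (\<lambda>\<omega>. real_of_ereal (g' (eval_vec Xs \<omega>)))
        in (\<forall>x. length x = length Xs \<longrightarrow> g' x < \<infinity>) \<longrightarrow>
           G \<in> H \<longrightarrow> G' \<in> H \<longrightarrow> E (\<lambda>\<omega>. \<bar>G' \<omega>\<bar>) < \<infinity> \<longrightarrow>
           E (\<lambda>\<omega>. \<phi> (eval_vec Xs \<omega> @ eval_vec Ys \<omega>)) = E G)"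

definition independent_seq ::
    "('a \<Rightarrow> real) set \<Rightarrow> (('a \<Rightarrow> real) \<Rightarrow> ereal) \<Rightarrow> (nat \<Rightarrow> 'a \<Rightarrow> real) \<Rightarrow> bool" where
  "independent_seq H E X \<longleftrightarrow> (\<forall>i\<ge>1. indep_to H E [X (i + 1)] (map X [1..<i + 1]))"

definition coord_nondecreasing :: "nat \<Rightarrow> (real list \<Rightarrow> real) \<Rightarrow> bool" where
  "coord_nondecreasing n \<phi> \<longleftrightarrow>
     (\<forall>x y. length x = n \<longrightarrow> length y = n \<longrightarrow> list_all2 (\<le>) x y \<longrightarrow> \<phi> x \<le> \<phi> y)"

definition coord_nonincreasing :: "nat \<Rightarrow> (real list \<Rightarrow> real) \<Rightarrow> bool" where
  "coord_nonincreasing n \<phi> \<longleftrightarrow>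
     (\<forall>x y. length x = n \<longrightarrow> length y = n \<longrightarrow> list_all2 (\<le>) x y \<longrightarrow> \<phi> y \<le> \<phi> x)"

definition neg_dep_to ::
    "'a measure \<Rightarrow> (('a \<Rightarrow> real) \<Rightarrow> ereal) \<Rightarrow> ('a \<Rightarrow> real) list \<Rightarrow> ('a \<Rightarrow> real) list \<Rightarrow> bool" where
  "neg_dep_to M E Ys Xs \<longleftrightarrow>
     (\<forall>\<phi>1 \<in> C_l_Lip (length Xs). \<forall>\<phi>2 \<in> C_l_Lip (length Ys).
        let U = (\<lambda>\<omega>. \<phi>1 (eval_vec Xs \<omega>)); W = (\<lambda>\<omega>. \<phi>2 (eval_vec Ys \<omega>))
        in (coord_nondecreasing (length Xs) \<phi>1 \<and> coord_nondecreasing (length Ys) \<phi>2 \<or>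
            coord_nonincreasing (length Xs) \<phi>1 \<and> coord_nonincreasing (length Ys) \<phi>2) \<longrightarrow>
           (\<forall>\<omega>\<in>space M. 0 \<le> U \<omega>) \<longrightarrow> 0 \<le> E W \<longrightarrow>
           E (\<lambda>\<omega>. \<bar>U \<omega> * W \<omega>\<bar>) < \<infinity> \<longrightarrow> E (\<lambda>\<omega>. \<bar>U \<omega>\<bar>) < \<infinity> \<longrightarrow> E (\<lambda>\<omega>. \<bar>W \<omega>\<bar>) < \<infinity> \<longrightarrow>
           E (\<lambda>\<omega>. U \<omega> * W \<omega>) \<le> E U * E W)"

definition negatively_dependent_seq ::
    "'a measure \<Rightarrow> (('a \<Rightarrow> real) \<Rightarrow> ereal) \<Rightarrow> (nat \<Rightarrow> 'a \<Rightarrow> real) \<Rightarrow> bool" where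
  "negatively_dependent_seq M E X \<longleftrightarrow> (\<forall>i\<ge>1. neg_dep_to M E [X (i + 1)] (map X [1..<i + 1]))"

definition log_e :: "real \<Rightarrow> real" where
  "log_e x = ln (max x (exp 1))"

definition lil_norm :: "nat \<Rightarrow> real" where
  "lil_norm n = sqrt (2 * real n * log_e (log_e (real n)))"

definition partial_sum :: "(nat \<Rightarrow> 'a \<Rightarrow> real) \<Rightarrow> nat \<Rightarrow> 'a \<Rightarrow> real" where
  "partial_sum X n \<omega> = (\<Sum>k=1..n. X k \<omega>)"

definition lil_moment_cond ::
    "'a measure \<Rightarrow> ('a \<Rightarrow> real) set \<Rightarrow> (('a \<Rightarrow> real) \<Rightarrow> ereal) \<Rightarrow> ('a \<Rightarrow> real) \<Rightarrow> bool" where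
  "lil_moment_cond M H E Y \<longleftrightarrow>
     choquet M (upper_cap M H E) (\<lambda>\<omega>. (Y \<omega>)\<^sup>2 / log_e (log_e \<bar>Y \<omega>\<bar>)) < \<infinity>"

definition lil_bounded_cond ::
    "'a measure \<Rightarrow> ('a \<Rightarrow> real) set \<Rightarrow> (('a \<Rightarrow> real) \<Rightarrow> ereal) \<Rightarrow> (nat \<Rightarrow> 'a \<Rightarrow> real) \<Rightarrow> bool" where
  "lil_bounded_cond M H E X \<longleftrightarrow>
     outer_cap M H E {\<omega>\<in>space M. limsup (\<lambda>n. ereal (\<bar>partial_sum X n \<omega>\<bar> / lil_norm n)) = \<infinity>} < 1"

end

theory Submission
  imports Defs
begin

text \<open>
  Part (a). Along blocks \<open>n\<^sub>k \<approx> \<rho>\<^bsup>2k\<^esup>\<close>, truncate the variables at \<open>\<eta> a\<^sub>n\<close> for \<open>n = n\<^sub>k\<close>; the Choquet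
  condition (1) makes the capacity that some truncation is active summable over \<open>k\<close>. Negative dependence gives
  \<open>E (exp (t S\<^sub>n)) \<le> (E (exp (t X\<^sub>1)))\<^sup>n\<close> for the truncated variables, and a third-order expansion of \<open>exp\<close>
  yields the Gaussian bound up to an error \<open>\<Lambda>\<^sub>k\<close>, a normalized truncated third moment. Again by (1), \<open>\<Lambda>\<^sub>k\<close> is
  summable over \<open>k\<close>, and a suitable choice of \<open>t\<close> bounds the capacity of a large deviation by a summable Gaussian
  term plus a multiple of \<open>\<Lambda>\<^sub>k\<close>. Inside a block, \<open>S\<^sub>n\<close> is \<open>S\<close> at the right end plus a sum of the variables
  \<open>- X\<^sub>i\<close> over the remaining indices; the maximum of such sums over \<open>n\<close> obeys a similar exponential inequality.

  Parts (b) and (c). For independent variables and functions \<open>h\<^sub>i \<ge> 0\<close> the lower expectation \<open>- E (- Z)\<close> of the product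
  \<open>Z = \<Prod> h\<^sub>i (X\<^sub>i)\<close> is the product of the lower expectations. If (1) fails, then \<open>\<Sum> V (\<bar>X\<^sub>n\<bar> \<ge> R a\<^sub>n) = \<infinity>\<close> for every
  \<open>R\<close>, and this product formula with continuity from above gives capacity \<open>1\<close> to \<open>limsup \<bar>X\<^sub>n\<bar> / a\<^sub>n = \<infinity>\<close>,
  contrary to (2). If \<open>E X\<^sub>1 = \<mu> > 0\<close>, the formula applied to \<open>exp (- t (X\<^sub>i - \<mu> / 2))\<close>, truncated, shows that the
  capacity of \<open>S\<^sub>n \<ge> n \<mu> / 2\<close> tends to \<open>1\<close> along \<open>n = 2\<^sup>k\<close>, which contradicts (2) since \<open>n / a\<^sub>n \<rightarrow> \<infinity>\<close>.
\<close>

section \<open>Bounded Lipschitz functions\<close>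

text \<open>Identical distribution and negative dependence say something only where the expectations
  involved are finite, and independence moreover only where the inner expectations, as functions of
  the past, belong to \<open>H\<close>. All test functions are therefore bounded and Lipschitz:
  finiteness is then automatic, and for products the inner expectation is a constant times a product
  over the past.

  Indicators are not Lipschitz, so identically distributed variables may differ in their tail
  capacities. Comparison through a trapezoidal function costs a factor 2 in the threshold, which is
  affordable because (1) controls the tails at every multiple of \<open>a_n\<close>.

  The sharp constant needs the exact coefficient 1/2 of the second moment in the exponential bound
  and block ends of ratio close to 1. The cubic error is only summable over the blocks, not
  negligible in each of them, so the exponent has to be adapted to its size. In (b) and (c) the
  exponential weights are estimated by first moments alone, after truncation at \<open>a_n\<close>;
  (1) pays for that truncation along powers of 2.\<close>

lemma abs_nth_le_vec_norm: "i < length x \<Longrightarrow> \<bar>x ! i\<bar> \<le> vec_norm x"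
  unfolding vec_norm_def using member_le_L2_set[of "{..<length x}" i "\<lambda>i. \<bar>x ! i\<bar>"]
  by (simp add: L2_set_def)

text \<open>The growth exponent is taken to be 0, and every coordinate difference is at most the
  norm of the difference vector.\<close>

lemma C_l_LipI:
  assumes "\<And>x y. length x = n \<Longrightarrow> length y = n \<Longrightarrow>
    \<bar>\<phi> x - \<phi> y\<bar> \<le> C * (\<Sum>i<n. \<bar>x ! i - y ! i\<bar>)"
  shows "\<phi> \<in> C_l_Lip n"
proof -
  \<comment> \<open>The summand 1 keeps the constant positive whatever the sign of
    \<open>C\<close>.\<close>
  let ?D = "\<bar>C\<bar> * n + 1"
  have "\<bar>\<phi> x - \<phi> y\<bar> \<le> ?D * (1 + vec_norm x ^ 0 + vec_norm y ^ 0) * vec_norm (map2 (-) x y)"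
    if l: "length x = n" "length y = n" for x y
  proof -
    let ?v = "vec_norm (map2 (-) x y)"
    have v: "0 \<le> ?v" by (simp add: vec_norm_def L2_set_nonneg)
    have "(\<Sum>i<n. \<bar>x ! i - y ! i\<bar>) \<le> (\<Sum>i<n. ?v)"
      by (intro sum_mono) (use abs_nth_le_vec_norm[of _ "map2 (-) x y"] l in auto)
    hence "\<bar>C\<bar> * (\<Sum>i<n. \<bar>x ! i - y ! i\<bar>) \<le> \<bar>C\<bar> * (n * ?v)"
      by (intro mult_left_mono) auto
    moreover have "C * (\<Sum>i<n. \<bar>x ! i - y ! i\<bar>) \<le> \<bar>C\<bar> * (\<Sum>i<n. \<bar>x ! i - y ! i\<bar>)"
      by (intro mult_right_mono sum_nonneg) auto
    moreover have "?D * (1 + vec_norm x ^ 0 + vec_norm y ^ 0) * ?v = \<bar>C\<bar> * (n * ?v) + 2 * (\<bar>C\<bar> * (n * ?v)) + 3 * ?v"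
      by (simp add: algebra_simps)
    moreover have "0 \<le> \<bar>C\<bar> * (n * ?v)" using v by simp
    ultimately show ?thesis using assms[OF l] v by linarith
  qed
  moreover have "?D > 0" by (smt (verit) mult_nonneg_nonneg of_nat_0_le_iff)
  ultimately show ?thesis unfolding C_l_Lip_def by blast
qed

lemma C_l_LipI1:
  assumes "\<And>x y. \<bar>f x - f y\<bar> \<le> C * \<bar>x - y\<bar>"
  shows "(\<lambda>xs. f (xs ! 0)) \<in> C_l_Lip (Suc 0)"
  by (rule C_l_LipI[where C = C]) (use assms in auto)

lemma square_C_l_Lip: "(\<lambda>xs. (xs ! 0)\<^sup>2) \<in> C_l_Lip (Suc 0)"
proof -
  have "\<bar>(x ! 0)\<^sup>2 - (y ! 0)\<^sup>2\<bar> \<le> 1 * (1 + vec_norm x ^ 1 + vec_norm y ^ 1) * vec_norm (map2 (-) x y)"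
    if l: "length x = Suc 0" "length y = Suc 0" for x y :: "real list"
  proof -
    obtain a b where [simp]: "x = [a]" "y = [b]" using l by (metis length_0_conv length_Suc_conv)
    have "\<bar>a\<^sup>2 - b\<^sup>2\<bar> = \<bar>a + b\<bar> * \<bar>a - b\<bar>" by (simp add: power2_eq_square algebra_simps flip: abs_mult)
    also have "\<dots> \<le> (1 + \<bar>a\<bar> + \<bar>b\<bar>) * \<bar>a - b\<bar>" by (intro mult_right_mono) auto
    finally show ?thesis by (simp add: vec_norm_def L2_set_def)
  qed
  thus ?thesis unfolding C_l_Lip_def using zero_less_one by blast
qed

text \<open>Boundedness and the Lipschitz property are what makes the transfer of expectations along
  identical distribution unconditional.\<close>

definition BL :: "(real \<Rightarrow> real) set" where
  "BL = {f. \<exists>C. (\<forall>x. \<bar>f x\<bar> \<le> C) \<and> (\<forall>x y. \<bar>f x - f y\<bar> \<le> C * \<bar>x - y\<bar>)}"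

lemma BL_I:
  assumes "\<And>x. \<bar>f x\<bar> \<le> C" "\<And>x y. \<bar>f x - f y\<bar> \<le> D * \<bar>x - y\<bar>"
  shows "f \<in> BL"
proof -
  have "\<bar>f x\<bar> \<le> max C D" for x using assms(1)[of x] by simp
  moreover have "\<bar>f x - f y\<bar> \<le> max C D * \<bar>x - y\<bar>" for x y
    using assms(2)[of x y] mult_right_mono[of D "max C D" "\<bar>x - y\<bar>"] by linarith
  ultimately show ?thesis unfolding BL_def by blast
qed

text \<open>A bounded function stays in a compact interval, so a locally Lipschitz \<open>h\<close>
  suffices; \<open>K C\<close> is its Lipschitz constant on \<open>[-C, C]\<close>. This serves
  exponentials, squares and cubes of clipped variables.\<close>

lemma BL_lip_comp:
  assumes "f \<in> BL" "\<And>x y C. \<bar>x\<bar> \<le> C \<Longrightarrow> \<bar>y\<bar> \<le> C \<Longrightarrow> \<bar>h x - h y\<bar> \<le> K C * \<bar>x - y\<bar>"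
  shows "(\<lambda>x. h (f x)) \<in> BL"
proof -
  obtain C where C: "\<And>x. \<bar>f x\<bar> \<le> C" "\<And>x y. \<bar>f x - f y\<bar> \<le> C * \<bar>x - y\<bar>" using assms(1) unfolding BL_def by blast
  have C0: "0 \<le> C" using C(1)[of 0] by linarith
  show ?thesis
  proof (rule BL_I)
    fix x y
    have "\<bar>h (f x) - h (f y)\<bar> \<le> K C * \<bar>f x - f y\<bar>" by (intro assms(2) C(1))
    also have "\<dots> \<le> \<bar>K C\<bar> * \<bar>f x - f y\<bar>" by (intro mult_right_mono) auto
    also have "\<dots> \<le> \<bar>K C\<bar> * (C * \<bar>x - y\<bar>)" using C(2) by (intro mult_left_mono) auto
    finally show "\<bar>h (f x) - h (f y)\<bar> \<le> (\<bar>K C\<bar> * C) * \<bar>x - y\<bar>" by (simp add: mult.assoc)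
    have "\<bar>h (f x) - h 0\<bar> \<le> K C * \<bar>f x\<bar>" using assms(2)[of "f x" C 0] C(1) C0 by simp
    also have "\<dots> \<le> \<bar>K C\<bar> * \<bar>f x\<bar>" by (intro mult_right_mono) auto
    also have "\<dots> \<le> \<bar>K C\<bar> * C" using C by (intro mult_left_mono) auto
    finally show "\<bar>h (f x)\<bar> \<le> \<bar>h 0\<bar> + \<bar>K C\<bar> * C" by linarith
  qed
qed

lemma BL_uminus: "f \<in> BL \<Longrightarrow> (\<lambda>x. - f x) \<in> BL"
  unfolding BL_def by (auto simp: abs_minus_commute[of "- _"] algebra_simps) (metis abs_minus_commute)

lemma BL_const: "(\<lambda>_. c) \<in> BL"
  by (rule BL_I[of _ "\<bar>c\<bar>" 0]) auto

text \<open>Several-variable version of \<open>BL\<close>; with the l1 distance coordinatewise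
  estimates simply add up. Dimension 0 is meaningful and describes functions of an empty
  past.\<close>

definition vBL :: "nat \<Rightarrow> (real list \<Rightarrow> real) set" where
  "vBL n = {\<phi>. \<exists>C. (\<forall>x. length x = n \<longrightarrow> \<bar>\<phi> x\<bar> \<le> C) \<and>
     (\<forall>x y. length x = n \<longrightarrow> length y = n \<longrightarrow> \<bar>\<phi> x - \<phi> y\<bar> \<le> C * (\<Sum>i<n. \<bar>x ! i - y ! i\<bar>))}"

lemma vBL_I:
  assumes "\<And>x. length x = n \<Longrightarrow> \<bar>\<phi> x\<bar> \<le> C"
    "\<And>x y. length x = n \<Longrightarrow> length y = n \<Longrightarrow> \<bar>\<phi> x - \<phi> y\<bar> \<le> D * (\<Sum>i<n. \<bar>x ! i - y ! i\<bar>)"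
  shows "\<phi> \<in> vBL n"
proof -
  have "\<bar>\<phi> x\<bar> \<le> max C D" if "length x = n" for x using assms(1)[OF that] by simp
  moreover have "\<bar>\<phi> x - \<phi> y\<bar> \<le> max C D * (\<Sum>i<n. \<bar>x ! i - y ! i\<bar>)" if "length x = n" "length y = n" for x y
  proof -
    have "D * (\<Sum>i<n. \<bar>x ! i - y ! i\<bar>) \<le> max C D * (\<Sum>i<n. \<bar>x ! i - y ! i\<bar>)"
      by (intro mult_right_mono sum_nonneg) auto
    thus ?thesis using assms(2)[OF that] by linarith
  qed
  ultimately show ?thesis unfolding vBL_def by blast
qed

lemma vBL_D:
  assumes "\<phi> \<in> vBL n"
  obtains C where "0 \<le> C" "\<And>x. length x = n \<Longrightarrow> \<bar>\<phi> x\<bar> \<le> C"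
    "\<And>x y. length x = n \<Longrightarrow> length y = n \<Longrightarrow> \<bar>\<phi> x - \<phi> y\<bar> \<le> C * (\<Sum>i<n. \<bar>x ! i - y ! i\<bar>)"
proof -
  obtain C where C: "\<And>x. length x = n \<Longrightarrow> \<bar>\<phi> x\<bar> \<le> C"
    "\<And>x y. length x = n \<Longrightarrow> length y = n \<Longrightarrow> \<bar>\<phi> x - \<phi> y\<bar> \<le> C * (\<Sum>i<n. \<bar>x ! i - y ! i\<bar>)"
    using assms unfolding vBL_def by blast
  have "0 \<le> C" using C(1)[of "replicate n 0"] by auto
  thus ?thesis using C that by blast
qed

lemma vBL_C_l_Lip: "\<phi> \<in> vBL n \<Longrightarrow> \<phi> \<in> C_l_Lip n"
  by (elim vBL_D, rule C_l_LipI) auto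

lemma vBL_const: "(\<lambda>_. c) \<in> vBL n"
  by (rule vBL_I[of _ _ "\<bar>c\<bar>" 0]) auto

lemma vBL_mult:
  assumes "\<phi> \<in> vBL n" "\<psi> \<in> vBL n" shows "(\<lambda>x. \<phi> x * \<psi> x) \<in> vBL n"
proof -
  obtain C where C: "0 \<le> C" "\<And>x. length x = n \<Longrightarrow> \<bar>\<phi> x\<bar> \<le> C"
    "\<And>x y. length x = n \<Longrightarrow> length y = n \<Longrightarrow> \<bar>\<phi> x - \<phi> y\<bar> \<le> C * (\<Sum>i<n. \<bar>x ! i - y ! i\<bar>)"
    using assms vBL_D by blast
  obtain D where D: "0 \<le> D" "\<And>x. length x = n \<Longrightarrow> \<bar>\<psi> x\<bar> \<le> D"
    "\<And>x y. length x = n \<Longrightarrow> length y = n \<Longrightarrow> \<bar>\<psi> x - \<psi> y\<bar> \<le> D * (\<Sum>i<n. \<bar>x ! i - y ! i\<bar>)"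
    using assms vBL_D by blast
  show ?thesis
  proof (rule vBL_I)
    fix x y :: "real list" assume l: "length x = n" "length y = n"
    let ?d = "\<Sum>i<n. \<bar>x ! i - y ! i\<bar>"
    have "\<phi> x * \<psi> x - \<phi> y * \<psi> y = \<phi> x * (\<psi> x - \<psi> y) + \<psi> y * (\<phi> x - \<phi> y)" by (simp add: algebra_simps)
    hence "\<bar>\<phi> x * \<psi> x - \<phi> y * \<psi> y\<bar> \<le> \<bar>\<phi> x\<bar> * \<bar>\<psi> x - \<psi> y\<bar> + \<bar>\<psi> y\<bar> * \<bar>\<phi> x - \<phi> y\<bar>"
      by (metis abs_mult abs_triangle_ineq)
    also have "\<dots> \<le> C * (D * ?d) + D * (C * ?d)"
      using C D l by (intro add_mono mult_mono) auto
    finally show "\<bar>\<phi> x * \<psi> x - \<phi> y * \<psi> y\<bar> \<le> (2 * C * D) * ?d" by (simp add: algebra_simps)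
  next
    fix x :: "real list" assume "length x = n"
    thus "\<bar>\<phi> x * \<psi> x\<bar> \<le> C * D" using C D unfolding abs_mult by (intro mult_mono) auto
  qed
qed

lemma vBL_uminus: "\<phi> \<in> vBL n \<Longrightarrow> (\<lambda>x. - \<phi> x) \<in> vBL n"
  using vBL_mult[OF vBL_const[of "-1"], of \<phi> n] by simp

lemma vBL_prod: "finite I \<Longrightarrow> (\<And>i. i \<in> I \<Longrightarrow> \<phi> i \<in> vBL n) \<Longrightarrow> (\<lambda>x. \<Prod>i\<in>I. \<phi> i x) \<in> vBL n"
  by (induction I rule: finite_induct) (auto intro: vBL_const vBL_mult)

lemma vBL_nth:
  assumes "f \<in> BL" "i < n" shows "(\<lambda>x. f (x ! i)) \<in> vBL n"
proof -
  obtain C where C: "\<And>x. \<bar>f x\<bar> \<le> C" "\<And>x y. \<bar>f x - f y\<bar> \<le> C * \<bar>x - y\<bar>" using assms(1) unfolding BL_def by blast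
  have C0: "0 \<le> C" using C(1)[of 0] by linarith
  show ?thesis
  proof (rule vBL_I)
    fix x y :: "real list" assume "length x = n" "length y = n"
    have "\<bar>x ! i - y ! i\<bar> \<le> (\<Sum>i<n. \<bar>x ! i - y ! i\<bar>)"
      using assms(2) by (intro member_le_sum) auto
    thus "\<bar>f (x ! i) - f (y ! i)\<bar> \<le> C * (\<Sum>i<n. \<bar>x ! i - y ! i\<bar>)"
      using C(2)[of "x ! i" "y ! i"] C0 by (meson mult_left_mono order_trans)
  qed (rule C)
qed

lemma vBL_comp:
  assumes "\<phi> \<in> vBL n" "\<And>x y C. \<bar>x\<bar> \<le> C \<Longrightarrow> \<bar>y\<bar> \<le> C \<Longrightarrow> \<bar>h x - h y\<bar> \<le> K C * \<bar>x - y\<bar>"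
  shows "(\<lambda>x. h (\<phi> x)) \<in> vBL n"
proof -
  obtain C where C: "0 \<le> C" "\<And>x. length x = n \<Longrightarrow> \<bar>\<phi> x\<bar> \<le> C"
    "\<And>x y. length x = n \<Longrightarrow> length y = n \<Longrightarrow> \<bar>\<phi> x - \<phi> y\<bar> \<le> C * (\<Sum>i<n. \<bar>x ! i - y ! i\<bar>)"
    using assms(1) vBL_D by blast
  show ?thesis
  proof (rule vBL_I)
    fix x y :: "real list" assume l: "length x = n" "length y = n"
    have "\<bar>h (\<phi> x) - h (\<phi> y)\<bar> \<le> K C * \<bar>\<phi> x - \<phi> y\<bar>" by (intro assms(2) C l)
    also have "\<dots> \<le> \<bar>K C\<bar> * \<bar>\<phi> x - \<phi> y\<bar>" by (intro mult_right_mono) auto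
    also have "\<dots> \<le> \<bar>K C\<bar> * (C * (\<Sum>i<n. \<bar>x ! i - y ! i\<bar>))" using C(3)[OF l] by (intro mult_left_mono) auto
    finally show "\<bar>h (\<phi> x) - h (\<phi> y)\<bar> \<le> (\<bar>K C\<bar> * C) * (\<Sum>i<n. \<bar>x ! i - y ! i\<bar>)" by (simp add: mult.assoc)
  next
    fix x :: "real list" assume l: "length x = n"
    have "\<bar>h (\<phi> x) - h 0\<bar> \<le> K C * \<bar>\<phi> x\<bar>" using assms(2)[of "\<phi> x" C 0] C(1,2) l by simp
    also have "\<dots> \<le> \<bar>K C\<bar> * C" using C l by (intro mult_mono) auto
    finally show "\<bar>h (\<phi> x)\<bar> \<le> \<bar>h 0\<bar> + \<bar>K C\<bar> * C" by linarith
  qed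
qed

lemma vBL_add:
  assumes "\<phi> \<in> vBL n" "\<psi> \<in> vBL n" shows "(\<lambda>x. \<phi> x + \<psi> x) \<in> vBL n"
proof -
  obtain C where C: "0 \<le> C" "\<And>x. length x = n \<Longrightarrow> \<bar>\<phi> x\<bar> \<le> C"
    "\<And>x y. length x = n \<Longrightarrow> length y = n \<Longrightarrow> \<bar>\<phi> x - \<phi> y\<bar> \<le> C * (\<Sum>i<n. \<bar>x ! i - y ! i\<bar>)"
    using assms vBL_D by blast
  obtain D where D: "0 \<le> D" "\<And>x. length x = n \<Longrightarrow> \<bar>\<psi> x\<bar> \<le> D"
    "\<And>x y. length x = n \<Longrightarrow> length y = n \<Longrightarrow> \<bar>\<psi> x - \<psi> y\<bar> \<le> D * (\<Sum>i<n. \<bar>x ! i - y ! i\<bar>)"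
    using assms vBL_D by blast
  show ?thesis
  proof (rule vBL_I)
    fix x y :: "real list" assume l: "length x = n" "length y = n"
    show "\<bar>\<phi> x + \<psi> x - (\<phi> y + \<psi> y)\<bar> \<le> (C + D) * (\<Sum>i<n. \<bar>x ! i - y ! i\<bar>)"
      using C(3)[OF l] D(3)[OF l] unfolding distrib_right by linarith
  next
    fix x :: "real list" assume l: "length x = n"
    show "\<bar>\<phi> x + \<psi> x\<bar> \<le> C + D" using C(2)[OF l] D(2)[OF l] by linarith
  qed
qed

lemma vBL_take: assumes "\<phi> \<in> vBL k" "k \<le> n" shows "(\<lambda>x. \<phi> (take k x)) \<in> vBL n"
proof -
  obtain C where C: "0 \<le> C" "\<And>x. length x = k \<Longrightarrow> \<bar>\<phi> x\<bar> \<le> C"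
    "\<And>x y. length x = k \<Longrightarrow> length y = k \<Longrightarrow> \<bar>\<phi> x - \<phi> y\<bar> \<le> C * (\<Sum>i<k. \<bar>x ! i - y ! i\<bar>)"
    using assms vBL_D by blast
  show ?thesis
  proof (rule vBL_I)
    fix x y :: "real list" assume l: "length x = n" "length y = n"
    have "\<bar>\<phi> (take k x) - \<phi> (take k y)\<bar> \<le> C * (\<Sum>i<k. \<bar>take k x ! i - take k y ! i\<bar>)"
      using l assms(2) by (intro C(3)) auto
    also have "\<dots> \<le> C * (\<Sum>i<n. \<bar>x ! i - y ! i\<bar>)"
      using C(1) assms(2) by (intro mult_left_mono) (auto intro!: sum_mono2)
    finally show "\<bar>\<phi> (take k x) - \<phi> (take k y)\<bar> \<le> C * (\<Sum>i<n. \<bar>x ! i - y ! i\<bar>)" .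
  next
    show "length x = n \<Longrightarrow> \<bar>\<phi> (take k x)\<bar> \<le> C" for x using assms(2) by (intro C(2)) auto
  qed
qed

lemma vBL_uminus_arg: assumes "\<phi> \<in> vBL n" shows "(\<lambda>x. \<phi> (map uminus x)) \<in> vBL n"
proof -
  obtain C where C: "0 \<le> C" "\<And>x. length x = n \<Longrightarrow> \<bar>\<phi> x\<bar> \<le> C"
    "\<And>x y. length x = n \<Longrightarrow> length y = n \<Longrightarrow> \<bar>\<phi> x - \<phi> y\<bar> \<le> C * (\<Sum>i<n. \<bar>x ! i - y ! i\<bar>)"
    using assms vBL_D by blast
  show ?thesis
  proof (rule vBL_I)
    fix x y :: "real list" assume l: "length x = n" "length y = n"
    have "\<bar>\<phi> (map uminus x) - \<phi> (map uminus y)\<bar> \<le> C * (\<Sum>i<n. \<bar>map uminus x ! i - map uminus y ! i\<bar>)"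
      using l by (intro C(3)) auto
    also have "(\<Sum>i<n. \<bar>map uminus x ! i - map uminus y ! i\<bar>) = (\<Sum>i<n. \<bar>x ! i - y ! i\<bar>)"
      using l by (intro sum.cong) auto
    finally show "\<bar>\<phi> (map uminus x) - \<phi> (map uminus y)\<bar> \<le> C * (\<Sum>i<n. \<bar>x ! i - y ! i\<bar>)" .
  next
    show "length x = n \<Longrightarrow> \<bar>\<phi> (map uminus x)\<bar> \<le> C" for x by (intro C(2)) auto
  qed
qed

lemma exp_lipschitz:
  fixes x y C :: real
  assumes "\<bar>x\<bar> \<le> C" "\<bar>y\<bar> \<le> C" shows "\<bar>exp x - exp y\<bar> \<le> exp C * \<bar>x - y\<bar>"
proof -
  have "exp x - exp y \<le> exp C * (x - y)" if "y \<le> x" "\<bar>x\<bar> \<le> C" for x y :: real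
  proof -
    have "exp y = exp x * exp (y - x)" unfolding exp_add[symmetric] by simp
    hence "exp x - exp y = exp x * (1 - exp (y - x))" unfolding right_diff_distrib by simp
    also have "\<dots> \<le> exp x * (x - y)"
    proof (rule mult_left_mono)
      have "1 + (y - x) \<le> exp (y - x)" by (rule exp_ge_add_one_self)
      thus "1 - exp (y - x) \<le> x - y" by linarith
    qed simp
    also have "\<dots> \<le> exp C * (x - y)" using that by (intro mult_right_mono) auto
    finally show ?thesis .
  qed
  from this[of x y] this[of y x] assms show ?thesis by (cases "x \<le> y") (auto simp: abs_if)
qed

section \<open>Truncation\<close>

definition clip :: "real \<Rightarrow> real \<Rightarrow> real" where
  "clip B x = max (- B) (min x B)"

lemma clip_bound: "0 \<le> B \<Longrightarrow> \<bar>clip B x\<bar> \<le> B"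
  and clip_abs_le: "0 \<le> B \<Longrightarrow> \<bar>clip B x\<bar> \<le> \<bar>x\<bar>"
  and clip_lip: "\<bar>clip B x - clip B y\<bar> \<le> \<bar>x - y\<bar>"
  and clip_mono: "x \<le> y \<Longrightarrow> clip B x \<le> clip B y"
  and clip_id: "\<bar>x\<bar> \<le> B \<Longrightarrow> clip B x = x"
  and clip_uminus: "0 \<le> B \<Longrightarrow> clip B (- x) = - clip B x"
  by (auto simp: clip_def)

text \<open>A Lipschitz substitute for the indicator of \<open>{x. r \<le> \<bar>x\<bar>}\<close>.\<close>

definition soft_ind :: "real \<Rightarrow> real \<Rightarrow> real" where
  "soft_ind r x = max 0 (min 1 (2 * \<bar>x\<bar> / r - 1))"

lemma soft_ind_01: "0 \<le> soft_ind r x" "soft_ind r x \<le> 1"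
  by (auto simp: soft_ind_def)

lemma soft_ind_one: "0 < r \<Longrightarrow> r \<le> \<bar>x\<bar> \<Longrightarrow> soft_ind r x = 1"
  by (auto simp: soft_ind_def field_simps max_def min_def)

lemma soft_ind_zero: "0 < r \<Longrightarrow> \<bar>x\<bar> < r / 2 \<Longrightarrow> soft_ind r x = 0"
  by (auto simp: soft_ind_def field_simps max_def min_def)

lemma soft_ind_lip: "0 < r \<Longrightarrow> \<bar>soft_ind r x - soft_ind r y\<bar> \<le> 2 / r * \<bar>x - y\<bar>"
proof -
  assume r: "0 < r"
  have "\<bar>soft_ind r x - soft_ind r y\<bar> \<le> \<bar>2 * \<bar>x\<bar> / r - 2 * \<bar>y\<bar> / r\<bar>"
    unfolding soft_ind_def by (auto simp: max_def min_def)
  also have "\<dots> = 2 / r * \<bar>\<bar>x\<bar> - \<bar>y\<bar>\<bar>"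
    using r by (simp add: abs_if field_simps)
  also have "\<dots> \<le> 2 / r * \<bar>x - y\<bar>" using r by (intro mult_left_mono) auto
  finally show ?thesis .
qed

lemma soft_ind_BL: "0 < r \<Longrightarrow> soft_ind r \<in> BL"
  using soft_ind_lip[of r] soft_ind_01[of r] by (intro BL_I[of _ 1 "2 / r"]) (auto simp: abs_of_nonneg)

lemma clip_BL: "0 \<le> B \<Longrightarrow> clip B \<in> BL"
  using clip_bound[of B] clip_lip[of B] by (intro BL_I[of _ B 1]) auto

lemma exp_clip_BL:
  assumes "0 \<le> B" "0 \<le> t" shows "(\<lambda>x. exp (t * clip B x)) \<in> BL"
proof (rule BL_lip_comp[OF clip_BL[OF assms(1)], of "\<lambda>y. exp (t * y)" "\<lambda>C. exp (t * C) * t"])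
  fix x y C :: real assume "\<bar>x\<bar> \<le> C" "\<bar>y\<bar> \<le> C"
  hence "\<bar>exp (t * x) - exp (t * y)\<bar> \<le> exp (t * C) * \<bar>t * x - t * y\<bar>"
    using assms(2) by (intro exp_lipschitz) (auto simp: abs_mult mult_left_mono)
  also have "\<bar>t * x - t * y\<bar> = t * \<bar>x - y\<bar>" using assms(2) by (simp flip: right_diff_distrib add: abs_mult)
  finally show "\<bar>exp (t * x) - exp (t * y)\<bar> \<le> exp (t * C) * t * \<bar>x - y\<bar>" by (simp add: mult.assoc)
qed

lemma clip_sq_BL: "0 \<le> B \<Longrightarrow> (\<lambda>x. (clip B x)\<^sup>2) \<in> BL"
proof (rule BL_lip_comp[OF clip_BL, of B "\<lambda>y. y\<^sup>2" "\<lambda>C. 2 * C"])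
  fix x y C :: real assume "\<bar>x\<bar> \<le> C" "\<bar>y\<bar> \<le> C"
  hence "\<bar>x + y\<bar> * \<bar>x - y\<bar> \<le> 2 * C * \<bar>x - y\<bar>" by (intro mult_right_mono) auto
  thus "\<bar>x\<^sup>2 - y\<^sup>2\<bar> \<le> 2 * C * \<bar>x - y\<bar>" by (simp add: power2_eq_square algebra_simps flip: abs_mult)
qed

lemma clip_cube_BL: "0 \<le> B \<Longrightarrow> (\<lambda>x. \<bar>clip B x\<bar> ^ 3) \<in> BL"
proof (rule BL_lip_comp[OF clip_BL, of B "\<lambda>y. \<bar>y\<bar> ^ 3" "\<lambda>C. 3 * C\<^sup>2"])
  fix x y C :: real assume C: "\<bar>x\<bar> \<le> C" "\<bar>y\<bar> \<le> C"
  let ?a = "\<bar>x\<bar>" and ?b = "\<bar>y\<bar>"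
  have "?a ^ 3 - ?b ^ 3 = (?a - ?b) * (?a * ?a + ?a * ?b + ?b * ?b)" by (simp add: power3_eq_cube algebra_simps)
  hence "\<bar>?a ^ 3 - ?b ^ 3\<bar> = \<bar>?a - ?b\<bar> * (?a * ?a + ?a * ?b + ?b * ?b)" by (simp add: abs_mult)
  also have "\<dots> \<le> \<bar>x - y\<bar> * (C * C + C * C + C * C)"
    using C by (intro mult_mono add_mono add_nonneg_nonneg) auto
  finally show "\<bar>?a ^ 3 - ?b ^ 3\<bar> \<le> 3 * C\<^sup>2 * \<bar>x - y\<bar>" by (simp add: power2_eq_square algebra_simps)
qed

text \<open>\<open>bmax B m x k\<close> is the maximum over \<open>m \<le> j \<le> k\<close> of the sums of \<open>clip B (x i)\<close>, \<open>j \<le> i < k\<close>. Unlike the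
  maximum of the initial sums, it satisfies a recursion in which the newest variable comes last.\<close>

primrec bmax :: "real \<Rightarrow> nat \<Rightarrow> (nat \<Rightarrow> real) \<Rightarrow> nat \<Rightarrow> real" where
  "bmax B m x 0 = 0"
| "bmax B m x (Suc k) = (if k < m then 0 else max 0 (bmax B m x k + clip B (x k)))"

lemma bmax_nonneg: "0 \<le> bmax B m x k"
  by (cases k) auto

lemma bmax_cong: "(\<And>i. i < k \<Longrightarrow> x i = y i) \<Longrightarrow> bmax B m x k = bmax B m y k"
  by (induction k) auto

lemma bmax_mono: "(\<And>i. i < k \<Longrightarrow> x i \<le> y i) \<Longrightarrow> bmax B m x k \<le> bmax B m y k"
proof (induction k)
  case (Suc k)
  have "bmax B m x k + clip B (x k) \<le> bmax B m y k + clip B (y k)"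
    by (intro add_mono Suc clip_mono) auto
  thus ?case by auto
qed simp

lemma bmax_zero: "k \<le> m \<Longrightarrow> bmax B m x k = 0"
  by (cases k) auto

lemma bmax_ge_sum: "m \<le> j \<Longrightarrow> j \<le> k \<Longrightarrow> (\<Sum>i=j..<k. clip B (x i)) \<le> bmax B m x k"
proof (induction k)
  case (Suc k)
  show ?case
  proof (cases "j = Suc k")
    case False
    hence "j \<le> k" using Suc.prems by simp
    moreover have "\<not> k < m" using \<open>j \<le> k\<close> Suc.prems by simp
    ultimately show ?thesis using Suc by auto
  qed (use bmax_nonneg[of B m x "Suc k"] in simp)
qed simp

lemma bmax_vBL: "0 \<le> B \<Longrightarrow> k \<le> n \<Longrightarrow> (\<lambda>xs. bmax B m ((!) xs) k) \<in> vBL n"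
proof (induction k)
  case (Suc k)
  show ?case
  proof (cases "k < m")
    case False
    have "(\<lambda>xs. bmax B m ((!) xs) k + clip B (xs ! k)) \<in> vBL n"
      using Suc by (intro vBL_add vBL_nth clip_BL) auto
    hence "(\<lambda>xs. max 0 (bmax B m ((!) xs) k + clip B (xs ! k))) \<in> vBL n"
      by (rule vBL_comp[where h = "max 0" and K = "\<lambda>_. 1"]) auto
    thus ?thesis using False by simp
  qed (simp add: vBL_const)
qed (simp add: vBL_const)

section \<open>Norming sequence of the law of the iterated logarithm\<close>

lemma max_ge_exp1: "0 < max x (exp (1::real))" "exp 1 \<le> max x (exp (1::real))"
  by (auto simp: less_max_iff_disj)

lemma log_e_ge_1: "1 \<le> log_e x"
  unfolding log_e_def using max_ge_exp1[of x] by (simp add: ln_ge_iff)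

lemma log_e_mono: "x \<le> y \<Longrightarrow> log_e x \<le> log_e y"
  unfolding log_e_def using max_ge_exp1[of x] by (intro ln_mono) auto

text \<open>Squaring the argument doubles a logarithm, and the cut-off at \<open>exp 1\<close> does
  no harm because the square on the right is itself at least \<open>exp 1\<close>.\<close>

lemma log_e_le_twice:
  assumes "a \<le> (max b (exp 1))\<^sup>2" shows "log_e a \<le> 2 * log_e b"
proof -
  have "exp 1 * 1 \<le> (max b (exp 1))\<^sup>2" unfolding power2_eq_square
    using max_ge_exp1[of b] by (intro mult_mono) (auto intro: order_trans[OF _ max_ge_exp1(2)])
  hence "max a (exp 1) \<le> (max b (exp 1))\<^sup>2" using assms by simp
  hence "ln (max a (exp 1)) \<le> ln ((max b (exp 1))\<^sup>2)" using max_ge_exp1[of a] by (intro ln_mono) auto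
  thus ?thesis unfolding log_e_def using max_ge_exp1[of b] by (simp add: ln_realpow)
qed

text \<open>The doubling bound is applied twice; the factor 2 left by the inner logarithm is
  absorbed by squaring, since \<open>2 \<le> exp 1\<close>.\<close>

lemma loglog_le_twice:
  assumes "0 \<le> y" "x \<le> y\<^sup>2"
  shows "log_e (log_e x) \<le> 2 * log_e (log_e y)"
proof (rule log_e_le_twice)
  have "x \<le> (max y (exp 1))\<^sup>2" using assms by (smt (verit) power_mono)
  hence "log_e x \<le> 2 * log_e y" by (rule log_e_le_twice)
  also have "\<dots> \<le> max (log_e y) (exp 1) * max (log_e y) (exp 1)"
    using log_e_ge_1[of y] exp_ge_add_one_self[of 1] by (intro mult_mono) auto
  finally show "log_e x \<le> (max (log_e y) (exp 1))\<^sup>2" by (simp add: power2_eq_square)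
qed

lemma log_e_le_self: "1 \<le> x \<Longrightarrow> log_e x \<le> x"
  unfolding log_e_def by (cases "x \<le> exp 1") (auto simp: max_def intro: order_trans[OF ln_le_minus_one])

text \<open>Monotonicity of \<open>log_e x / x\<close>: the logarithm grows by at most
  \<open>ln (y / x) \<le> y / x - 1\<close>, and \<open>1 \<le> log_e x\<close> makes this a
  relative bound.\<close>

lemma log_e_ratio:
  assumes "0 < x" "x \<le> y" shows "log_e y \<le> y / x * log_e x"
proof -
  have "max y (exp 1) / max x (exp 1) \<le> y / x"
    using assms max_ge_exp1[of x] by (auto simp: field_simps max_def)
  hence "ln (max y (exp 1) / max x (exp 1)) \<le> ln (y / x)"
    using assms max_ge_exp1[of x] max_ge_exp1[of y] by (intro ln_mono divide_pos_pos) auto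
  hence "log_e y - log_e x \<le> ln (y / x)"
    unfolding log_e_def using max_ge_exp1[of x] max_ge_exp1[of y] by (simp add: ln_div)
  also have "\<dots> \<le> y / x - 1" using assms by (intro ln_le_minus_one) auto
  also have "\<dots> \<le> (y / x - 1) * log_e x"
    using assms log_e_ge_1[of x] mult_left_mono[of 1 "log_e x" "y / x - 1"] by simp
  finally show ?thesis by (simp add: algebra_simps)
qed

lemma loglog_ratio:
  assumes "0 < x" "x \<le> y" shows "log_e (log_e y) \<le> y / x * log_e (log_e x)"
proof -
  have l: "0 < log_e x" "log_e x \<le> log_e y" using log_e_ge_1[of x] log_e_mono assms by auto
  have "log_e (log_e y) \<le> log_e y / log_e x * log_e (log_e x)" using log_e_ratio[OF l] .
  also have "\<dots> \<le> y / x * log_e (log_e x)"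
    using log_e_ratio[OF assms] l log_e_ge_1[of "log_e x"] by (intro mult_right_mono) (auto simp: field_simps)
  finally show ?thesis .
qed

lemma lil_norm_pos: "1 \<le> n \<Longrightarrow> 0 < lil_norm n"
  unfolding lil_norm_def using log_e_ge_1[of "log_e n"] by auto

lemma lil_norm_nonneg: "0 \<le> lil_norm n"
  unfolding lil_norm_def using log_e_ge_1[of "log_e n"] by auto

lemma lil_norm_sq: "(lil_norm n)\<^sup>2 = 2 * real n * log_e (log_e (real n))"
  unfolding lil_norm_def using log_e_ge_1[of "log_e n"] by auto

lemma lil_norm_mono: "m \<le> n \<Longrightarrow> lil_norm m \<le> lil_norm n"
  unfolding lil_norm_def using log_e_ge_1[of "log_e m"]
  by (intro real_sqrt_le_mono mult_mono log_e_mono) auto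

text \<open>As \<open>log_e (log_e x) / x\<close> is nonincreasing, so is
  \<open>lil_norm n / n\<close>. Inside a block this compares the right end with any earlier
  index.\<close>

lemma lil_norm_ratio:
  assumes "1 \<le> m" "m \<le> n" shows "lil_norm n \<le> real n / real m * lil_norm m"
proof -
  have "(lil_norm n)\<^sup>2 \<le> 2 * real n * (n / m * log_e (log_e (real m)))"
    unfolding lil_norm_sq using assms by (intro mult_left_mono loglog_ratio) auto
  also have "\<dots> = (real n / real m * lil_norm m)\<^sup>2"
    unfolding power_mult_distrib lil_norm_sq using assms by (simp add: field_simps power2_eq_square)
  finally show ?thesis by (rule power2_le_imp_le) (intro mult_nonneg_nonneg divide_nonneg_nonneg lil_norm_nonneg, auto)
qed

text \<open>Crude, by \<open>log_e (log_e n) \<le> log_e n \<le> 2 * sqrt n\<close>; any exponent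
  below 1 makes \<open>n / lil_norm n\<close> diverge.\<close>

lemma lil_norm_le_powr:
  assumes "3 \<le> n" shows "lil_norm n \<le> 2 * real n powr (3/4)"
proof -
  have e: "exp 1 \<le> real n" using assms exp_le by linarith
  have "log_e (log_e (real n)) \<le> log_e (real n)" by (rule log_e_le_self[OF log_e_ge_1])
  also have "\<dots> = 2 * ln (sqrt (real n))" unfolding log_e_def using e assms by (simp add: ln_sqrt)
  also have "\<dots> \<le> 2 * sqrt (real n)" using assms ln_bound[of "sqrt n"] by simp
  finally have "(lil_norm n)\<^sup>2 \<le> 2 * real n * (2 * sqrt (real n))"
    unfolding lil_norm_sq by (intro mult_left_mono) auto
  also have "\<dots> = (2 * real n powr (3/4))\<^sup>2"
    using assms by (simp add: power_mult_distrib power2_eq_square powr_half_sqrt[symmetric] flip: powr_add)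
      (simp add: powr_mult_base)
  finally show ?thesis by (rule power2_le_imp_le) auto
qed

lemma lil_norm_over_n: "filterlim (\<lambda>n. real n / lil_norm n) at_top sequentially"
proof (rule filterlim_at_top_mono)
  show "filterlim (\<lambda>n. (1/2) * real n powr (1/4)) at_top sequentially"
    by (intro filterlim_tendsto_pos_mult_at_top[OF tendsto_const]
         filterlim_compose[OF real_powr_at_top filterlim_real_sequentially]) auto
  show "\<forall>\<^sub>F n in sequentially. (1/2) * real n powr (1/4) \<le> real n / lil_norm n"
    using eventually_ge_at_top[of 3]
  proof eventually_elim
    case (elim n)
    have "(1/2) * real n powr (1/4) = real n / (2 * real n powr (3/4))"
      using elim by (simp add: field_simps flip: powr_add)
    also have "\<dots> \<le> real n / lil_norm n"
      using elim lil_norm_le_powr[of n] lil_norm_pos[of n] by (intro divide_left_mono) auto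
    finally show ?case .
  qed
qed

text \<open>The integrand of the Choquet condition (1). The cut-off in \<open>log_e\<close> makes
  the denominator at least 1.\<close>

definition lil_weight :: "real \<Rightarrow> real" where
  "lil_weight x = x\<^sup>2 / log_e (log_e \<bar>x\<bar>)"

lemma lil_weight_nonneg: "0 \<le> lil_weight x"
  unfolding lil_weight_def using log_e_ge_1[of "log_e \<bar>x\<bar>"] by auto

text \<open>The weight is at most the square, so \<open>n \<le> x\<^sup>2\<close> and the iterated
  logarithm of \<open>n\<close> is at most twice that of \<open>\<bar>x\<bar>\<close>. The constant
  16 is this 2 times the 8 in the square of \<open>2 * R * lil_norm n\<close>.\<close>

lemma lil_weight_ge_imp:
  assumes "1 \<le> n" "1 \<le> R" "16 * R\<^sup>2 * real n \<le> lil_weight x"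
  shows "2 * R * lil_norm n \<le> \<bar>x\<bar>"
proof -
  let ?l = "log_e (log_e \<bar>x\<bar>)"
  have l: "1 \<le> ?l" by (rule log_e_ge_1)
  have R: "1 \<le> R\<^sup>2" using assms(2) by simp
  have x: "16 * R\<^sup>2 * real n * ?l \<le> x\<^sup>2" using assms(3) l unfolding lil_weight_def by (simp add: field_simps)
  have "1 * real n * 1 \<le> 16 * R\<^sup>2 * real n * ?l" using l R by (intro mult_mono) auto
  hence "real n \<le> \<bar>x\<bar>\<^sup>2" using x by simp
  hence "log_e (log_e (real n)) \<le> 2 * ?l" by (intro loglog_le_twice) auto
  hence "8 * R\<^sup>2 * real n * log_e (log_e (real n)) \<le> 8 * R\<^sup>2 * real n * (2 * ?l)" by (intro mult_left_mono) auto
  moreover have "(2 * R * lil_norm n)\<^sup>2 = 8 * R\<^sup>2 * real n * log_e (log_e (real n))"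
    unfolding power_mult_distrib lil_norm_sq by simp
  moreover have "8 * R\<^sup>2 * real n * (2 * ?l) = 16 * R\<^sup>2 * real n * ?l" by simp
  ultimately have "(2 * R * lil_norm n)\<^sup>2 \<le> \<bar>x\<bar>\<^sup>2" using x unfolding power2_abs by linarith
  thus ?thesis by (rule power2_le_imp_le) auto
qed

lemma lil_weight_ge_abs: "1 \<le> \<bar>x\<bar> \<Longrightarrow> \<bar>x\<bar> \<le> lil_weight x"
proof -
  let ?l = "log_e (log_e \<bar>x\<bar>)"
  assume x: "1 \<le> \<bar>x\<bar>"
  have l: "1 \<le> ?l" by (rule log_e_ge_1)
  have "?l \<le> \<bar>x\<bar>" using log_e_le_self[OF log_e_ge_1] log_e_le_self[OF x] order_trans by blast
  hence "\<bar>x\<bar> * ?l \<le> \<bar>x\<bar> * \<bar>x\<bar>" by (intro mult_left_mono) auto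
  thus ?thesis using l unfolding lil_weight_def by (simp add: field_simps power2_eq_square)
qed

text \<open>For \<open>\<bar>x\<bar> \<le> n\<close> the iterated logarithms compare in the right
  direction, which gives \<open>2 * \<eta>\<^sup>2\<close>; for larger \<open>\<bar>x\<bar>\<close>
  the at least linear growth of the weight gives the constant 1.\<close>

lemma lil_weight_ge:
  assumes "1 \<le> n" "0 < \<eta>" "\<eta> * lil_norm n \<le> \<bar>x\<bar>"
  shows "min 1 (2 * \<eta>\<^sup>2) * real n \<le> lil_weight x"
proof (cases "\<bar>x\<bar> \<le> real n")
  case True
  let ?l = "log_e (log_e \<bar>x\<bar>)"
  have l: "1 \<le> ?l" by (rule log_e_ge_1)
  have "(\<eta> * lil_norm n)\<^sup>2 \<le> \<bar>x\<bar>\<^sup>2" using assms lil_norm_nonneg[of n] by (intro power_mono) auto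
  hence "2 * \<eta>\<^sup>2 * real n * log_e (log_e (real n)) \<le> x\<^sup>2" by (simp add: power_mult_distrib lil_norm_sq mult_ac)
  moreover have "2 * \<eta>\<^sup>2 * real n * ?l \<le> 2 * \<eta>\<^sup>2 * real n * log_e (log_e (real n))"
    using True by (intro mult_left_mono log_e_mono) auto
  ultimately have "2 * \<eta>\<^sup>2 * real n \<le> lil_weight x" using l unfolding lil_weight_def by (simp add: field_simps)
  moreover have "min 1 (2 * \<eta>\<^sup>2) * real n \<le> 2 * \<eta>\<^sup>2 * real n" by (intro mult_right_mono) auto
  ultimately show ?thesis by linarith
next
  case False
  hence "\<bar>x\<bar> \<le> lil_weight x" using assms(1) by (intro lil_weight_ge_abs) linarith
  moreover have "min 1 (2 * \<eta>\<^sup>2) * real n \<le> 1 * real n" by (intro mult_right_mono) auto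
  ultimately show ?thesis using False by linarith
qed

section \<open>Sub-linear expectations and capacities\<close>

lemma eval_vec_nth: "j < n \<Longrightarrow> eval_vec (map X [1..<n + 1]) w ! j = X (j + 1) w"
  by (simp add: eval_vec_def del: upt_Suc)

lemma length_eval_vec [simp]: "length (eval_vec Xs w) = length Xs"
  by (simp add: eval_vec_def)

text \<open>The past before time \<open>k + 1\<close>. Variables are numbered from 1 and list
  positions from 0, so position \<open>i\<close> holds \<open>X (i + 1)\<close>; for
  \<open>k = 0\<close> the list is empty.\<close>

definition hist :: "(nat \<Rightarrow> 'a \<Rightarrow> real) \<Rightarrow> nat \<Rightarrow> 'a \<Rightarrow> real list" where
  "hist X k w = eval_vec (map X [1..<k + 1]) w"

lemma length_hist [simp]: "length (hist X k w) = k"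
  by (simp add: hist_def del: upt_Suc)

lemma hist_nth: "i < k \<Longrightarrow> hist X k w ! i = X (i + 1) w"
  unfolding hist_def by (rule eval_vec_nth)

lemma hist_uminus: "hist (\<lambda>n w. - X n w) k w = map uminus (hist X k w)"
  by (rule nth_equalityI) (auto simp: hist_nth)

lemma take_hist: "take k (hist X (Suc k) w) = hist X k w"
  by (rule nth_equalityI) (auto simp: hist_nth)

context sublinear_expectation_space
begin

lemma H_lip:
  assumes "Z \<in> H" "\<And>x y. \<bar>f x - f y\<bar> \<le> C * \<bar>x - y\<bar>"
  shows "(\<lambda>w. f (Z w)) \<in> H"
  using H_comp[of "[Z]" "\<lambda>xs. f (xs ! 0)"] C_l_LipI1[of f C, OF assms(2)] assms(1)
  by (simp add: eval_vec_def)

lemma H_square: "Z \<in> H \<Longrightarrow> (\<lambda>w. (Z w)\<^sup>2) \<in> H"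
  using H_comp[of "[Z]" "\<lambda>xs. (xs ! 0)\<^sup>2"] square_C_l_Lip
  by (simp add: eval_vec_def)

lemma H_const: "(\<lambda>w. c) \<in> H"
  using H_lip[OF H_zero, of "\<lambda>_. c" 0] by simp

lemma H_abs: "Z \<in> H \<Longrightarrow> (\<lambda>w. \<bar>Z w\<bar>) \<in> H"
  by (rule H_lip[of Z abs 1]) auto

lemma H_uminus: "Z \<in> H \<Longrightarrow> (\<lambda>w. - Z w) \<in> H"
  using H_scale[of Z "-1"] by simp

lemma H_pos: "Z \<in> H \<Longrightarrow> (\<lambda>w. max (Z w) 0) \<in> H"
  by (rule H_lip[of Z "\<lambda>x. max x 0" 1]) auto

lemma H_diff: "Z \<in> H \<Longrightarrow> W \<in> H \<Longrightarrow> (\<lambda>w. Z w - W w) \<in> H"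
  using H_add[OF _ H_uminus, of Z W] by simp

lemma H_sum: "finite I \<Longrightarrow> (\<And>i. i \<in> I \<Longrightarrow> Z i \<in> H) \<Longrightarrow> (\<lambda>w. \<Sum>i\<in>I. Z i w) \<in> H"
  by (induction I rule: finite_induct) (auto intro: H_zero H_add)

lemma E_nonneg: "Z \<in> H \<Longrightarrow> (\<And>w. w \<in> space M \<Longrightarrow> 0 \<le> Z w) \<Longrightarrow> 0 \<le> E Z"
  using E_mono[OF _ H_zero, of Z] E_const[of 0] by (simp flip: zero_ereal_def)

lemma E_cong: "Z \<in> H \<Longrightarrow> (\<And>w. w \<in> space M \<Longrightarrow> Z w = W w) \<Longrightarrow> E Z = E W"
  using H_cong[of Z W] E_mono[of Z W] E_mono[of W Z] by (auto intro: antisym)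

section \<open>Integrable variables and real-valued expectations\<close>

definition L1 :: "('a \<Rightarrow> real) set" where
  "L1 = {Z \<in> H. E (\<lambda>w. \<bar>Z w\<bar>) < \<infinity>}"

definition er :: "('a \<Rightarrow> real) \<Rightarrow> real" where
  "er Z = real_of_ereal (E Z)"

lemma L1_H: "Z \<in> L1 \<Longrightarrow> Z \<in> H" by (simp add: L1_def)

lemma L1_mono:
  assumes "W \<in> L1" "Z \<in> H" "\<And>w. w \<in> space M \<Longrightarrow> \<bar>Z w\<bar> \<le> \<bar>W w\<bar>"
  shows "Z \<in> L1"
proof -
  have "E (\<lambda>w. \<bar>Z w\<bar>) \<le> E (\<lambda>w. \<bar>W w\<bar>)"
    using assms by (intro E_mono) (auto intro: H_abs L1_H)
  thus ?thesis using assms by (auto simp: L1_def)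
qed

lemma L1_const: "(\<lambda>_. c) \<in> L1"
  by (simp add: L1_def H_const E_const)

lemma L1_bounded:
  assumes "Z \<in> H" "\<And>w. w \<in> space M \<Longrightarrow> \<bar>Z w\<bar> \<le> C"
  shows "Z \<in> L1"
  using assms by (intro L1_mono[OF L1_const[of "C"]]) fastforce+

lemma E_er:
  assumes "Z \<in> L1" shows "E Z = ereal (er Z)"
proof -
  have Z: "Z \<in> H" and f: "E (\<lambda>w. \<bar>Z w\<bar>) < \<infinity>" using assms by (auto simp: L1_def)
  have 1: "E Z < \<infinity>" using E_mono[OF H_abs[OF Z] Z] f by fastforce
  have 2: "E (\<lambda>w. - Z w) < \<infinity>" using E_mono[OF H_abs[OF Z] H_uminus[OF Z]] f by fastforce
  \<comment> \<open>Otherwise sub-additivity applied to \<open>Z + (- Z)\<close> would bound the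
    expectation of 0 by minus infinity.\<close>
  have "E Z \<noteq> -\<infinity>"
  proof
    assume m: "E Z = -\<infinity>"
    hence "E (\<lambda>w. Z w + - Z w) \<le> E Z + E (\<lambda>w. - Z w)"
      using 1 2 by (intro E_subadd Z H_uminus) auto
    also have "\<dots> = -\<infinity>" using m 2 by (cases "E (\<lambda>w. - Z w)") auto
    finally show False by (simp add: E_const)
  qed
  thus ?thesis using 1 unfolding er_def by (cases "E Z") auto
qed

lemma L1_add:
  assumes "Z \<in> L1" "W \<in> L1" shows "(\<lambda>w. Z w + W w) \<in> L1"
proof -
  have H: "Z \<in> H" "W \<in> H" using assms by (auto simp: L1_def)
  have a: "E (\<lambda>w. \<bar>Z w\<bar>) < \<infinity>" "E (\<lambda>w. \<bar>W w\<bar>) < \<infinity>" using assms by (auto simp: L1_def)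
  have b: "0 \<le> E (\<lambda>w. \<bar>Z w\<bar>)" "0 \<le> E (\<lambda>w. \<bar>W w\<bar>)" using H by (auto intro!: E_nonneg H_abs)
  have "E (\<lambda>w. \<bar>Z w + W w\<bar>) \<le> E (\<lambda>w. \<bar>Z w\<bar> + \<bar>W w\<bar>)"
    using H by (intro E_mono H_abs H_add) auto
  also have "\<dots> \<le> E (\<lambda>w. \<bar>Z w\<bar>) + E (\<lambda>w. \<bar>W w\<bar>)"
    using a b by (intro E_subadd H_abs H) auto
  also have "\<dots> < \<infinity>" using a by auto
  finally show ?thesis using H by (auto simp: L1_def intro: H_add)
qed

lemma L1_scale:
  assumes "Z \<in> L1" shows "(\<lambda>w. c * Z w) \<in> L1"
proof -
  have "Z \<in> H" using assms by (auto simp: L1_def)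
  have "E (\<lambda>w. \<bar>c * Z w\<bar>) = ereal \<bar>c\<bar> * E (\<lambda>w. \<bar>Z w\<bar>)"
    unfolding abs_mult using assms by (intro E_scale) (auto simp: L1_def intro: H_abs)
  also have "\<dots> < \<infinity>"
    using assms E_nonneg[OF H_abs[OF \<open>Z \<in> H\<close>]] by (cases "E (\<lambda>w. \<bar>Z w\<bar>)") (auto simp: L1_def)
  finally show ?thesis using \<open>Z \<in> H\<close> by (auto simp: L1_def intro: H_scale)
qed

lemma L1_uminus: "Z \<in> L1 \<Longrightarrow> (\<lambda>w. - Z w) \<in> L1"
  using L1_scale[of Z "-1"] by simp

lemma L1_diff: "Z \<in> L1 \<Longrightarrow> W \<in> L1 \<Longrightarrow> (\<lambda>w. Z w - W w) \<in> L1"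
  using L1_add[OF _ L1_uminus, of Z W] by simp

lemma L1_sum: "finite I \<Longrightarrow> (\<And>i. i \<in> I \<Longrightarrow> Z i \<in> L1) \<Longrightarrow> (\<lambda>w. \<Sum>i\<in>I. Z i w) \<in> L1"
  by (induction I rule: finite_induct) (auto intro: L1_const L1_add)

lemma er_mono: "Z \<in> L1 \<Longrightarrow> W \<in> L1 \<Longrightarrow> (\<And>w. w \<in> space M \<Longrightarrow> Z w \<le> W w) \<Longrightarrow> er Z \<le> er W"
  using E_mono[of W Z] by (simp add: E_er L1_H)

lemma er_const: "er (\<lambda>_. c) = c"
  by (simp add: er_def E_const)

lemma er_add: "Z \<in> L1 \<Longrightarrow> W \<in> L1 \<Longrightarrow> er (\<lambda>w. Z w + W w) \<le> er Z + er W"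
  using E_subadd[of Z W] by (simp add: E_er L1_H L1_add)

lemma er_scale: "Z \<in> L1 \<Longrightarrow> 0 \<le> c \<Longrightarrow> er (\<lambda>w. c * Z w) = c * er Z"
  using E_scale[of Z c] by (simp add: E_er L1_H L1_scale)

lemma er_nonneg: "Z \<in> L1 \<Longrightarrow> (\<And>w. w \<in> space M \<Longrightarrow> 0 \<le> Z w) \<Longrightarrow> 0 \<le> er Z"
  using E_nonneg[of Z] by (simp add: E_er L1_H)

lemma er_sum: "finite I \<Longrightarrow> (\<And>i. i \<in> I \<Longrightarrow> Z i \<in> L1) \<Longrightarrow>
    er (\<lambda>w. \<Sum>i\<in>I. Z i w) \<le> (\<Sum>i\<in>I. er (Z i))"
proof (induction I rule: finite_induct)
  case (insert i I)
  have "er (\<lambda>w. Z i w + (\<Sum>i\<in>I. Z i w)) \<le> er (Z i) + er (\<lambda>w. \<Sum>i\<in>I. Z i w)"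
    using insert by (intro er_add L1_sum) auto
  thus ?case using insert by auto
qed (simp add: er_const)

text \<open>Constants are additive although \<open>E\<close> is only sub-additive: add
  \<open>c\<close> and then \<open>- c\<close>.\<close>

lemma er_shift: assumes "Z \<in> L1" shows "er (\<lambda>w. Z w + c) = er Z + c"
proof -
  have "er (\<lambda>w. (Z w + c) + - c) \<le> er (\<lambda>w. Z w + c) + er (\<lambda>_. - c)"
    by (intro er_add L1_add assms L1_const)
  thus ?thesis using er_add[OF assms L1_const, of c] by (simp add: er_const)
qed

lemma BL_L1: "f \<in> BL \<Longrightarrow> Z \<in> H \<Longrightarrow> (\<lambda>w. f (Z w)) \<in> L1"
proof -
  assume f: "f \<in> BL" and Z: "Z \<in> H"
  then obtain C where "\<And>x. \<bar>f x\<bar> \<le> C" "\<And>x y. \<bar>f x - f y\<bar> \<le> C * \<bar>x - y\<bar>" unfolding BL_def by blast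
  thus ?thesis using L1_bounded[OF H_lip[OF Z, of f C]] by blast
qed

lemma BL_ident:
  assumes "identically_distributed E X" "\<And>n. n \<ge> 1 \<Longrightarrow> X n \<in> H" "f \<in> BL" "i \<ge> 1"
  shows "er (\<lambda>w. f (X i w)) = er (\<lambda>w. f (X 1 w))"
proof -
  from assms(3) obtain C where "\<And>x y. \<bar>f x - f y\<bar> \<le> C * \<bar>x - y\<bar>" unfolding BL_def by blast
  hence "(\<lambda>xs. f (xs ! 0)) \<in> C_l_Lip 1" using C_l_LipI1[of f C] by simp
  hence "\<bar>E (\<lambda>w. f (X i w))\<bar> \<noteq> \<infinity> \<longrightarrow> \<bar>E (\<lambda>w. f (X 1 w))\<bar> \<noteq> \<infinity> \<longrightarrow>
      E (\<lambda>w. f (X i w)) = E (\<lambda>w. f (X 1 w))"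
    using assms(1,4) unfolding identically_distributed_def
    by (elim allE[of _ i]) (force dest: bspec[of _ _ "\<lambda>xs. f (xs ! 0)"])
  moreover have "E (\<lambda>w. f (X j w)) = ereal (er (\<lambda>w. f (X j w)))" if "j \<ge> 1" for j
    using assms(2,3) that by (intro E_er BL_L1)
  ultimately have "E (\<lambda>w. f (X i w)) = E (\<lambda>w. f (X 1 w))" using assms(4) by simp
  thus ?thesis by (simp add: er_def)
qed

lemma vBL_L1:
  assumes "\<phi> \<in> vBL (length Xs)" "set Xs \<subseteq> H" "Xs \<noteq> []"
  shows "(\<lambda>w. \<phi> (eval_vec Xs w)) \<in> L1"
proof -
  obtain C where "\<And>x. length x = length Xs \<Longrightarrow> \<bar>\<phi> x\<bar> \<le> C" using assms vBL_D by blast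
  thus ?thesis using assms by (intro L1_bounded[of _ C] H_comp vBL_C_l_Lip) auto
qed

lemma hist_L1:
  assumes "\<And>n. n \<ge> 1 \<Longrightarrow> X n \<in> H" "\<phi> \<in> vBL k"
  shows "(\<lambda>w. \<phi> (hist X k w)) \<in> L1"
proof (cases "k = 0")
  case True
  thus ?thesis by (simp add: hist_def eval_vec_def L1_const)
next
  case False
  show ?thesis unfolding hist_def using assms False by (intro vBL_L1) (auto simp del: upt_Suc)
qed

text \<open>The product is a bounded Lipschitz function of the past of length
  \<open>k + 1\<close>.\<close>

lemma hist_mult_L1:
  assumes "\<And>n. n \<ge> 1 \<Longrightarrow> X n \<in> H" "\<phi> \<in> vBL k" "f \<in> BL"
  shows "(\<lambda>w. \<phi> (hist X k w) * f (X (k + 1) w)) \<in> L1"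
proof -
  have "(\<lambda>w. (\<lambda>x. \<phi> (take k x) * f (x ! k)) (hist X (Suc k) w)) \<in> L1"
    using assms by (intro hist_L1 vBL_mult vBL_take vBL_nth) auto
  thus ?thesis by (simp add: take_hist hist_nth)
qed

section \<open>The upper capacity\<close>

abbreviation V :: "'a set \<Rightarrow> ereal" where "V \<equiv> upper_cap M H E"

abbreviation Vs :: "'a set \<Rightarrow> ereal" where "Vs \<equiv> outer_cap M H E"

abbreviation tail :: "('a \<Rightarrow> real) \<Rightarrow> real \<Rightarrow> 'a set" where
  "tail Z c \<equiv> {w\<in>space M. c \<le> \<bar>Z w\<bar>}"

abbreviation weight_tail :: "('a \<Rightarrow> real) \<Rightarrow> real \<Rightarrow> 'a set" where
  "weight_tail Z c \<equiv> {w\<in>space M. c \<le> lil_weight (Z w)}"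

definition cap :: "'a set \<Rightarrow> real" where "cap A = real_of_ereal (V A)"

lemma V_upper: "\<xi> \<in> H \<Longrightarrow> (\<And>w. w \<in> space M \<Longrightarrow> indicator A w \<le> \<xi> w) \<Longrightarrow> V A \<le> E \<xi>"
  unfolding upper_cap_def by (rule Inf_lower) auto

lemma V_lower:
  assumes "\<And>\<xi>. \<xi> \<in> H \<Longrightarrow> (\<And>w. w \<in> space M \<Longrightarrow> indicator A w \<le> \<xi> w) \<Longrightarrow> c \<le> E \<xi>"
  shows "c \<le> V A"
  unfolding upper_cap_def by (rule Inf_greatest) (use assms in auto)

lemma V_nonneg: "0 \<le> V A"
  by (rule V_lower) (metis E_nonneg indicator_pos_le order_trans)

lemma V_le_1: "V A \<le> 1"
  using V_upper[OF H_const[of 1], of A] by (simp add: E_const indicator_le_1 one_ereal_def)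

lemma V_cap: "V A = ereal (cap A)"
  using V_nonneg[of A] V_le_1[of A] unfolding cap_def by (cases "V A") auto

lemma cap_nonneg: "0 \<le> cap A" and cap_le_1: "cap A \<le> 1"
  using V_nonneg[of A] V_le_1[of A] by (simp_all add: V_cap)

lemma cap_upper: "\<xi> \<in> L1 \<Longrightarrow> (\<And>w. w \<in> space M \<Longrightarrow> indicator A w \<le> \<xi> w) \<Longrightarrow> cap A \<le> er \<xi>"
  using V_upper[of \<xi> A] by (simp add: V_cap E_er L1_H)

text \<open>Every function that competes in the infimum lies above the indicator, hence above
  \<open>f\<close>.\<close>

lemma V_lower_E:
  "f \<in> H \<Longrightarrow> (\<And>w. w \<in> space M \<Longrightarrow> f w \<le> indicator A w) \<Longrightarrow> E f \<le> V A"
  by (rule V_lower) (meson E_mono order_trans)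

lemma cap_lower_er:
  "f \<in> L1 \<Longrightarrow> (\<And>w. w \<in> space M \<Longrightarrow> f w \<le> indicator A w) \<Longrightarrow> er f \<le> cap A"
  using V_lower_E[of f A] by (simp add: V_cap E_er L1_H)

lemma cap_mono: assumes "A \<inter> space M \<subseteq> B" shows "cap A \<le> cap B"
proof -
  have "V A \<le> V B"
  proof (rule V_lower)
    fix \<xi> assume x: "\<xi> \<in> H" "\<And>w. w \<in> space M \<Longrightarrow> indicator B w \<le> \<xi> w"
    show "V A \<le> E \<xi>"
    proof (rule V_upper[OF x(1)])
      fix w assume w: "w \<in> space M"
      have "indicator A w \<le> (indicator B w :: real)" using assms w by (auto simp: indicator_def)
      thus "indicator A w \<le> \<xi> w" using x(2)[OF w] by linarith
    qed
  qed
  thus ?thesis by (simp add: V_cap)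
qed

lemma cap_empty: "cap {} = 0"
  using cap_upper[OF L1_const[of 0], of "{}"] cap_nonneg[of "{}"] by (simp add: er_const)

lemma cap_space: "A \<inter> space M = space M \<Longrightarrow> cap A = 1"
  using cap_lower_er[OF L1_const[of 1], of A] cap_le_1[of A] by (force simp: er_const indicator_def)

lemma V_approx:
  assumes "e > 0"
  obtains \<xi> where "\<xi> \<in> L1" "\<And>w. w \<in> space M \<Longrightarrow> indicator A w \<le> \<xi> w" "er \<xi> < cap A + e"
proof -
  have "V A < ereal (cap A + e)" using assms by (simp add: V_cap)
  then obtain \<xi> where x: "\<xi> \<in> H" "\<And>w. w \<in> space M \<Longrightarrow> indicator A w \<le> \<xi> w" "E \<xi> < ereal (cap A + e)"
    unfolding upper_cap_def Inf_less_iff by auto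
  \<comment> \<open>A function above an indicator is nonnegative, so finite expectation already
    means integrability.\<close>
  have "E (\<lambda>w. \<bar>\<xi> w\<bar>) = E \<xi>"
    using x(1) order_trans[OF indicator_pos_le x(2)] by (intro E_cong[symmetric]) auto
  hence "\<xi> \<in> L1" using x by (auto simp: L1_def)
  moreover have "er \<xi> < cap A + e" using x(3) by (simp add: E_er[OF \<open>\<xi> \<in> L1\<close>])
  ultimately show ?thesis using that x(2) by blast
qed

lemma cap_Un: "cap (A \<union> B) \<le> cap A + cap B"
proof (rule field_le_epsilon)
  fix e :: real assume "0 < e"
  obtain \<xi> where x: "\<xi> \<in> L1" "\<And>w. w \<in> space M \<Longrightarrow> indicator A w \<le> \<xi> w" "er \<xi> < cap A + e/2"
    using V_approx[of "e/2" A] \<open>0 < e\<close> by auto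
  obtain \<zeta> where z: "\<zeta> \<in> L1" "\<And>w. w \<in> space M \<Longrightarrow> indicator B w \<le> \<zeta> w" "er \<zeta> < cap B + e/2"
    using V_approx[of "e/2" B] \<open>0 < e\<close> by auto
  have "cap (A \<union> B) \<le> er (\<lambda>w. \<xi> w + \<zeta> w)"
  proof (rule cap_upper)
    fix w assume "w \<in> space M"
    thus "indicator (A \<union> B) w \<le> \<xi> w + \<zeta> w" using x(2)[of w] z(2)[of w] 
      by (auto simp: indicator_def split: if_splits)
  qed (use x z in \<open>auto intro: L1_add\<close>)
  thus "cap (A \<union> B) \<le> cap A + cap B + e" using er_add[OF x(1) z(1)] x(3) z(3) by linarith
qed

lemma cap_UN: "finite I \<Longrightarrow> cap (\<Union>i\<in>I. A i) \<le> (\<Sum>i\<in>I. cap (A i))"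
proof (induction I rule: finite_induct)
  case (insert i I)
  thus ?case using cap_Un[of "A i" "\<Union>i\<in>I. A i"] by auto
qed (simp add: cap_empty)

lemma cap_markov:
  assumes "Z \<in> L1" "\<And>w. w \<in> space M \<Longrightarrow> 0 \<le> Z w" "x > 0"
    "\<And>w. w \<in> space M \<Longrightarrow> w \<in> A \<Longrightarrow> x \<le> Z w"
  shows "cap A \<le> er Z / x"
proof -
  have "cap A \<le> er (\<lambda>w. (1/x) * Z w)"
    using assms by (intro cap_upper L1_scale) (auto simp: indicator_def)
  thus ?thesis using assms by (subst (asm) er_scale) auto
qed

text \<open>Only the expectation of \<open>soft_ind r\<close> is transferred by identical
  distribution; it lies between the tail capacities at \<open>r\<close> and at
  \<open>r / 2\<close>.\<close>

lemma tail_ident: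
  assumes "identically_distributed E X" "\<And>n. n \<ge> 1 \<Longrightarrow> X n \<in> H" "i \<ge> 1" "0 < r"
  shows "cap (tail (X i) r) \<le> er (\<lambda>w. soft_ind r (X 1 w))"
    and "er (\<lambda>w. soft_ind r (X 1 w)) \<le> cap (tail (X 1) (r / 2))"
proof -
  have "cap (tail (X i) r) \<le> er (\<lambda>w. soft_ind r (X i w))"
    using assms soft_ind_01
    by (intro cap_upper BL_L1[of "soft_ind r"] soft_ind_BL) (auto simp: soft_ind_one indicator_def)
  thus "cap (tail (X i) r) \<le> er (\<lambda>w. soft_ind r (X 1 w))"
    using BL_ident[OF assms(1,2) soft_ind_BL assms(3)] assms(4) by simp
  show "er (\<lambda>w. soft_ind r (X 1 w)) \<le> cap (tail (X 1) (r / 2))"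
  proof (rule cap_lower_er)
    fix w show "w \<in> space M \<Longrightarrow> soft_ind r (X 1 w) \<le> indicator {w \<in> space M. r / 2 \<le> \<bar>X 1 w\<bar>} w"
      using soft_ind_01[of r "X 1 w"] soft_ind_zero[of r "X 1 w"] assms(4) by (auto simp: indicator_def)
  qed (use assms BL_L1[OF soft_ind_BL[of r], of "X 1"] in auto)
qed

lemma sets_ge: "Z \<in> H \<Longrightarrow> {w\<in>space M. c \<le> Z w} \<in> sets M"
  by (intro borel_measurable_le borel_measurable_const H_measurable)

lemma UN_tail_sets:
  fixes I :: "nat set"
  assumes "\<And>i. i \<in> I \<Longrightarrow> Z i \<in> H"
  shows "(\<Union>i\<in>I. tail (Z i) (c i)) \<in> sets M"
  by (intro sets.countable_UN' image_subsetI sets_ge H_abs assms) auto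

end

lemma continuous_cap_incseq:
  "continuous_cap M W \<Longrightarrow> (\<And>n. A n \<in> sets M) \<Longrightarrow> incseq A \<Longrightarrow> (\<lambda>n. W (A n)) \<longlonglongrightarrow> W (\<Union>n. A n)"
  unfolding continuous_cap_def by (elim allE[of _ A]) simp

lemma continuous_cap_decseq:
  "continuous_cap M W \<Longrightarrow> (\<And>n. A n \<in> sets M) \<Longrightarrow> decseq A \<Longrightarrow> (\<lambda>n. W (A n)) \<longlonglongrightarrow> W (\<Inter>n. A n)"
  unfolding continuous_cap_def by (elim allE[of _ A]) simp

context sublinear_expectation_space
begin

section \<open>The outer capacity and its comparison with the capacity\<close>

lemma Vs_nonneg: "0 \<le> Vs A"
  unfolding outer_cap_def by (rule Inf_greatest) (auto intro!: suminf_nonneg summable_ereal_pos V_nonneg)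

lemma Vs_upper: "(\<And>n. B n \<in> sets M) \<Longrightarrow> A \<subseteq> (\<Union>n. B n) \<Longrightarrow> Vs A \<le> (\<Sum>n. V (B n))"
  unfolding outer_cap_def by (rule Inf_lower) auto

lemma Vs_mono: "A \<subseteq> B \<Longrightarrow> Vs A \<le> Vs B"
  unfolding outer_cap_def by (rule Inf_superset_mono) blast

lemma Vs_null_subset: "Vs B = 0 \<Longrightarrow> A \<subseteq> B \<Longrightarrow> Vs A = 0"
  using Vs_mono[of A B] Vs_nonneg[of A] by (simp add: antisym)

lemma Vs_le_V: assumes "A \<in> sets M" shows "Vs A \<le> V A"
proof -
  let ?B = "\<lambda>n::nat. if n = 0 then A else {}"
  have "Vs A \<le> (\<Sum>n. V (?B n))" using assms by (intro Vs_upper) auto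
  also have "\<dots> = (\<Sum>n\<in>{0}. V (?B n))" by (rule suminf_finite) (auto simp: V_cap cap_empty)
  finally show ?thesis by simp
qed

text \<open>Direct half of the Borel-Cantelli lemma: each remainder of the sequence is an admissible
  cover of \<open>A\<close>, and the remainders of a convergent series tend to 0.\<close>

lemma Vs_limsup_null:
  assumes C: "\<And>k. C k \<in> sets M" and s: "summable (\<lambda>k. cap (C k))" and A: "\<And>K. A \<subseteq> (\<Union>k\<in>{K..}. C k)"
  shows "Vs A = 0"
proof (rule antisym)
  have "Vs A \<le> ereal (\<Sum>k. cap (C (k + K)))" for K
  proof -
    have "A \<subseteq> (\<Union>k. C (k + K))"
    proof
      fix x assume "x \<in> A"
      then obtain k where "k \<ge> K" "x \<in> C k" using A[of K] by blast
      thus "x \<in> (\<Union>k. C (k + K))" by (intro UN_I[of "k - K"]) auto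
    qed
    hence "Vs A \<le> (\<Sum>k. V (C (k + K)))" using C by (intro Vs_upper)
    also have "\<dots> = ereal (\<Sum>k. cap (C (k + K)))"
      unfolding V_cap using s by (intro suminf_ereal' summable_ignore_initial_segment[of _ K])
    finally show ?thesis .
  qed
  moreover have "(\<lambda>K. ereal (\<Sum>k. cap (C (k + K)))) \<longlonglongrightarrow> ereal 0"
    using suminf_exist_split2[OF s] by (intro tendsto_ereal)
  ultimately have "Vs A \<le> ereal 0" by (intro LIMSEQ_le_const[of _ "ereal 0" "Vs A"]) blast+
  thus "Vs A \<le> 0" by (simp add: zero_ereal_def)
qed (rule Vs_nonneg)

text \<open>The usual argument for outer measures: the set with index \<open>m\<close> is covered at
  cost below \<open>e / 2 ^ (m + 1)\<close>, and the covers are merged.\<close>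

lemma Vs_UN_null:
  assumes "\<And>m::nat. Vs (A m) = 0" shows "Vs (\<Union>m. A m) = 0"
proof (rule antisym)
  show "Vs (\<Union>m. A m) \<le> 0"
  proof (rule ereal_le_epsilon2)
    fix e :: real assume e: "0 < e"
    have "\<exists>B. (\<forall>n. B n \<in> sets M) \<and> A m \<subseteq> (\<Union>n::nat. B n) \<and> (\<Sum>n. V (B n)) < ereal (e * (1/2) ^ Suc m)" for m
    proof -
      have "Vs (A m) < ereal (e * (1/2) ^ Suc m)" using assms e by simp
      thus ?thesis unfolding outer_cap_def Inf_less_iff by blast
    qed
    then obtain B where B: "\<And>m n. B m n \<in> sets M" "\<And>m. A m \<subseteq> (\<Union>n::nat. B m n)"
      "\<And>m. (\<Sum>n. V (B m n)) < ereal (e * (1/2) ^ Suc m)" by metis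
    have sm: "summable (\<lambda>n. cap (B m n))" for m
      using B(3)[of m] unfolding V_cap by (intro summable_ereal cap_nonneg) auto
    define S where "S = (\<lambda>m. \<Sum>n. cap (B m n))"
    have S: "0 \<le> S m" "S m \<le> e * (1/2) ^ Suc m" for m
    proof -
      show "0 \<le> S m" unfolding S_def by (intro suminf_nonneg sm cap_nonneg)
      have "(\<Sum>n. V (B m n)) = ereal (S m)" unfolding V_cap S_def using sm by (rule suminf_ereal')
      thus "S m \<le> e * (1/2) ^ Suc m" using B(3)[of m] by simp
    qed
    have geo: "(\<lambda>m. e * (1/2) ^ Suc m) sums e" using sums_mult[OF power_half_series, of e] by simp
    have sS: "summable S" by (rule summable_comparison_test'[OF sums_summable[OF geo], of 0]) (use S in auto)
    \<comment> \<open>The double family is enumerated as one sequence; its sum is rearranged in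
      \<open>ennreal\<close>, where convergence is no issue.\<close>
    let ?B = "\<lambda>i. case prod_decode i of (m, n) \<Rightarrow> B m n"
    have "(\<Sum>i. ennreal (cap (?B i))) = (\<Sum>i. (\<lambda>(m, n). ennreal (cap (B m n))) (prod_decode i))"
      by (intro suminf_cong) (simp split: prod.split)
    also have "\<dots> = (\<Sum>m. ennreal (S m))"
      unfolding S_def using sm cap_nonneg by (intro suminf_ennreal_2dimen) (simp add: suminf_ennreal2)
    also have "\<dots> = ennreal (suminf S)" using S sS by (intro suminf_ennreal2) auto
    also have "\<dots> \<le> ennreal e"
      using suminf_le[OF S(2) sS sums_summable[OF geo]] sums_unique[OF geo] by (intro ennreal_leI) simp
    finally have le: "(\<Sum>i. ennreal (cap (?B i))) \<le> ennreal e" .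
    hence sB: "summable (\<lambda>i. cap (?B i))" by (intro summable_suminf_not_top cap_nonneg) (auto simp: top_unique)
    have "(\<Union>m. A m) \<subseteq> (\<Union>i. ?B i)"
    proof
      fix x assume "x \<in> (\<Union>m. A m)"
      then obtain m n where "x \<in> B m n" using B(2) by blast
      thus "x \<in> (\<Union>i. ?B i)" by (intro UN_I[of "prod_encode (m, n)"]) auto
    qed
    hence "Vs (\<Union>m. A m) \<le> (\<Sum>i. V (?B i))" using B(1) by (intro Vs_upper) (auto split: prod.split)
    also have "\<dots> = ereal (\<Sum>i. cap (?B i))" unfolding V_cap using sB by (rule suminf_ereal')
    also have "\<dots> \<le> ereal e" using le e sB cap_nonneg by (subst (asm) suminf_ennreal2) (auto simp: suminf_nonneg)
    finally show "Vs (\<Union>m. A m) \<le> 0 + ereal e" by simp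
  qed
qed (rule Vs_nonneg)

text \<open>The countable sub-additivity of \<open>E\<close> in (b) and the continuity of \<open>V\<close> in (c) both give this lower bound for
  the outer capacity, after which the two parts have a common proof.\<close>

definition dominated :: bool where
  "dominated \<longleftrightarrow> (\<forall>A\<in>sets M. \<forall>f\<in>L1.
     (\<forall>w\<in>space M. f w \<le> indicator A w) \<longrightarrow> ereal (er f) \<le> Vs A)"

lemma dominatedD:
  "dominated \<Longrightarrow> A \<in> sets M \<Longrightarrow> f \<in> L1 \<Longrightarrow>
    (\<And>w. w \<in> space M \<Longrightarrow> f w \<le> indicator A w) \<Longrightarrow> ereal (er f) \<le> Vs A"
  by (simp add: dominated_def)

text \<open>Given a cover of \<open>A\<close>, choose nearly optimal functions above the indicators
  of its members, with errors adding up to \<open>e\<close>. Their series lies above the positive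
  part of \<open>f\<close>, and countable sub-additivity applies.\<close>

lemma dominated_countably_subadd:
  assumes "countably_subadd_exp M H E" shows dominated
  unfolding dominated_def
proof (intro ballI impI)
  fix A f assume A: "A \<in> sets M" and f: "f \<in> L1" and le: "\<forall>w\<in>space M. f w \<le> indicator A w"
  let ?g = "\<lambda>w. max (f w) 0"
  have g: "?g \<in> H" using f by (intro H_pos L1_H)
  show "ereal (er f) \<le> Vs A"
    unfolding outer_cap_def
  proof (rule Inf_greatest, clarify)
    fix B :: "nat \<Rightarrow> 'a set" assume B: "\<forall>n. B n \<in> sets M" "A \<subseteq> (\<Union>n. B n)"
    show "ereal (er f) \<le> (\<Sum>n. V (B n))"
    proof (rule ereal_le_epsilon2)
      fix e :: real assume e: "0 < e"
      have "\<exists>\<xi>. \<xi> \<in> L1 \<and> (\<forall>w\<in>space M. indicator (B n) w \<le> \<xi> w) \<and> er \<xi> < cap (B n) + e * (1/2)^Suc n" for n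
      proof -
        have "0 < e * (1/2)^Suc n" using e by simp
        from V_approx[OF this, of "B n"] show ?thesis by metis
      qed
      then obtain \<xi> where x: "\<And>n. \<xi> n \<in> L1" "\<And>n w. w \<in> space M \<Longrightarrow> indicator (B n) w \<le> \<xi> n w"
        "\<And>n. er (\<xi> n) < cap (B n) + e * (1/2)^Suc n" by metis
      have x0: "0 \<le> \<xi> n w" if "w \<in> space M" for n w
        using order_trans[OF indicator_pos_le x(2)[OF that, of n]] .
      have "ereal (?g w) \<le> (\<Sum>n. ereal (\<xi> n w))" if w: "w \<in> space M" for w
      proof (cases "w \<in> A")
        case True
        then obtain n where "w \<in> B n" using B by auto
        have "ereal (?g w) \<le> ereal (\<xi> n w)" using le w True x(2)[OF w, of n] \<open>w \<in> B n\<close> by (force simp: indicator_def)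
        also have "\<dots> = (\<Sum>n\<in>{n}. ereal (\<xi> n w))" by simp
        also have "\<dots> \<le> (\<Sum>n. ereal (\<xi> n w))" using x0[OF w] by (intro sum_le_suminf summable_ereal_pos) auto
        finally show ?thesis .
      next
        case False
        have "f w \<le> indicator A w" using le w by blast
        hence "?g w = 0" using False by (auto simp: indicator_def max_def)
        thus ?thesis using x0[OF w] by (auto intro!: suminf_nonneg summable_ereal_pos simp flip: zero_ereal_def)
      qed
      hence "E ?g \<le> (\<Sum>n. E (\<xi> n))"
        using assms g x(1) x0 unfolding countably_subadd_exp_def by (auto simp: L1_H)
      also have "\<dots> \<le> (\<Sum>n. V (B n) + ereal (e * (1/2)^Suc n))"
        using x x0 E_nonneg[of "\<xi> _"] e 
        by (intro suminf_le summable_ereal_pos add_nonneg_nonneg V_nonneg)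
           (auto simp: E_er V_cap L1_H less_imp_le)
      also have "\<dots> = (\<Sum>n. V (B n)) + (\<Sum>n. ereal (e * (1/2)^Suc n))"
        using e by (intro suminf_add_ereal V_nonneg) auto
      also have "(\<Sum>n. ereal (e * (1/2)^Suc n)) = ereal e"
        using sums_mult[OF power_half_series, of e] by (intro sums_unique[symmetric]) (simp add: sums_ereal)
      finally have "E ?g \<le> (\<Sum>n. V (B n)) + ereal e" .
      moreover have "E f \<le> E ?g" using g L1_H[OF f] by (intro E_mono) auto
      ultimately show "ereal (er f) \<le> (\<Sum>n. V (B n)) + ereal e" using E_er[OF f] by auto
    qed
  qed
qed

text \<open>Finite sub-additivity and continuity from below make \<open>V\<close> countably
  sub-additive, so no cover is cheaper than the set itself.\<close>

lemma Vs_eq_V: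
  assumes c: "continuous_cap M V" and A: "A \<in> sets M" shows "Vs A = V A"
proof (rule antisym[OF Vs_le_V[OF A]])
  show "V A \<le> Vs A"
    unfolding outer_cap_def
  proof (rule Inf_greatest, clarify)
    fix B :: "nat \<Rightarrow> 'a set" assume B: "\<forall>n. B n \<in> sets M" "A \<subseteq> (\<Union>n. B n)"
    let ?U = "\<lambda>n. \<Union>i<n. B i"
    have U: "(\<Union>n. ?U n) = (\<Union>n. B n)" by auto
    have "incseq ?U" by (intro monoI UN_mono) auto
    moreover have "?U n \<in> sets M" for n using B by auto
    ultimately have "(\<lambda>n. V (?U n)) \<longlonglongrightarrow> V (\<Union>n. ?U n)" by (intro continuous_cap_incseq[OF c])
    hence lim: "(\<lambda>n. V (?U n)) \<longlonglongrightarrow> V (\<Union>n. B n)" unfolding U .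
    have "V (?U n) \<le> (\<Sum>n. V (B n))" for n
    proof -
      have "V (?U n) \<le> ereal (\<Sum>i<n. cap (B i))" using cap_UN[of "{..<n}" B] by (simp add: V_cap)
      also have "\<dots> = (\<Sum>i<n. V (B i))" by (simp add: V_cap)
      also have "\<dots> \<le> (\<Sum>n. V (B n))" by (intro sum_le_suminf summable_ereal_pos V_nonneg) auto
      finally show ?thesis .
    qed
    hence "V (\<Union>n. B n) \<le> (\<Sum>n. V (B n))" by (intro LIMSEQ_le_const2[OF lim]) auto
    moreover have "V A \<le> V (\<Union>n. B n)" using B cap_mono[of A "\<Union>n. B n"] by (auto simp: V_cap)
    ultimately show "V A \<le> (\<Sum>n. V (B n))" by auto
  qed
qed

lemma continuous_V_Vs:
  assumes "continuous_cap M V" shows "continuous_cap M Vs"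
  unfolding continuous_cap_def
proof (intro allI impI)
  fix A :: "nat \<Rightarrow> 'a set" assume A: "\<forall>n. A n \<in> sets M"
  have U: "(\<Union>n. A n) \<in> sets M" "(\<Inter>n. A n) \<in> sets M" using A by auto
  have eq: "Vs (A n) = V (A n)" "Vs (\<Union>n. A n) = V (\<Union>n. A n)" "Vs (\<Inter>n. A n) = V (\<Inter>n. A n)" for n
    using A U by (auto intro!: Vs_eq_V[OF assms])
  show "(incseq A \<longrightarrow> (\<lambda>n. Vs (A n)) \<longlonglongrightarrow> Vs (\<Union>n. A n)) \<and>
      (decseq A \<longrightarrow> (\<lambda>n. Vs (A n)) \<longlonglongrightarrow> Vs (\<Inter>n. A n))"
    unfolding eq using continuous_cap_incseq[OF assms] continuous_cap_decseq[OF assms] A by blast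
qed

lemma dominated_continuous:
  assumes "continuous_cap M V" shows dominated
  unfolding dominated_def using V_lower_E by (simp add: Vs_eq_V[OF assms] E_er[symmetric] L1_H)

lemma Vs_Inter_ge_1:
  assumes "continuous_cap M Vs" "\<And>m. A m \<in> sets M" "decseq A" "\<And>m. 1 \<le> Vs (A m)"
  shows "1 \<le> Vs (\<Inter>m. A m)"
proof -
  have "(\<lambda>n. Vs (A n)) \<longlonglongrightarrow> Vs (\<Inter>n. A n)" using assms by (intro continuous_cap_decseq)
  thus ?thesis by (rule LIMSEQ_le_const) (use assms in auto)
qed

section \<open>Choquet integrals and series of capacities\<close>

lemma choquet_nonneg:
  assumes Y: "\<And>w. 0 \<le> Y w"
  shows "choquet M V Y = enn2ereal (\<integral>\<^sup>+t\<in>{0..}. e2ennreal (V {w\<in>space M. t \<le> Y w}) \<partial>lborel)"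
proof -
  have V1: "V {w\<in>space M. t \<le> Y w} = 1" if "t \<le> 0" for t
  proof -
    have "{w\<in>space M. t \<le> Y w} = space M" using Y that order_trans by blast
    thus ?thesis by (simp add: V_cap cap_space)
  qed
  have "(\<integral>\<^sup>+t\<in>{..0}. e2ennreal (1 - V {w\<in>space M. t \<le> Y w}) \<partial>lborel) = (\<integral>\<^sup>+(t::real). 0 \<partial>lborel)"
    by (intro nn_integral_cong) (auto simp: V1 indicator_def e2ennreal_neg)
  hence neg: "(\<integral>\<^sup>+t\<in>{..0}. e2ennreal (1 - V {w\<in>space M. t \<le> Y w}) \<partial>lborel) = 0" by simp
  show ?thesis unfolding choquet_def neg by (simp add: zero_ennreal.rep_eq)
qed

text \<open>Integral test: on each cell of length \<open>c\<close> the nonincreasing integrand is at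
  most its value at the left end.\<close>

lemma choquet_finite:
  assumes Y: "\<And>w. 0 \<le> Y w" and c: "0 < c"
    and s: "summable (\<lambda>n. cap {w\<in>space M. c * real n \<le> Y w})"
  shows "choquet M V Y < \<infinity>"
proof -
  let ?p = "\<lambda>t. cap {w\<in>space M. t \<le> Y w}"
  let ?I = "\<lambda>n. {c * real n..<c * (real n + 1)}"
  have "(\<integral>\<^sup>+t\<in>{0..}. e2ennreal (V {w\<in>space M. t \<le> Y w}) \<partial>lborel)
      \<le> (\<integral>\<^sup>+t. (\<Sum>n. ennreal (?p (c * n)) * indicator (?I n) t) \<partial>lborel)"
  proof (rule nn_integral_mono)
    fix t :: real
    show "e2ennreal (V {w\<in>space M. t \<le> Y w}) * indicator {0..} t
        \<le> (\<Sum>n. ennreal (?p (c * n)) * indicator (?I n) t)"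
    proof (cases "0 \<le> t")
      case True
      define n where "n = nat \<lfloor>t / c\<rfloor>"
      have n: "real n \<le> t / c" "t / c < real n + 1" using True c unfolding n_def by auto
      have tI: "t \<in> ?I n" using n c by (auto simp: field_simps)
      have "e2ennreal (V {w\<in>space M. t \<le> Y w}) * indicator {0..} t = ennreal (?p t)"
        using True by (simp add: V_cap e2ennreal_ereal)
      also have "\<dots> \<le> ennreal (?p (c * n)) * indicator (?I n) t"
        using tI by (auto intro!: ennreal_leI cap_mono)
      also have "\<dots> = (\<Sum>n\<in>{n}. ennreal (?p (c * n)) * indicator (?I n) t)" by (subst sum.insert) auto
      also have "\<dots> \<le> (\<Sum>n. ennreal (?p (c * n)) * indicator (?I n) t)" by (intro sum_le_suminf) auto
      finally show ?thesis .
    qed simp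
  qed
  also have "\<dots> = (\<Sum>n. (\<integral>\<^sup>+t. ennreal (?p (c * n)) * indicator (?I n) t \<partial>lborel))"
    by (intro nn_integral_suminf) auto
  also have "\<dots> = (\<Sum>n. ennreal (?p (c * n) * c))"
  proof (rule suminf_cong)
    fix n
    have "(\<integral>\<^sup>+t. ennreal (?p (c * n)) * indicator (?I n) t \<partial>lborel) = ennreal (?p (c * n)) * ennreal (c * (real n + 1) - c * real n)"
      using c by (subst nn_integral_cmult_indicator) auto
    thus "(\<integral>\<^sup>+t. ennreal (?p (c * n)) * indicator (?I n) t \<partial>lborel) = ennreal (?p (c * n) * c)"
      using c by (simp add: ring_distribs ennreal_mult cap_nonneg)
  qed
  also have "\<dots> < \<infinity>"
    using summable_mult2[OF s, of c] cap_nonneg c by (subst suminf_ennreal2) auto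
  finally have pos: "(\<integral>\<^sup>+t\<in>{0..}. e2ennreal (V {w\<in>space M. t \<le> Y w}) \<partial>lborel) < \<infinity>" .
  show ?thesis unfolding choquet_nonneg[OF Y] using pos
    by (cases "\<integral>\<^sup>+t\<in>{0..}. e2ennreal (V {w\<in>space M. t \<le> Y w}) \<partial>lborel") auto
qed

text \<open>The reverse integral test, with values at right ends of cells. The grid is arbitrary
  because geometric grids are needed for the blocks and for powers of 2.\<close>

lemma choquet_summable:
  assumes Y: "\<And>w. 0 \<le> Y w" and b: "incseq b" "\<And>n. 0 \<le> b n"
    and fin: "choquet M V Y < \<infinity>"
  shows "summable (\<lambda>n. (b (Suc n) - b n) * cap {w\<in>space M. b (Suc n) \<le> Y w})"
proof -
  let ?p = "\<lambda>t. cap {w\<in>space M. t \<le> Y w}"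
  let ?T = "\<integral>\<^sup>+t\<in>{0..}. e2ennreal (V {w\<in>space M. t \<le> Y w}) \<partial>lborel"
  have T: "?T < \<infinity>" using fin unfolding choquet_nonneg[OF Y] by (cases ?T) auto
  let ?I = "\<lambda>n. {b n<..b (Suc n)}"
  have disj: "disjoint_family ?I"
    unfolding disjoint_family_on_def
  proof (intro ballI impI)
    fix m n :: nat assume "m \<noteq> n"
    thus "?I m \<inter> ?I n = {}"
    proof (induction m n rule: linorder_wlog)
      case (le m n)
      hence "b (Suc m) \<le> b n" using b(1) by (auto simp: incseq_def)
      thus ?case by auto
    qed (auto simp: Int_commute)
  qed
  have "(\<Sum>n. ennreal ((b (Suc n) - b n) * ?p (b (Suc n)))) = (\<Sum>n. (\<integral>\<^sup>+t. ennreal (?p (b (Suc n))) * indicator (?I n) t \<partial>lborel))"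
  proof (rule suminf_cong)
    fix n
    have "(\<integral>\<^sup>+t. ennreal (?p (b (Suc n))) * indicator (?I n) t \<partial>lborel) = ennreal (?p (b (Suc n))) * ennreal (b (Suc n) - b n)"
      using b(1) by (subst nn_integral_cmult_indicator) (auto simp: incseq_SucD)
    thus "ennreal ((b (Suc n) - b n) * ?p (b (Suc n))) = (\<integral>\<^sup>+t. ennreal (?p (b (Suc n))) * indicator (?I n) t \<partial>lborel)"
      using b(1) by (simp add: mult.commute ennreal_mult cap_nonneg incseq_SucD)
  qed
  also have "\<dots> = (\<integral>\<^sup>+t. (\<Sum>n. ennreal (?p (b (Suc n))) * indicator (?I n) t) \<partial>lborel)"
    by (intro nn_integral_suminf[symmetric]) auto
  also have "\<dots> \<le> ?T"
  proof (rule nn_integral_mono)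
    fix t :: real
    show "(\<Sum>n. ennreal (?p (b (Suc n))) * indicator (?I n) t) \<le> e2ennreal (V {w\<in>space M. t \<le> Y w}) * indicator {0..} t"
    proof (cases "\<exists>n. t \<in> ?I n")
      case True
      then obtain n where n: "t \<in> ?I n" by blast
      have "m = n" if "t \<in> ?I m" for m
        using disjoint_family_onD[OF disj, of m n] n that by blast
      hence "(\<Sum>m. ennreal (?p (b (Suc m))) * indicator (?I m) t) = (\<Sum>m\<in>{n}. ennreal (?p (b (Suc m))) * indicator (?I m) t)"
        by (intro suminf_finite) (auto simp: indicator_def)
      also have "\<dots> \<le> ennreal (?p t)" using n by (auto intro!: ennreal_leI cap_mono)
      also have "\<dots> = e2ennreal (V {w\<in>space M. t \<le> Y w}) * indicator {0..} t"
        using n b(2)[of n] by (auto simp: V_cap e2ennreal_ereal indicator_def)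
      finally show ?thesis .
    next
      case False
      hence "(\<Sum>n. ennreal (?p (b (Suc n))) * indicator (?I n) t) = (\<Sum>n. 0)" by (intro suminf_cong) (auto simp: indicator_def)
      thus ?thesis by simp
    qed
  qed
  finally have "(\<Sum>n. ennreal ((b (Suc n) - b n) * ?p (b (Suc n)))) \<noteq> top" using T by (auto simp: top_unique)
  thus ?thesis using b(1) by (intro summable_suminf_not_top) (auto simp: cap_nonneg incseq_SucD)
qed

lemma lil_moment_cond_iff: "lil_moment_cond M H E Y \<longleftrightarrow> choquet M V (\<lambda>w. lil_weight (Y w)) < \<infinity>"
  by (simp add: lil_moment_cond_def lil_weight_def)

end

section \<open>Independent sequences\<close>

lemma prod_one_minus_le_exp:
  fixes p :: "'b \<Rightarrow> real"
  assumes "\<And>i. i \<in> I \<Longrightarrow> p i \<le> 1"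
  shows "(\<Prod>i\<in>I. 1 - p i) \<le> exp (- (\<Sum>i\<in>I. p i))"
proof (cases "finite I")
  case True
  have "(\<Prod>i\<in>I. 1 - p i) \<le> (\<Prod>i\<in>I. exp (- p i))"
    using assms exp_ge_add_one_self[of "- p _"] by (intro prod_mono) (auto simp: algebra_simps)
  thus ?thesis using True by (simp add: exp_sum sum_negf[symmetric])
qed simp

lemma limsup_infI:
  fixes u :: "nat \<Rightarrow> real"
  assumes "\<And>C N. \<exists>n\<ge>N. C \<le> u n"
  shows "limsup (\<lambda>n. ereal (u n)) = \<infinity>"
proof (rule ccontr)
  assume "limsup (\<lambda>n. ereal (u n)) \<noteq> \<infinity>"
  then obtain C :: real where "limsup (\<lambda>n. ereal (u n)) < ereal C"
    by (metis ereal_infty_less(1) less_PInf_Ex_of_nat)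
  hence "\<forall>\<^sub>F n in sequentially. ereal (u n) < ereal C" by (rule Limsup_lessD)
  then obtain N where "\<And>n. n \<ge> N \<Longrightarrow> u n < C" by (auto simp: eventually_sequentially)
  thus False using assms[of N C] by force
qed

text \<open>A variable is a difference of consecutive partial sums, so a bound \<open>C\<close> on
  the normalized sums would bound the normalized variables by \<open>2 * C\<close>.\<close>

lemma limsup_partial_sums:
  assumes "\<And>k m. \<exists>i\<ge>max m 1. (real k + 1) * lil_norm i \<le> \<bar>X i w\<bar>"
  shows "limsup (\<lambda>n. ereal (\<bar>partial_sum X n w\<bar> / lil_norm n)) = \<infinity>"
proof (rule ccontr)
  let ?S = "\<lambda>n. partial_sum X n w"
  assume "\<not> ?thesis"
  hence "\<exists>C N. \<forall>n\<ge>N. \<bar>?S n\<bar> / lil_norm n < C" using limsup_infI[of "\<lambda>n. \<bar>?S n\<bar> / lil_norm n"] not_le by blast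
  then obtain C N where CN: "\<And>n. n \<ge> N \<Longrightarrow> \<bar>?S n\<bar> / lil_norm n < C" by blast
  have C: "0 < C" using CN[of N] lil_norm_nonneg[of N] by (meson divide_nonneg_nonneg abs_ge_zero le_less_trans order_refl)
  obtain k :: nat where k: "2 * C < real k" using reals_Archimedean2 by blast
  \<comment> \<open>\<open>N + 2\<close> ensures that \<open>i - 1\<close> is still at least
    \<open>N\<close> and at least 1.\<close>
  obtain i where i: "max (N + 2) 1 \<le> i" "(real k + 1) * lil_norm i \<le> \<bar>X i w\<bar>" using assms by blast
  have S: "\<bar>?S n\<bar> \<le> C * lil_norm n" if "n \<ge> N" "n \<ge> 1" for n
    using CN[OF that(1)] lil_norm_pos[OF that(2)] by (simp add: field_simps)
  have "?S i = ?S (i - 1) + X i w" using i(1) by (cases i) (auto simp: partial_sum_def)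
  hence "\<bar>X i w\<bar> \<le> \<bar>?S i\<bar> + \<bar>?S (i - 1)\<bar>" by linarith
  also have "\<dots> \<le> C * lil_norm i + C * lil_norm (i - 1)" using i(1) by (intro add_mono S) auto
  also have "\<dots> \<le> C * lil_norm i + C * lil_norm i" using C by (intro add_left_mono mult_left_mono lil_norm_mono) auto
  finally have "(real k + 1) * lil_norm i \<le> 2 * C * lil_norm i" using i(2) by simp
  moreover have "0 < lil_norm i" using i(1) by (intro lil_norm_pos) auto
  ultimately show False using k by simp
qed

text \<open>For negative \<open>u\<close> the claim is inverted: the quadratic lower bound for
  \<open>exp (- u)\<close>, times \<open>1 + u + u\<^sup>2\<close>, is at least 1.\<close>

lemma exp_le_quadratic: "\<bar>u\<bar> \<le> 1 \<Longrightarrow> exp u \<le> 1 + u + u\<^sup>2" for u :: real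
proof (cases "0 \<le> u")
  case False
  assume "\<bar>u\<bar> \<le> 1"
  have "1 + (- u) + (- u)\<^sup>2 / 2 \<le> exp (- u)" using False by (intro exp_lower_Taylor_quadratic) auto
  moreover have "1 \<le> (1 + u + u\<^sup>2) * (1 + (- u) + (- u)\<^sup>2 / 2)"
  proof -
    have "(1 + u + u\<^sup>2) * (1 + (- u) + (- u)\<^sup>2 / 2) - 1 = u\<^sup>2 / 2 * (1 - u + u\<^sup>2)"
      by (simp add: field_simps power2_eq_square)
    moreover have "0 \<le> u\<^sup>2 / 2 * (1 - u + u\<^sup>2)" using False by (intro mult_nonneg_nonneg) auto
    ultimately show ?thesis by linarith
  qed
  moreover have "0 \<le> 1 + u + u\<^sup>2" using \<open>\<bar>u\<bar> \<le> 1\<close> by (smt (verit) zero_le_power2)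
  ultimately have "1 \<le> (1 + u + u\<^sup>2) * exp (- u)" by (meson mult_left_mono order_trans)
  thus ?thesis by (simp add: exp_minus field_simps)
qed (use exp_bound in auto)

context sublinear_expectation_space
begin

text \<open>Freeze the past in minus the product of \<open>n + 1\<close> factors: the past product
  is nonnegative and leaves the inner expectation by positive homogeneity. What remains is the
  number \<open>?e \<le> 0\<close>, and \<open>- ?e\<close> leaves the outer expectation in the same
  way. The minus signs are what makes this the factorization of lower expectations.\<close>

lemma independent_prod:
  assumes X: "\<And>n. n \<ge> 1 \<Longrightarrow> X n \<in> H" and ind: "independent_seq H E X"
    and h: "\<And>j. h j \<in> BL" "\<And>j x. 0 \<le> h j x"
  shows "(\<lambda>w. \<Prod>j=1..n. h j (X j w)) \<in> L1 \<and>
    er (\<lambda>w. - (\<Prod>j=1..n. h j (X j w))) = - (\<Prod>j=1..n. - er (\<lambda>w. - h j (X j w)))"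
proof (induction n)
  case 0
  show ?case by (simp add: L1_const er_const)
next
  case (Suc n)
  let ?P = "\<lambda>x. \<Prod>j<n. h (j + 1) (x ! j)"
  let ?\<phi> = "\<lambda>x. - (?P x * h (n + 1) (x ! n))"
  let ?Xs = "map X [1..<n + 1]" and ?Y = "X (n + 1)"
  have P: "?P (hist X n w) = (\<Prod>j=1..n. h j (X j w))" for w
  proof -
    have "?P (hist X n w) = (\<Prod>j<n. h (j + 1) (X (j + 1) w))"
      by (intro prod.cong refl) (simp add: hist_nth)
    also have "\<dots> = (\<Prod>j=1..n. h j (X j w))"
      by (rule prod.reindex_bij_witness[of _ "\<lambda>j. j - 1" "\<lambda>j. j + 1"]) auto
    finally show ?thesis .
  qed
  have P0: "0 \<le> ?P x" for x by (intro prod_nonneg) (auto simp: h)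
  have \<phi>_app: "?\<phi> (x @ [y]) = ?P x * (- h (n + 1) y)" if "length x = n" for x y
    using that by (simp add: nth_append)
  have hY: "(\<lambda>w. h (n + 1) (?Y w)) \<in> L1" using h X by (intro BL_L1) auto
  have IH1: "(\<lambda>w. \<Prod>j=1..n. h j (X j w)) \<in> L1" using Suc by blast
  let ?e = "er (\<lambda>w. - h (n + 1) (?Y w))" and ?e' = "er (\<lambda>w. h (n + 1) (?Y w))"
  have e0: "?e \<le> 0" using er_mono[OF L1_uminus[OF hY] L1_const[of 0]] h by (simp add: er_const)
  have e'0: "0 \<le> ?e'" using er_nonneg[OF hY] h by simp
  have g: "E (\<lambda>w. ?\<phi> (x @ eval_vec [?Y] w)) = ereal (?P x * ?e)"
    and g': "E (\<lambda>w. \<bar>?\<phi> (x @ eval_vec [?Y] w)\<bar>) = ereal (?P x * ?e')" if l: "length x = n" for x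
  proof -
    have "E (\<lambda>w. ?\<phi> (x @ eval_vec [?Y] w)) = E (\<lambda>w. ?P x * (- h (n + 1) (?Y w)))"
      using \<phi>_app[OF l] by (simp add: eval_vec_def)
    also have "\<dots> = ereal (?P x * ?e)"
      by (simp only: E_er[OF L1_scale[OF L1_uminus[OF hY]]] er_scale[OF L1_uminus[OF hY] P0])
    finally show "E (\<lambda>w. ?\<phi> (x @ eval_vec [?Y] w)) = ereal (?P x * ?e)" .
    have "E (\<lambda>w. \<bar>?\<phi> (x @ eval_vec [?Y] w)\<bar>) = E (\<lambda>w. ?P x * h (n + 1) (?Y w))"
      using \<phi>_app[OF l] P0[of x] h(2) by (simp add: eval_vec_def abs_mult)
    also have "\<dots> = ereal (?P x * ?e')"
      by (simp only: E_er[OF L1_scale[OF hY]] er_scale[OF hY P0])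
    finally show "E (\<lambda>w. \<bar>?\<phi> (x @ eval_vec [?Y] w)\<bar>) = ereal (?P x * ?e')" .
  qed
  have prod_Suc: "(\<Prod>j=1..Suc n. h j (X j w)) = (\<Prod>j=1..n. h j (X j w)) * h (n + 1) (?Y w)" for w
    by simp
  have "?P \<in> vBL n" by (intro vBL_prod vBL_nth h) auto
  from hist_mult_L1[of X, OF X this h(1)[of "n + 1"]] have L: "(\<lambda>w. \<Prod>j=1..Suc n. h j (X j w)) \<in> L1"
    unfolding P prod_Suc by simp
  \<comment> \<open>Independence is postulated only relative to a nonempty past, so the first factor
    is treated separately.\<close>
  have "er (\<lambda>w. - (\<Prod>j=1..Suc n. h j (X j w))) = (- ?e) * er (\<lambda>w. - (\<Prod>j=1..n. h j (X j w)))"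
  proof (cases "n = 0")
    case True thus ?thesis by (simp add: er_const)
  next
    case False
    have I: "indep_to H E [?Y] ?Xs" using ind False unfolding independent_seq_def by auto
    have \<phi>: "?\<phi> \<in> C_l_Lip (length ?Xs + length [?Y])"
      by (intro vBL_C_l_Lip vBL_uminus vBL_mult vBL_prod vBL_nth h) auto
    note * = bspec[OF I[unfolded indep_to_def] \<phi>, unfolded Let_def]
    have len: "length (eval_vec ?Xs w) = n" for w by (simp del: upt_Suc)
    have G: "real_of_ereal (E (\<lambda>w'. ?\<phi> (eval_vec ?Xs w @ eval_vec [?Y] w'))) = ?e * (\<Prod>j=1..n. h j (X j w))" for w
      unfolding g[OF len] P[unfolded hist_def] by simp
    have G': "real_of_ereal (E (\<lambda>w'. \<bar>?\<phi> (eval_vec ?Xs w @ eval_vec [?Y] w')\<bar>)) = ?e' * (\<Prod>j=1..n. h j (X j w))" for w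
      unfolding g'[OF len] P[unfolded hist_def] by simp
    have "E (\<lambda>w. ?\<phi> (eval_vec ?Xs w @ eval_vec [?Y] w)) = E (\<lambda>w. ?e * (\<Prod>j=1..n. h j (X j w)))"
      unfolding G[symmetric]
    proof (rule *[THEN mp, THEN mp, THEN mp, THEN mp])
      show "\<forall>x. length x = length ?Xs \<longrightarrow> E (\<lambda>w. \<bar>?\<phi> (x @ eval_vec [?Y] w)\<bar>) < \<infinity>"
      proof (intro allI impI)
        fix x :: "real list" assume "length x = length ?Xs"
        hence "length x = n" by (simp del: upt_Suc)
        thus "E (\<lambda>w. \<bar>?\<phi> (x @ eval_vec [?Y] w)\<bar>) < \<infinity>" by (simp only: g') simp
      qed
      show "E (\<lambda>w. \<bar>real_of_ereal (E (\<lambda>w'. \<bar>?\<phi> (eval_vec ?Xs w @ eval_vec [?Y] w')\<bar>))\<bar>) < \<infinity>"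
        unfolding G' using L1_scale[OF IH1, of ?e'] unfolding L1_def by blast
    qed (simp_all only: G G' L1_H L1_scale[OF IH1])
    moreover have "?\<phi> (eval_vec ?Xs w @ eval_vec [?Y] w) = - (\<Prod>j=1..Suc n. h j (X j w))" for w
      unfolding prod_Suc P[symmetric] hist_def using \<phi>_app[OF len, of w "?Y w"] by (simp add: eval_vec_def del: upt_Suc)
    ultimately have "er (\<lambda>w. - (\<Prod>j=1..Suc n. h j (X j w))) = er (\<lambda>w. (- ?e) * (- (\<Prod>j=1..n. h j (X j w))))"
      by (simp add: er_def)
    also have "\<dots> = (- ?e) * er (\<lambda>w. - (\<Prod>j=1..n. h j (X j w)))"
      using e0 IH1 by (intro er_scale L1_uminus) auto
    finally show ?thesis .
  qed
  thus ?case using Suc L by simp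
qed

text \<open>A converse Borel-Cantelli lemma: the lower expectation of \<open>\<Prod> (1 - soft_ind (r j) (X j))\<close> factorizes.\<close>

lemma borel_cantelli_tails:
  assumes X: "\<And>n. n \<ge> 1 \<Longrightarrow> X n \<in> H" and id: "identically_distributed E X"
    and ind: "independent_seq H E X" and dom: dominated
    and r: "\<And>i. 1 \<le> i \<Longrightarrow> 0 < r i"
    and ns: "\<not> summable (\<lambda>i. cap (tail (X 1) (r i)))"
  shows "1 \<le> Vs (\<Union>i\<in>{max m 1..}. tail (X i) (r i / 2))" (is "1 \<le> Vs ?A")
proof -
  define K where "K = max m 1"
  \<comment> \<open>Factors before \<open>K\<close> are 1, so the product over \<open>1..N\<close>
    tests only the indices that occur in the union.\<close>
  define h :: "nat \<Rightarrow> real \<Rightarrow> real" where "h = (\<lambda>j x. 1 - (if K \<le> j then soft_ind (r j) x else 0))"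
  define q where "q = (\<lambda>j. if K \<le> j then er (\<lambda>w. soft_ind (r j) (X 1 w)) else 0)"
  have K: "1 \<le> K" unfolding K_def by simp
  have hb: "h j \<in> BL" for j
  proof (cases "K \<le> j")
    case True
    hence rj: "0 < r j" using r K by auto
    show ?thesis unfolding h_def using True soft_ind_01[of "r j"] soft_ind_lip[OF rj]
      by (intro BL_I[of _ 1 "2 / r j"]) (auto simp: abs_minus_commute)
  qed (auto simp: h_def BL_const)
  have h0: "0 \<le> h j x" "h j x \<le> 1" for j x unfolding h_def using soft_ind_01[of "r j" x] by auto
  have q01: "0 \<le> q j" "q j \<le> 1" for j
  proof -
    have "0 \<le> er (\<lambda>w. soft_ind (r j) (X 1 w)) \<and> er (\<lambda>w. soft_ind (r j) (X 1 w)) \<le> 1" if "K \<le> j"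
    proof -
      have L: "(\<lambda>w. soft_ind (r j) (X 1 w)) \<in> L1" using that K X r by (intro BL_L1 soft_ind_BL) auto
      show ?thesis using er_nonneg[OF L] er_mono[OF L L1_const[of 1]] soft_ind_01 by (simp add: er_const)
    qed
    thus "0 \<le> q j" "q j \<le> 1" unfolding q_def by auto
  qed
  have er_h: "- er (\<lambda>w. - h j (X j w)) = 1 - q j" if "1 \<le> j" for j
  proof (cases "K \<le> j")
    case True
    have L: "(\<lambda>w. soft_ind (r j) (X j w)) \<in> L1" using that X r by (intro BL_L1 soft_ind_BL) auto
    have "er (\<lambda>w. - h j (X j w)) = er (\<lambda>w. soft_ind (r j) (X j w) + - 1)"
      using True by (simp add: h_def)
    also have "\<dots> = q j - 1"
      using er_shift[OF L, of "- 1"] BL_ident[OF id X soft_ind_BL[OF r[OF that]] that] True unfolding q_def by simp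
    finally show ?thesis by simp
  qed (simp add: h_def q_def er_const)
  have A: "?A \<in> sets M" by (rule UN_tail_sets) (use X in auto)
  have low: "ereal (1 - exp (- (\<Sum>j=1..N. q j))) \<le> Vs ?A" for N
  proof -
    let ?P = "\<lambda>w. \<Prod>j=1..N. h j (X j w)"
    note P = independent_prod[of X h N, OF X ind hb h0(1)]
    have P01: "0 \<le> ?P w" for w by (intro prod_nonneg) (auto simp: h0)
    have "er (\<lambda>w. - ?P w + 1) = 1 - (\<Prod>j=1..N. - er (\<lambda>w. - h j (X j w)))"
      using P by (subst er_shift) (auto intro: L1_uminus)
    moreover have "(\<Prod>j=1..N. - er (\<lambda>w. - h j (X j w))) = (\<Prod>j=1..N. 1 - q j)"
      by (intro prod.cong refl er_h) auto
    moreover have "\<dots> \<le> exp (- (\<Sum>j=1..N. q j))" by (intro prod_one_minus_le_exp q01)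
    ultimately have "1 - exp (- (\<Sum>j=1..N. q j)) \<le> er (\<lambda>w. - ?P w + 1)" by linarith
    moreover have "ereal (er (\<lambda>w. - ?P w + 1)) \<le> Vs ?A"
    proof -
      \<comment> \<open>Off the union every soft indicator vanishes and the product is exactly 1;
        elsewhere nonnegativity of the product suffices.\<close>
      have "- ?P w + 1 \<le> indicator ?A w" if w: "w \<in> space M" for w
      proof (cases "w \<in> ?A")
        case True thus ?thesis using P01[of w] by simp
      next
        case False
        have "h j (X j w) = 1" if "j \<in> {1..N}" for j
          using False w that soft_ind_zero[OF r, of j "X j w"] unfolding h_def K_def by (auto simp: not_le)
        hence "?P w = 1" by (intro prod.neutral) auto
        thus ?thesis using False by simp
      qed
      moreover have "(\<lambda>w. - ?P w + 1) \<in> L1" using P by (intro L1_add L1_uminus L1_const) auto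
      ultimately show ?thesis by (intro dominatedD[OF dom A])
    qed
    ultimately show ?thesis by (meson ereal_less_eq(3) order_trans)
  qed
  have nq: "\<not> summable q"
  proof
    assume "summable q"
    hence "summable (\<lambda>i. cap (tail (X 1) (r i)))"
    proof (rule summable_comparison_test'[where N = K])
      fix n assume "K \<le> n"
      thus "norm (cap (tail (X 1) (r n))) \<le> q n"
        using tail_ident(1)[OF id X order_refl r[of n]] K cap_nonneg by (auto simp: q_def)
    qed
    thus False using ns by blast
  qed
  show ?thesis
  proof (rule ereal_le_epsilon2)
    fix e :: real assume e: "0 < e"
    have "\<exists>N. - ln e \<le> (\<Sum>j<N. q j)"
    proof (rule ccontr)
      assume "\<not> ?thesis"
      hence "\<And>N. (\<Sum>j<N. q j) \<le> - ln e" by (auto simp: not_le less_imp_le)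
      hence "summable q" using q01 by (intro summableI_nonneg_bounded) auto
      thus False using nq by blast
    qed
    then obtain N where N: "- ln e \<le> (\<Sum>j<N. q j)" by blast
    have "(\<Sum>j<N. q j) \<le> (\<Sum>j\<in>{0..N}. q j)" using q01 by (intro sum_mono2) auto
    also have "\<dots> = (\<Sum>j=1..N. q j)" using K by (subst sum.atLeast_Suc_atMost) (auto simp: q_def)
    finally have "- (\<Sum>j=1..N. q j) \<le> ln e" using N by linarith
    hence "exp (- (\<Sum>j=1..N. q j)) \<le> exp (ln e)" by (rule exp_le_cancel_iff[THEN iffD2])
    hence "1 \<le> ereal (1 - exp (- (\<Sum>j=1..N. q j))) + ereal e" using e by (simp add: one_ereal_def)
    also have "\<dots> \<le> Vs ?A + ereal e" by (intro add_right_mono low)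
    finally show "1 \<le> Vs ?A + ereal e" .
  qed
qed

lemma moment_cond_if_bounded:
  assumes X: "\<And>n. n \<ge> 1 \<Longrightarrow> X n \<in> H" and id: "identically_distributed E X"
    and ind: "independent_seq H E X" and dom: dominated and cont: "continuous_cap M Vs"
    and bdd: "lil_bounded_cond M H E X"
  shows "lil_moment_cond M H E (X 1)"
proof (rule ccontr)
  assume no: "\<not> lil_moment_cond M H E (X 1)"
  \<comment> \<open>Intersecting over \<open>m\<close> says that level \<open>k + 1\<close> is
    exceeded infinitely often, and then over \<open>k\<close> that this holds for all levels. Both
    families decrease, so continuity from above applies twice.\<close>
  define D where "D = (\<lambda>(k::nat) m. \<Union>i\<in>{max m 1..}. tail (X i) ((real k + 1) * lil_norm i))"
  have D: "1 \<le> Vs (D k m)" for k m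
  proof -
    let ?R = "real k + 1"
    \<comment> \<open>The doubled threshold anticipates the halving in
      \<open>borel_cantelli_tails\<close>.\<close>
    have ns: "\<not> summable (\<lambda>i. cap (tail (X 1) (2 * (?R * lil_norm i))))"
    proof
      assume s: "summable (\<lambda>i. cap (tail (X 1) (2 * (?R * lil_norm i))))"
      have "summable (\<lambda>n. cap (weight_tail (X 1) (16 * ?R\<^sup>2 * real n)))"
      proof (rule summable_comparison_test'[OF s, where N = 1])
        fix n :: nat assume n: "1 \<le> n"
        have "2 * (?R * lil_norm n) \<le> \<bar>X 1 w\<bar>" if "16 * ?R\<^sup>2 * real n \<le> lil_weight (X 1 w)" for w
          using lil_weight_ge_imp[OF n _ that] by (simp add: algebra_simps)
        thus "norm (cap (weight_tail (X 1) (16 * ?R\<^sup>2 * real n)))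
            \<le> cap (tail (X 1) (2 * (?R * lil_norm n)))"
          by (auto simp: cap_nonneg intro!: cap_mono)
      qed
      hence "choquet M V (\<lambda>w. lil_weight (X 1 w)) < \<infinity>"
        by (intro choquet_finite[where c = "16 * ?R\<^sup>2"] lil_weight_nonneg) auto
      thus False using no by (simp add: lil_moment_cond_iff)
    qed
    have "1 \<le> Vs (\<Union>i\<in>{max m 1..}. tail (X i) (2 * (?R * lil_norm i) / 2))"
      by (rule borel_cantelli_tails[OF X id ind dom _ ns]) (auto intro!: mult_pos_pos lil_norm_pos)
    thus ?thesis unfolding D_def by (subst (asm) nonzero_mult_div_cancel_left) simp_all
  qed
  have Ds: "D k m \<in> sets M" for k m unfolding D_def
    by (rule UN_tail_sets) (use X in auto)
  have D2: "1 \<le> Vs (\<Inter>m. D k m)" for k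
  proof (rule Vs_Inter_ge_1[OF cont Ds _ D])
    show "decseq (D k)" unfolding D_def decseq_def by (intro allI impI UN_mono) auto
  qed
  have Dmono: "D (Suc k) m \<subseteq> D k m" for k m
  proof
    fix w assume "w \<in> D (Suc k) m"
    then obtain i where i: "i \<ge> max m 1" "w \<in> space M" "(real (Suc k) + 1) * lil_norm i \<le> \<bar>X i w\<bar>"
      unfolding D_def by auto
    have "(real k + 1) * lil_norm i \<le> (real (Suc k) + 1) * lil_norm i"
      by (intro mult_right_mono lil_norm_nonneg) auto
    thus "w \<in> D k m" using i unfolding D_def by force
  qed
  have "1 \<le> Vs (\<Inter>k. \<Inter>m. D k m)"
  proof (rule Vs_Inter_ge_1[OF cont _ _ D2])
    show "decseq (\<lambda>k. \<Inter>m. D k m)" by (rule decseq_SucI) (use Dmono in blast)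
  qed (use Ds in auto)
  also have "\<dots> \<le> Vs {w\<in>space M. limsup (\<lambda>n. ereal (\<bar>partial_sum X n w\<bar> / lil_norm n)) = \<infinity>}"
  proof (rule Vs_mono, rule subsetI)
    fix w assume w: "w \<in> (\<Inter>k. \<Inter>m. D k m)"
    hence "w \<in> space M" unfolding D_def by auto
    moreover have "\<exists>i\<ge>max m 1. (real k + 1) * lil_norm i \<le> \<bar>X i w\<bar>" for k m using w unfolding D_def by blast
    ultimately show "w \<in> {w\<in>space M. limsup (\<lambda>n. ereal (\<bar>partial_sum X n w\<bar> / lil_norm n)) = \<infinity>}"
      using limsup_partial_sums[of X w] by blast
  qed
  finally show False using bdd unfolding lil_bounded_cond_def by simp
qed

section \<open>Vanishing of the means of \<open>X 1\<close> and \<open>- X 1\<close>\<close>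

lemma tail_L1:
  assumes Z: "Z \<in> H" and lim: "((\<lambda>c::real. E (\<lambda>w. max (\<bar>Z w\<bar> - c) 0)) \<longlongrightarrow> 0) at_top"
  shows "Z \<in> L1" and "0 < e \<Longrightarrow> \<forall>\<^sub>F c in at_top. er (\<lambda>w. max (\<bar>Z w\<bar> - c) 0) < e"
    and "(\<lambda>w. max (\<bar>Z w\<bar> - c) 0) \<in> L1"
proof -
  have H: "(\<lambda>w. max (\<bar>Z w\<bar> - c) 0) \<in> H" for c by (intro H_pos H_diff H_abs Z H_const)
  have "\<forall>\<^sub>F c in at_top. E (\<lambda>w. max (\<bar>Z w\<bar> - c) 0) < ereal 1"
    using order_tendstoD(2)[OF lim, of "ereal 1"] by simp
  then obtain c where "E (\<lambda>w. max (\<bar>Z w\<bar> - c) 0) < ereal 1" by (auto simp: eventually_at_top_linorder)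
  hence "(\<lambda>w. max (\<bar>Z w\<bar> - c) 0) \<in> L1" using H[of c] by (auto simp: L1_def)
  hence "(\<lambda>w. max (\<bar>Z w\<bar> - c) 0 + \<bar>c\<bar>) \<in> L1" by (intro L1_add L1_const)
  thus L: "Z \<in> L1" by (rule L1_mono) (use Z in auto)
  show L': "(\<lambda>w. max (\<bar>Z w\<bar> - c) 0) \<in> L1" for c
    by (rule L1_mono[OF L1_add[OF L1_mono[OF L H_abs[OF Z]] L1_const[of "\<bar>c\<bar>"]] H]) auto
  show "\<forall>\<^sub>F c in at_top. er (\<lambda>w. max (\<bar>Z w\<bar> - c) 0) < e" if "0 < e"
    using order_tendstoD(2)[OF lim, of "ereal e"] that by (simp add: E_er[OF L'])
qed

text \<open>In (b) uniform integrability is derived: \<open>(\<bar>Z\<bar> - n)\<close> cut at 0 is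
  a sum of layers of height at most 1, and the layer \<open>j\<close> has expectation at most the
  capacity of \<open>\<bar>Z\<bar> \<ge> j + n\<close>. These capacities are summable because the
  weight in (1) dominates \<open>\<bar>x\<bar>\<close> once
  \<open>\<bar>x\<bar> \<ge> 1\<close>.\<close>

lemma tail_if_countably_subadd:
  assumes Z: "Z \<in> H" and cs: "countably_subadd_exp M H E" and mom: "lil_moment_cond M H E Z"
  shows "((\<lambda>c::real. E (\<lambda>w. max (\<bar>Z w\<bar> - c) 0)) \<longlongrightarrow> 0) at_top"
proof -
  let ?v = "\<lambda>j::nat. cap (tail Z (real j))"
  let ?cl = "\<lambda>x::real. max 0 (min 1 x)"
  have H: "(\<lambda>w. max (\<bar>Z w\<bar> - c) 0) \<in> H" for c by (intro H_pos H_diff H_abs Z H_const)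
  have "summable (\<lambda>n. (real (Suc n) - real n) * cap (weight_tail Z (real (Suc n))))"
    using mom by (intro choquet_summable) (auto simp: lil_weight_nonneg lil_moment_cond_iff incseq_def)
  hence s0: "summable (\<lambda>n. cap (weight_tail Z (real (Suc n))))" by simp
  have "summable (\<lambda>n. ?v (Suc n))"
  proof (rule summable_comparison_test'[OF s0, where N = 0])
    fix n :: nat
    show "norm (?v (Suc n)) \<le> cap (weight_tail Z (real (Suc n)))"
    proof -
      have "tail Z (real (Suc n)) \<inter> space M \<subseteq> weight_tail Z (real (Suc n))"
        using lil_weight_ge_abs by (smt (verit) Int_iff mem_Collect_eq of_nat_0_le_iff of_nat_Suc subsetI)
      thus ?thesis using cap_nonneg by (simp add: cap_mono)
    qed
  qed
  hence s: "summable ?v" by (subst (asm) summable_Suc_iff)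
  have part: "(\<Sum>j<N. ?cl (y - real j)) = min y (real N)" if "0 \<le> y" for y N
    using that by (induction N) (auto simp: min_def max_def)
  have bound: "E (\<lambda>w. max (\<bar>Z w\<bar> - real n) 0) \<le> ereal (\<Sum>j. ?v (j + n))" for n
  proof -
    let ?\<xi> = "\<lambda>j w. ?cl (max (\<bar>Z w\<bar> - real n) 0 - real j)"
    have xH: "?\<xi> j \<in> H" for j
      by (rule H_lip[OF H[of "real n"], of "\<lambda>y. ?cl (y - real j)" 1]) auto
    have xL: "?\<xi> j \<in> L1" for j by (rule L1_bounded[OF xH, of _ 1]) auto
    have "E (\<lambda>w. max (\<bar>Z w\<bar> - real n) 0) \<le> (\<Sum>j. E (?\<xi> j))"
    proof -
      have "ereal (max (\<bar>Z w\<bar> - real n) 0) \<le> (\<Sum>j. ereal (?\<xi> j w))" for w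
      proof -
        let ?y = "max (\<bar>Z w\<bar> - real n) 0"
        obtain N :: nat where "?y \<le> real N" using real_arch_simple by blast
        hence "ereal ?y = ereal (\<Sum>j<N. ?\<xi> j w)" using part[of ?y N] by simp
        also have "\<dots> = (\<Sum>j<N. ereal (?\<xi> j w))" by (rule sum_ereal[symmetric])
        also have "\<dots> \<le> (\<Sum>j. ereal (?\<xi> j w))"
          by (intro sum_le_suminf summable_ereal_pos) (auto simp: le_max_iff_disj)
        finally show ?thesis .
      qed
      thus ?thesis using cs[unfolded countably_subadd_exp_def, rule_format, of "\<lambda>w. max (\<bar>Z w\<bar> - real n) 0" ?\<xi>] H xH
        by auto
    qed
    also have "\<dots> \<le> (\<Sum>j. ereal (?v (j + n)))"
    proof (intro suminf_le summable_ereal_pos)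
      fix j
      have "E (?\<xi> j) \<le> V (tail Z (real (j + n)))"
        by (rule V_lower_E[OF xH]) (auto simp: indicator_def max_def min_def)
      thus "E (?\<xi> j) \<le> ereal (?v (j + n))" by (simp add: V_cap)
    qed (auto intro!: E_nonneg[OF xH] cap_nonneg)
    also have "\<dots> = ereal (\<Sum>j. ?v (j + n))"
      using s summable_ignore_initial_segment[of ?v n] by (intro suminf_ereal' ) (auto simp: summable_sums sums_ereal)
    finally show ?thesis .
  qed
  have lim: "(\<lambda>n. \<Sum>j. ?v (j + n)) \<longlonglongrightarrow> 0" using suminf_exist_split2[OF s] .
  show ?thesis
  proof (rule order_tendstoI)
    fix a :: ereal assume "a < 0"
    have "0 \<le> E (\<lambda>w. max (\<bar>Z w\<bar> - c) 0)" for c by (intro E_nonneg H) auto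
    thus "\<forall>\<^sub>F c in at_top. a < E (\<lambda>w. max (\<bar>Z w\<bar> - c) 0)" 
      using \<open>a < 0\<close> by (intro always_eventually allI less_le_trans[OF \<open>a < 0\<close>])
  next
    fix a :: ereal assume a: "0 < a"
    then obtain e :: real where e: "0 < e" "ereal e < a" by (metis ereal_dense2 ereal_less(2))
    obtain n where n: "(\<Sum>j. ?v (j + n)) < e"
      using order_tendstoD(2)[OF lim e(1)] by (auto simp: eventually_sequentially)
    show "\<forall>\<^sub>F c in at_top. E (\<lambda>w. max (\<bar>Z w\<bar> - c) 0) < a"
      using eventually_ge_at_top[of "real n"]
    proof eventually_elim
      case (elim c)
      have "E (\<lambda>w. max (\<bar>Z w\<bar> - c) 0) \<le> E (\<lambda>w. max (\<bar>Z w\<bar> - real n) 0)"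
        using elim by (intro E_mono H) auto
      also have "\<dots> \<le> ereal (\<Sum>j. ?v (j + n))" by (rule bound)
      also have "\<dots> < ereal e" using n by simp
      finally show ?case using e(2) by simp
    qed
  qed
qed

text \<open>The lower expectation \<open>- E (- h)\<close> of the exponential weight of a variable with upper mean above \<open>\<mu>\<close>
  is strictly below \<open>1\<close>, although the variable need not have a positive lower mean.\<close>

lemma lower_exp_clip_lt_1:
  assumes Z: "Z \<in> L1" and s: "\<bar>s\<bar> = 1" and \<mu>: "0 < \<mu>" "\<mu> \<le> er (\<lambda>w. s * Z w)"
    and B: "\<mu> \<le> B" "er (\<lambda>w. max (\<bar>Z w\<bar> - B) 0) \<le> \<mu> / 4" "(\<lambda>w. max (\<bar>Z w\<bar> - B) 0) \<in> L1"
    and \<delta>: "0 < \<delta>" "\<delta> \<le> 1/2" "\<delta> * (16 * (er (\<lambda>w. \<bar>Z w\<bar>) + \<mu>)) \<le> \<mu>"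
  defines "h \<equiv> \<lambda>x. exp (- (\<delta> / B) * (clip B (s * x) - \<mu> / 2))"
  shows "- er (\<lambda>w. - h (Z w)) \<le> 1 - (\<delta> * \<mu> / 8) / B"
    and "h \<in> BL"
proof -
  \<comment> \<open>Since \<open>\<bar>?z x\<bar> \<le> 2 * B\<close> and
    \<open>\<delta> \<le> 1/2\<close>, the exponent stays in \<open>[-1, 1]\<close>, where
    \<open>exp_le_quadratic\<close> is valid.\<close>
  let ?t = "\<delta> / B" and ?z = "\<lambda>x. clip B (s * x) - \<mu> / 2"
  have B0: "0 < B" and t0: "0 < ?t" using B \<mu> \<delta> by auto
  have zb: "\<bar>?z x\<bar> \<le> 2 * B" for x using clip_bound[of B "s * x"] B0 B(1) \<mu>(1) by linarith
  have tz: "\<bar>?t * ?z x\<bar> \<le> 1" for x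
  proof -
    have "\<bar>?t * ?z x\<bar> \<le> ?t * (2 * B)" unfolding abs_mult using zb[of x] t0 by (intro mult_mono) auto
    also have "\<dots> \<le> 1" using \<delta> B0 by simp
    finally show ?thesis .
  qed
  have clipBL: "(\<lambda>x. clip B (s * x)) \<in> BL"
  proof (rule BL_I[of _ B 1])
    fix x y
    have "\<bar>clip B (s * x) - clip B (s * y)\<bar> \<le> \<bar>s * x - s * y\<bar>" by (rule clip_lip)
    also have "\<dots> = \<bar>x - y\<bar>" using s by (simp flip: right_diff_distrib add: abs_mult)
    finally show "\<bar>clip B (s * x) - clip B (s * y)\<bar> \<le> 1 * \<bar>x - y\<bar>" by simp
  qed (use clip_bound B0 in auto)
  have "(\<lambda>x. exp (- ?t * (clip B (s * x) - \<mu> / 2))) \<in> BL"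
  proof (rule BL_lip_comp[OF clipBL, of "\<lambda>y. exp (- ?t * (y - \<mu> / 2))" "\<lambda>C. exp (?t * (C + \<mu>)) * ?t"])
    fix x y C :: real assume C: "\<bar>x\<bar> \<le> C" "\<bar>y\<bar> \<le> C"
    have b: "\<bar>- ?t * (z - \<mu> / 2)\<bar> \<le> ?t * (C + \<mu>)" if "\<bar>z\<bar> \<le> C" for z
    proof -
      have "\<bar>- ?t * (z - \<mu> / 2)\<bar> = ?t * \<bar>z - \<mu> / 2\<bar>" using t0 by (simp only: abs_mult abs_minus_cancel abs_of_pos)
      also have "\<dots> \<le> ?t * (C + \<mu>)" using that \<mu>(1) t0 by (intro mult_left_mono) auto
      finally show ?thesis .
    qed
    have "\<bar>exp (- ?t * (x - \<mu> / 2)) - exp (- ?t * (y - \<mu> / 2))\<bar>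
        \<le> exp (?t * (C + \<mu>)) * \<bar>- ?t * (x - \<mu> / 2) - - ?t * (y - \<mu> / 2)\<bar>"
      by (intro exp_lipschitz b C)
    also have "- ?t * (x - \<mu> / 2) - - ?t * (y - \<mu> / 2) = - ?t * (x - y)" by (simp add: algebra_simps diff_divide_distrib)
    also have "\<bar>- ?t * (x - y)\<bar> = ?t * \<bar>x - y\<bar>" using t0 by (simp only: abs_mult abs_minus_cancel abs_of_pos)
    finally show "\<bar>exp (- ?t * (x - \<mu> / 2)) - exp (- ?t * (y - \<mu> / 2))\<bar> \<le> exp (?t * (C + \<mu>)) * ?t * \<bar>x - y\<bar>"
      by (simp only: mult.assoc)
  qed
  thus hBL: "h \<in> BL" unfolding h_def .
  have ZH: "Z \<in> H" using Z by (rule L1_H)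
  have absL: "(\<lambda>w. \<bar>Z w\<bar>) \<in> L1" using L1_mono[OF Z H_abs[OF ZH]] by simp
  have cL: "(\<lambda>w. clip B (s * Z w)) \<in> L1" by (rule BL_L1[OF clipBL ZH])
  have sL: "(\<lambda>w. s * Z w) \<in> L1" by (rule L1_scale[OF Z])
  have sabs: "\<bar>s * x\<bar> = \<bar>x\<bar>" for x using s by (simp add: abs_mult)
  \<comment> \<open>Clipping costs at most \<open>\<mu> / 4\<close> of the upper mean and centring
    \<open>\<mu> / 2\<close>, so \<open>\<mu> / 4\<close> is left.\<close>
  have "er (\<lambda>w. s * Z w) \<le> er (\<lambda>w. clip B (s * Z w) + max (\<bar>Z w\<bar> - B) 0)"
  proof (rule er_mono[OF sL L1_add[OF cL B(3)]])
    fix w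
    show "s * Z w \<le> clip B (s * Z w) + max (\<bar>Z w\<bar> - B) 0"
      using sabs[of "Z w"] B0 by (auto simp: clip_def)
  qed
  also have "\<dots> \<le> er (\<lambda>w. clip B (s * Z w)) + \<mu> / 4" using er_add[OF cL B(3)] B(2) by linarith
  finally have "\<mu> * (3 / 4) \<le> er (\<lambda>w. clip B (s * Z w))" using \<mu>(2) by linarith
  hence erz: "\<mu> / 4 \<le> er (\<lambda>w. ?z (Z w))" using er_shift[OF cL, of "- \<mu> / 2"] by simp
  have zL: "(\<lambda>w. ?z (Z w)) \<in> L1" by (intro L1_diff cL L1_const)
  let ?c = "2 * \<delta>\<^sup>2 / B"
  let ?w = "\<lambda>w. ?c * (\<bar>Z w\<bar> + \<mu>)"
  have c0: "0 \<le> ?c" using B0 by simp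
  have wL: "?w \<in> L1" by (intro L1_scale L1_add absL L1_const)
  have erw: "er ?w = ?c * (er (\<lambda>w. \<bar>Z w\<bar>) + \<mu>)"
    by (simp only: er_scale[OF L1_add[OF absL L1_const] c0] er_shift[OF absL])
  have tzL: "(\<lambda>w. ?t * ?z (Z w)) \<in> L1" by (intro L1_scale zL)
  have hle: "h x \<le> 1 - ?t * ?z x + ?c * (\<bar>x\<bar> + \<mu>)" for x
  proof -
    have "h x \<le> 1 + - (?t * ?z x) + (- (?t * ?z x))\<^sup>2"
      unfolding h_def using exp_le_quadratic[of "- (?t * ?z x)"] tz[of x] by simp
    moreover have "(- (?t * ?z x))\<^sup>2 \<le> ?c * (\<bar>x\<bar> + \<mu>)"
    proof -
      \<comment> \<open>One factor \<open>\<bar>?z x\<bar>\<close> is bounded by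
        \<open>2 * B\<close> and the other by \<open>\<bar>x\<bar> + \<mu>\<close>, so a first
        moment suffices for the quadratic term.\<close>
      have "(- (?t * ?z x))\<^sup>2 = ?t\<^sup>2 * (\<bar>?z x\<bar> * \<bar>?z x\<bar>)" by (simp add: power_mult_distrib power2_eq_square abs_mult_self_eq)
      also have "\<dots> \<le> ?t\<^sup>2 * (2 * B * (\<bar>x\<bar> + \<mu>))"
      proof (intro mult_left_mono mult_mono zb)
        show "\<bar>?z x\<bar> \<le> \<bar>x\<bar> + \<mu>" using clip_abs_le[of B "s * x"] sabs[of x] B0 \<mu>(1) by linarith
      qed (use B0 in auto)
      also have "\<dots> = ?c * (\<bar>x\<bar> + \<mu>)" using B0 by (simp add: power2_eq_square field_simps)
      finally show ?thesis .
    qed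
    ultimately show ?thesis by linarith
  qed
  have hL: "(\<lambda>w. - h (Z w)) \<in> L1" using BL_L1[OF hBL ZH] by (rule L1_uminus)
  \<comment> \<open>Placing the mean term alone on the left lets sub-additivity bound the
    expectation of \<open>- h\<close> from below.\<close>
  have "er (\<lambda>w. ?t * ?z (Z w)) \<le> er (\<lambda>w. (- h (Z w) + 1) + ?w w)"
  proof (rule er_mono[OF tzL])
    show "(\<lambda>w. (- h (Z w) + 1) + ?w w) \<in> L1" by (intro L1_add hL L1_const wL)
    show "?t * ?z (Z w) \<le> (- h (Z w) + 1) + ?w w" for w using hle[of "Z w"] by linarith
  qed
  also have "\<dots> \<le> er (\<lambda>w. - h (Z w) + 1) + er ?w" by (intro er_add L1_add hL L1_const wL)
  also have "er (\<lambda>w. - h (Z w) + 1) = er (\<lambda>w. - h (Z w)) + 1" by (rule er_shift[OF hL])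
  finally have 1: "?t * er (\<lambda>w. ?z (Z w)) \<le> er (\<lambda>w. - h (Z w)) + 1 + ?c * (er (\<lambda>w. \<bar>Z w\<bar>) + \<mu>)"
    unfolding erw using t0 by (subst (asm) er_scale[OF zL]) auto
  have 2: "?t * (\<mu> / 4) \<le> ?t * er (\<lambda>w. ?z (Z w))" using erz t0 by (intro mult_left_mono) auto
  \<comment> \<open>This is where the third condition on \<open>\<delta>\<close> enters: the
    quadratic error uses up at most half of the linear gain.\<close>
  have 3: "?c * (er (\<lambda>w. \<bar>Z w\<bar>) + \<mu>) \<le> ?t * (\<mu> / 8)"
  proof -
    have "?c * (er (\<lambda>w. \<bar>Z w\<bar>) + \<mu>) = ?t / 8 * (\<delta> * (16 * (er (\<lambda>w. \<bar>Z w\<bar>) + \<mu>)))"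
      using B0 by (simp add: power2_eq_square field_simps)
    also have "\<dots> \<le> ?t / 8 * \<mu>" using \<delta> t0 by (intro mult_left_mono) auto
    finally show ?thesis by simp
  qed
  have 4: "?t * (\<mu> / 4) - ?t * (\<mu> / 8) = (\<delta> * \<mu> / 8) / B" by (simp add: field_simps)
  have "a \<le> e + 1 + c \<Longrightarrow> d \<le> a \<Longrightarrow> c \<le> f \<Longrightarrow> d - f = g \<Longrightarrow> - e \<le> 1 - g" for a c d e f g :: real
    by linarith
  from this[OF 1 2 3 4] show "- er (\<lambda>w. - h (Z w)) \<le> 1 - (\<delta> * \<mu> / 8) / B" .
qed

text \<open>On a geometric grid the cell lengths are proportional to the grid points, so these
  products are, up to a constant, dominated by the terms of a convergent series.\<close>

lemma moment_cond_tail_small: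
  assumes "lil_moment_cond M H E Z" "0 < \<eta>"
  shows "(\<lambda>k. 2 ^ k * cap (tail Z (\<eta> * lil_norm (2 ^ k)))) \<longlonglongrightarrow> 0"
proof -
  define c where "c = min 1 (2 * \<eta>\<^sup>2)"
  define b where "b = (\<lambda>k::nat. c / 2 * 2 ^ k)"
  have c: "0 < c" using assms(2) by (simp add: c_def)
  have "incseq b" unfolding b_def using c by (intro incseq_SucI) auto
  hence "summable (\<lambda>k. (b (Suc k) - b k) * cap (weight_tail Z (b (Suc k))))"
    using assms(1) c by (intro choquet_summable) (auto simp: lil_weight_nonneg lil_moment_cond_iff b_def)
  hence "(\<lambda>k. (b (Suc k) - b k) * cap (weight_tail Z (b (Suc k)))) \<longlonglongrightarrow> 0"
    by (rule summable_LIMSEQ_zero)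
  hence "(\<lambda>k. 2 / c * ((b (Suc k) - b k) * cap (weight_tail Z (b (Suc k))))) \<longlonglongrightarrow> 2 / c * 0"
    by (intro tendsto_mult_left)
  moreover have "2 / c * ((b (Suc k) - b k) * p) = 2 ^ k * p" for k p
    using c by (simp add: b_def field_simps)
  moreover have "b (Suc k) = c * 2 ^ k" for k by (simp add: b_def)
  ultimately have lim: "(\<lambda>k. 2 ^ k * cap (weight_tail Z (c * 2 ^ k))) \<longlonglongrightarrow> 0" by simp
  show ?thesis
  proof (rule tendsto_sandwich[OF _ _ tendsto_const lim])
    have "tail Z (\<eta> * lil_norm (2 ^ k)) \<inter> space M \<subseteq> weight_tail Z (c * 2 ^ k)" for k
      using lil_weight_ge[of "2 ^ k" \<eta>] assms(2) by (auto simp: c_def)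
    thus "\<forall>\<^sub>F k in sequentially. 2 ^ k * cap (tail Z (\<eta> * lil_norm (2 ^ k)))
        \<le> 2 ^ k * cap (weight_tail Z (c * 2 ^ k))"
      by (intro always_eventually allI mult_left_mono cap_mono) auto
  qed (auto simp: cap_nonneg)
qed

text \<open>The sign \<open>s\<close> treats the upper means of \<open>X 1\<close> and
  \<open>- X 1\<close> at once.\<close>

lemma mean_le_zero:
  assumes X: "\<And>n. n \<ge> 1 \<Longrightarrow> X n \<in> H" and id: "identically_distributed E X"
    and ind: "independent_seq H E X" and dom: dominated and cont: "continuous_cap M Vs"
    and bdd: "lil_bounded_cond M H E X" and mom: "lil_moment_cond M H E (X 1)"
    and tail: "((\<lambda>c::real. E (\<lambda>w. max (\<bar>X 1 w\<bar> - c) 0)) \<longlongrightarrow> 0) at_top"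
    and s: "\<bar>s\<bar> = 1"
  shows "er (\<lambda>w. s * X 1 w) \<le> 0"
proof (rule ccontr)
  assume neg: "\<not> ?thesis"
  define \<mu> where "\<mu> = er (\<lambda>w. s * X 1 w)"
  have \<mu>: "0 < \<mu>" using neg by (simp add: \<mu>_def)
  have X1: "X 1 \<in> H" using X by simp
  note L = tail_L1[OF X1 tail]
  have absL: "(\<lambda>w. \<bar>X 1 w\<bar>) \<in> L1" using L1_mono[OF L(1) H_abs[OF X1]] by simp
  define K where "K = 16 * (er (\<lambda>w. \<bar>X 1 w\<bar>) + \<mu>)"
  have K: "0 < K" unfolding K_def using er_nonneg[OF absL] \<mu> by simp
  define \<delta> where "\<delta> = min (1/2) (\<mu> / K)"
  have \<delta>: "0 < \<delta>" "\<delta> \<le> 1/2" "\<delta> * K \<le> \<mu>" using \<mu> K unfolding \<delta>_def by (auto simp: min_def field_simps)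
  define \<beta> where "\<beta> = \<delta> * \<mu> / 8"
  have \<beta>: "0 < \<beta>" unfolding \<beta>_def using \<delta> \<mu> by simp
  define h where "h = (\<lambda>B x. exp (- (\<delta> / B) * (clip B (s * x) - \<mu> / 2)))"
  define F where "F = (\<lambda>n::nat. {w\<in>space M. real n * (\<mu> / 2) \<le> s * partial_sum X n w})"
  \<comment> \<open>Lower bound for the capacity of \<open>F n\<close>: the exponential term is the
    bound for the product of the lower expectations, and the last term pays for clipping at
    \<open>lil_norm n\<close>.\<close>
  define u where "u = (\<lambda>n. 1 - exp (- \<beta> * (real n / lil_norm n)) - real n * cap (tail (X 1) ((1/2) * lil_norm n)))"
  have psH: "(\<lambda>w. partial_sum X n w) \<in> H" for n unfolding partial_sum_def by (intro H_sum X) auto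
  have Fs: "F n \<in> sets M" for n unfolding F_def by (intro sets_ge H_scale psH)
  have low: "ereal (u n) \<le> Vs (F n)"
    if B: "\<mu> \<le> lil_norm n" "er (\<lambda>w. max (\<bar>X 1 w\<bar> - lil_norm n) 0) \<le> \<mu> / 4" for n
  proof -
    let ?B = "lil_norm n"
    have B0: "0 < ?B" using B(1) \<mu> by simp
    note mb = lower_exp_clip_lt_1[OF L(1) s \<mu> eq_refl[OF \<mu>_def] B L(3) \<delta>(1,2) \<delta>(3)[unfolded K_def]]
    have mb1: "- er (\<lambda>w. - h ?B (X 1 w)) \<le> 1 - \<beta> / ?B" unfolding h_def \<beta>_def by (rule mb(1))
    have hb: "h ?B \<in> BL" unfolding h_def by (rule mb(2))
    have hpos: "0 \<le> h ?B x" for x unfolding h_def by simp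
    let ?P = "\<lambda>w. \<Prod>j=1..n. h ?B (X j w)"
    note P = independent_prod[of X "\<lambda>_. h ?B" n, OF X ind hb hpos]
    have eq: "er (\<lambda>w. - h ?B (X j w)) = er (\<lambda>w. - h ?B (X 1 w))" if "j \<ge> 1" for j
      by (rule BL_ident[OF id X BL_uminus[OF hb] that])
    have "(\<Prod>j=1..n. - er (\<lambda>w. - h ?B (X j w))) = (\<Prod>j=1..n. - er (\<lambda>w. - h ?B (X 1 w)))"
      by (intro prod.cong refl arg_cong[of _ _ uminus] eq) simp
    also have "\<dots> = (- er (\<lambda>w. - h ?B (X 1 w))) ^ n" by simp
    also have "\<dots> \<le> exp (- (\<beta> / ?B)) ^ n"
    proof (rule power_mono)
      show "- er (\<lambda>w. - h ?B (X 1 w)) \<le> exp (- (\<beta> / ?B))"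
        using mb1 exp_ge_add_one_self[of "- (\<beta> / ?B)"] by linarith
      show "0 \<le> - er (\<lambda>w. - h ?B (X 1 w))"
        using er_mono[OF L1_uminus[OF BL_L1[OF hb X1]] L1_const[of 0]] hpos by (simp add: er_const)
    qed
    also have "\<dots> = exp (- \<beta> * (real n / ?B))" by (simp flip: exp_of_nat_mult)
    finally have Pn: "(\<Prod>j=1..n. - er (\<lambda>w. - h ?B (X j w))) \<le> exp (- \<beta> * (real n / ?B))" .
    let ?S = "\<lambda>w. \<Sum>j=1..n. soft_ind ?B (X j w)"
    have sL: "(\<lambda>w. soft_ind ?B (X j w)) \<in> L1" if "j \<ge> 1" for j using B0 that X by (intro BL_L1 soft_ind_BL)
    have SL: "?S \<in> L1" by (intro L1_sum sL) auto
    have "er ?S \<le> (\<Sum>j=1..n. er (\<lambda>w. soft_ind ?B (X j w)))" by (intro er_sum sL) auto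
    also have "\<dots> = (\<Sum>j=1..n. er (\<lambda>w. soft_ind ?B (X 1 w)))"
      by (intro sum.cong refl BL_ident[OF id X soft_ind_BL[OF B0]]) auto
    also have "\<dots> \<le> real n * cap (tail (X 1) ((1/2) * ?B))"
      using tail_ident(2)[OF id X order_refl B0] by (simp add: mult_left_mono)
    finally have S: "er ?S \<le> real n * cap (tail (X 1) ((1/2) * ?B))" .
    have PL: "(\<lambda>w. - ?P w + 1) \<in> L1" using P by (intro L1_add L1_uminus L1_const) auto
    have fL: "(\<lambda>w. (- ?P w + 1) - ?S w) \<in> L1" by (intro L1_diff PL SL)
    have "er (\<lambda>w. - ?P w + 1) = 1 - (\<Prod>j=1..n. - er (\<lambda>w. - h ?B (X j w)))"
      using P by (subst er_shift) (auto intro: L1_uminus)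
    moreover have "er (\<lambda>w. ((- ?P w + 1) - ?S w) + ?S w) \<le> er (\<lambda>w. (- ?P w + 1) - ?S w) + er ?S"
      by (intro er_add fL SL)
    ultimately have "u n \<le> er (\<lambda>w. (- ?P w + 1) - ?S w)" unfolding u_def using S Pn by simp
    moreover have "ereal (er (\<lambda>w. (- ?P w + 1) - ?S w)) \<le> Vs (F n)"
    proof (rule dominatedD[OF dom Fs fL])
      fix w assume w: "w \<in> space M"
      have P0: "0 \<le> ?P w" by (intro prod_nonneg) (auto simp: hpos)
      have S0: "0 \<le> ?S w" by (intro sum_nonneg) (auto simp: soft_ind_01)
      \<comment> \<open>Outside \<open>F n\<close> either some clipping is active and the sum of
        soft indicators is at least 1, or none is and the exponent of the product is
        nonnegative.\<close>
      show "(- ?P w + 1) - ?S w \<le> indicator (F n) w"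
      proof (cases "w \<in> F n")
        case True thus ?thesis using P0 S0 by simp
      next
        case F: False
        show ?thesis
        proof (cases "\<exists>j\<in>{1..n}. ?B \<le> \<bar>X j w\<bar>")
          case True
          then obtain j where j: "j \<in> {1..n}" "?B \<le> \<bar>X j w\<bar>" by blast
          have "1 = soft_ind ?B (X j w)" using j B0 by (simp add: soft_ind_one)
          also have "\<dots> \<le> ?S w" using j by (intro member_le_sum) (auto simp: soft_ind_01)
          finally show ?thesis using P0 F by simp
        next
          case False
          have "h ?B (X j w) = exp (- (\<delta> / ?B) * (s * X j w - \<mu> / 2))" if "j \<in> {1..n}" for j
            using False that s unfolding h_def by (subst clip_id) (auto simp: abs_mult not_le less_imp_le)
          hence "?P w = (\<Prod>j=1..n. exp (- (\<delta> / ?B) * (s * X j w - \<mu> / 2)))" by (intro prod.cong) auto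
          also have "\<dots> = exp (\<Sum>j=1..n. - (\<delta> / ?B) * (s * X j w - \<mu> / 2))" by (simp add: exp_sum)
          also have "(\<Sum>j=1..n. - (\<delta> / ?B) * (s * X j w - \<mu> / 2)) = (\<delta> / ?B) * (real n * (\<mu> / 2) - s * partial_sum X n w)"
            unfolding partial_sum_def sum_distrib_left[symmetric] sum_subtractf by (simp add: algebra_simps diff_divide_distrib)
          finally have "1 \<le> ?P w" using F w \<delta> B0 unfolding F_def by (simp add: mult_nonneg_nonneg)
          thus ?thesis using S0 F by simp
        qed
      qed
    qed
    ultimately show ?thesis by (meson ereal_less_eq(3) order_trans)
  qed
  \<comment> \<open>Powers of 2 are used because the cost of truncation is known to vanish along
    them.\<close>
  have div: "filterlim (\<lambda>k::nat. real (2 ^ k) / lil_norm (2 ^ k)) at_top sequentially"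
    by (rule filterlim_compose[OF lil_norm_over_n]) (rule filterlim_subseq, simp add: strict_mono_def)
  have "(\<lambda>k. u (2 ^ k)) \<longlonglongrightarrow> 1 - 0 - 0"
    unfolding u_def
  proof (intro tendsto_diff tendsto_const)
    show "(\<lambda>k::nat. exp (- \<beta> * (real (2 ^ k) / lil_norm (2 ^ k)))) \<longlonglongrightarrow> 0"
      by (intro filterlim_compose[OF exp_at_bot] filterlim_tendsto_neg_mult_at_bot[OF tendsto_const] div) (use \<beta> in auto)
    show "(\<lambda>k::nat. real (2 ^ k) * cap (tail (X 1) ((1/2) * lil_norm (2 ^ k)))) \<longlonglongrightarrow> 0"
      using moment_cond_tail_small[OF mom, of "1/2"] by simp
  qed
  hence u1: "(\<lambda>k. ereal (u (2 ^ k))) \<longlonglongrightarrow> ereal 1" by simp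
  have lil_inf: "filterlim (\<lambda>k::nat. lil_norm (2 ^ k)) at_top sequentially"
  proof (rule filterlim_at_top_mono)
    show "filterlim (\<lambda>k::nat. sqrt (real k)) at_top sequentially"
      by (rule filterlim_compose[OF sqrt_at_top filterlim_real_sequentially])
    show "\<forall>\<^sub>F k::nat in sequentially. sqrt (real k) \<le> lil_norm (2 ^ k)"
    proof (rule always_eventually, rule allI)
      fix k :: nat
      have "real k \<le> 2 ^ k" using less_exp[of k] by (metis of_nat_le_iff of_nat_numeral of_nat_power less_imp_le)
      also have "\<dots> \<le> 2 * real (2 ^ k) * log_e (log_e (real (2 ^ k)))"
        using log_e_ge_1[of "log_e (real (2 ^ k))"] mult_mono[of "2 ^ k" "2 * 2 ^ k" 1 "log_e (log_e (real (2 ^ k)))"] by simp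
      finally show "sqrt (real k) \<le> lil_norm (2 ^ k)" unfolding lil_norm_def by (rule real_sqrt_le_mono)
    qed
  qed
  have ev: "\<forall>\<^sub>F k in sequentially. ereal (u (2 ^ k)) \<le> Vs (F (2 ^ k))"
  proof -
    have "\<forall>\<^sub>F c in at_top. \<mu> \<le> c \<and> er (\<lambda>w. max (\<bar>X 1 w\<bar> - c) 0) < \<mu> / 4"
      using L(2)[of "\<mu> / 4"] \<mu> by (intro eventually_conj eventually_ge_at_top) auto
    hence "\<forall>\<^sub>F k in sequentially. \<mu> \<le> lil_norm (2 ^ k) \<and> er (\<lambda>w. max (\<bar>X 1 w\<bar> - lil_norm (2 ^ k)) 0) < \<mu> / 4"
      using lil_inf unfolding filterlim_iff by blast
    thus ?thesis by eventually_elim (rule low, auto)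
  qed
  have "1 \<le> Vs (\<Inter>m. \<Union>k\<in>{m..}. F (2 ^ k))"
  proof (rule Vs_Inter_ge_1[OF cont])
    show "(\<Union>k\<in>{m..}. F (2 ^ k)) \<in> sets M" for m by (intro sets.countable_UN' image_subsetI Fs) auto
    show "decseq (\<lambda>m. \<Union>k\<in>{m..}. F (2 ^ k))" unfolding decseq_def by (intro allI impI UN_mono) auto
    fix m
    have "\<forall>\<^sub>F k in sequentially. ereal (u (2 ^ k)) \<le> Vs (\<Union>k\<in>{m..}. F (2 ^ k))"
      using ev eventually_ge_at_top[of m]
    proof eventually_elim
      case (elim k)
      have "Vs (F (2 ^ k)) \<le> Vs (\<Union>k\<in>{m..}. F (2 ^ k))" using elim(2) by (intro Vs_mono) blast
      thus ?case using elim(1) by (rule order_trans[rotated])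
    qed
    from tendsto_upperbound[OF u1 this] show "1 \<le> Vs (\<Union>k\<in>{m..}. F (2 ^ k))" by (simp add: one_ereal_def)
  qed
  also have "\<dots> \<le> Vs {w\<in>space M. limsup (\<lambda>n. ereal (\<bar>partial_sum X n w\<bar> / lil_norm n)) = \<infinity>}"
  proof (rule Vs_mono, rule subsetI)
    fix w assume w: "w \<in> (\<Inter>m. \<Union>k\<in>{m..}. F (2 ^ k))"
    have "limsup (\<lambda>n. ereal (\<bar>partial_sum X n w\<bar> / lil_norm n)) = \<infinity>"
    proof (rule limsup_infI)
      fix C N
      have "\<forall>\<^sub>F n in sequentially. 2 * C / \<mu> \<le> real n / lil_norm n"
        using lil_norm_over_n unfolding filterlim_at_top by blast
      then obtain N' where N': "\<And>n. n \<ge> N' \<Longrightarrow> 2 * C / \<mu> \<le> real n / lil_norm n" by (auto simp: eventually_sequentially)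
      obtain k where k: "max N N' \<le> k" "w \<in> F (2 ^ k)" using w by blast
      have k2: "k \<le> 2 ^ k" using less_exp[of k] by simp
      let ?n = "2 ^ k :: nat"
      have "real ?n * (\<mu> / 2) \<le> \<bar>s * partial_sum X ?n w\<bar>" using k(2) unfolding F_def by auto
      also have "\<dots> = \<bar>partial_sum X ?n w\<bar>" using s by (simp add: abs_mult)
      finally have S: "real ?n * (\<mu> / 2) / lil_norm ?n \<le> \<bar>partial_sum X ?n w\<bar> / lil_norm ?n"
        by (intro divide_right_mono lil_norm_nonneg)
      have "2 * C / \<mu> \<le> real ?n / lil_norm ?n" using k(1) k2 by (intro N') linarith
      hence "C \<le> real ?n / lil_norm ?n * (\<mu> / 2)" using \<mu> by (simp add: field_simps)
      also have "\<dots> = real ?n * (\<mu> / 2) / lil_norm ?n" by simp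
      also note S
      finally have "C \<le> \<bar>partial_sum X ?n w\<bar> / lil_norm ?n" .
      moreover have "N \<le> ?n" using k(1) k2 by linarith
      ultimately show "\<exists>n\<ge>N. C \<le> \<bar>partial_sum X n w\<bar> / lil_norm n" by blast
    qed
    thus "w \<in> {w\<in>space M. limsup (\<lambda>n. ereal (\<bar>partial_sum X n w\<bar> / lil_norm n)) = \<infinity>}"
      using w unfolding F_def by auto
  qed
  finally show False using bdd unfolding lil_bounded_cond_def by simp
qed

text \<open>Both upper means are at most 0, and by sub-additivity their sum is at least 0.\<close>

lemma mean_zero:
  assumes X: "\<And>n. n \<ge> 1 \<Longrightarrow> X n \<in> H" and id: "identically_distributed E X"
    and ind: "independent_seq H E X" and dom: dominated and cont: "continuous_cap M Vs"
    and bdd: "lil_bounded_cond M H E X" and mom: "lil_moment_cond M H E (X 1)"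
    and tail: "((\<lambda>c::real. E (\<lambda>w. max (\<bar>X 1 w\<bar> - c) 0)) \<longlongrightarrow> 0) at_top"
  shows "E (X 1) = 0" "E (\<lambda>w. - X 1 w) = 0"
proof -
  have L: "X 1 \<in> L1" using tail_L1(1)[OF _ tail] X by simp
  have a: "er (X 1) \<le> 0" "er (\<lambda>w. - X 1 w) \<le> 0"
    using mean_le_zero[OF X id ind dom cont bdd mom tail, of 1] mean_le_zero[OF X id ind dom cont bdd mom tail, of "-1"] by auto
  have "er (\<lambda>w. X 1 w + - X 1 w) \<le> er (X 1) + er (\<lambda>w. - X 1 w)" by (intro er_add L L1_uminus)
  hence "0 \<le> er (X 1) + er (\<lambda>w. - X 1 w)" by (simp add: er_const)
  thus "E (X 1) = 0" "E (\<lambda>w. - X 1 w) = 0" using a L by (simp_all add: E_er L1_uminus)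
qed

end

section \<open>Exponential inequalities under negative dependence\<close>

text \<open>Taylor with Lagrange remainder. The coefficient 1/2 of the square must be exact, as it
  determines the constant in the law of the iterated logarithm.\<close>

lemma exp_le_cubic: "exp u \<le> 1 + u + u\<^sup>2 / 2 + \<bar>u\<bar> ^ 3 * exp \<bar>u\<bar> / 6" for u :: real
proof -
  obtain t where t: "\<bar>t\<bar> \<le> \<bar>u\<bar>" "exp u = (\<Sum>m<3. u ^ m / fact m) + exp t / fact 3 * u ^ 3"
    using Maclaurin_exp_le[of u 3] by blast
  have "exp t / fact 3 * u ^ 3 \<le> exp \<bar>u\<bar> / 6 * \<bar>u\<bar> ^ 3"
  proof -
    have "exp t / fact 3 * u ^ 3 \<le> exp t / 6 * \<bar>u\<bar> ^ 3"
      by (simp add: fact_numeral mult_left_mono power_abs[symmetric])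
    also have "\<dots> \<le> exp \<bar>u\<bar> / 6 * \<bar>u\<bar> ^ 3" using t(1) by (intro mult_right_mono) auto
    finally show ?thesis .
  qed
  thus ?thesis using t(2) by (simp add: eval_nat_numeral mult.commute)
qed

text \<open>The function \<open>u \<mapsto> exp u - u\<close> is flat at \<open>0\<close>, which makes it (unlike \<open>exp\<close>) compatible with the
  reflection at \<open>0\<close> in the recursion for \<open>bmax\<close>.\<close>

lemma exp_minus_id_reflect: "exp (max 0 (a + w)) - max 0 (a + w) \<le> (exp a - a) + exp a * (exp w - 1) - w" for a w :: real
proof -
  have "exp (max 0 u) - max 0 u \<le> exp u - u" for u :: real
  proof (cases "0 \<le> u")
    case False
    hence "exp (max 0 u) - max 0 u = 1" by (simp add: max_def)
    thus ?thesis using exp_ge_add_one_self[of u] by linarith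
  qed (simp add: max_def)
  from this[of "a + w"] show ?thesis by (simp add: exp_add algebra_simps)
qed

text \<open>Recovers the exponential from the flat function, at the price of a factor 2. For
  \<open>a \<ge> 0\<close> it reduces to \<open>(a - 1)\<^sup>2 + 1 \<ge> 0\<close> after the
  quadratic lower bound for \<open>exp\<close>.\<close>

lemma exp_le_twice_minus_id: "exp a \<le> 2 * (exp a - a)" for a :: real
proof (cases "0 \<le> a")
  case True
  have "1 + a + a\<^sup>2 / 2 \<le> exp a" using True by (rule exp_lower_Taylor_quadratic)
  moreover have "0 \<le> (a - 1)\<^sup>2" by simp
  ultimately show ?thesis by (simp add: power2_diff)
next
  case False
  thus ?thesis using exp_gt_zero[of a] unfolding right_diff_distrib by linarith
qed

context sublinear_expectation_space
begin

text \<open>All that is used of negative dependence. It makes sense for the empty past (\<open>k = 0\<close>), and negative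
  dependence of \<open>X\<close> yields it for \<open>- X\<close> as well.\<close>

definition neg_dep :: "(nat \<Rightarrow> 'a \<Rightarrow> real) \<Rightarrow> bool" where
  "neg_dep X \<longleftrightarrow> (\<forall>k. \<forall>\<phi>\<in>vBL k. \<forall>f\<in>BL. coord_nondecreasing k \<phi> \<longrightarrow> mono f \<longrightarrow>
     (\<forall>x. 0 \<le> \<phi> x) \<longrightarrow> 0 \<le> er (\<lambda>w. f (X (k + 1) w)) \<longrightarrow>
     er (\<lambda>w. \<phi> (hist X k w) * f (X (k + 1) w)) \<le> er (\<lambda>w. \<phi> (hist X k w)) * er (\<lambda>w. f (X (k + 1) w)))"

lemma neg_dep_er:
  assumes X: "\<And>n. n \<ge> 1 \<Longrightarrow> X n \<in> H" and neg: "negatively_dependent_seq M E X"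
    and \<phi>: "\<phi> \<in> vBL k" "\<And>x. 0 \<le> \<phi> x" and f: "f \<in> BL" "0 \<le> er (\<lambda>w. f (X (k + 1) w))"
    and mon: "coord_nondecreasing k \<phi> \<and> mono f \<or> coord_nonincreasing k \<phi> \<and> antimono f"
  shows "er (\<lambda>w. \<phi> (hist X k w) * f (X (k + 1) w)) \<le> er (\<lambda>w. \<phi> (hist X k w)) * er (\<lambda>w. f (X (k + 1) w))"
proof (cases "k = 0")
  case True
  have "(\<lambda>w. f (X 1 w)) \<in> L1" using f X by (intro BL_L1) auto
  thus ?thesis using True \<phi>(2)[of "[]"] by (simp add: hist_def eval_vec_def er_const er_scale)
next
  case False
  let ?Xs = "map X [1..<k + 1]" and ?Ys = "[X (k + 1)]"
  let ?f = "\<lambda>xs. f (xs ! 0)"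
  have neg_dep: "neg_dep_to M E ?Ys ?Xs" using neg False unfolding negatively_dependent_seq_def by auto
  have 1: "\<phi> \<in> C_l_Lip (length ?Xs)" using vBL_C_l_Lip[OF \<phi>(1)] by (simp del: upt_Suc)
  have 2: "?f \<in> C_l_Lip (length ?Ys)" using vBL_C_l_Lip[OF vBL_nth[OF f(1), of 0 1]] by simp
  note * = bspec[OF bspec[OF neg_dep[unfolded neg_dep_to_def] 1] 2, unfolded Let_def]
  have fy: "?f (eval_vec ?Ys w) = f (X (k + 1) w)" for w by (simp add: eval_vec_def)
  have UL: "(\<lambda>w. \<phi> (hist X k w)) \<in> L1" by (rule hist_L1[OF X \<phi>(1)])
  have WL: "(\<lambda>w. f (X (k + 1) w)) \<in> L1" using f X by (intro BL_L1) auto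
  have UWL: "(\<lambda>w. \<phi> (hist X k w) * f (X (k + 1) w)) \<in> L1" by (rule hist_mult_L1[OF X \<phi>(1) f(1)])
  have "E (\<lambda>w. \<phi> (hist X k w) * f (X (k + 1) w)) \<le> E (\<lambda>w. \<phi> (hist X k w)) * E (\<lambda>w. f (X (k + 1) w))"
  proof (rule *[THEN mp, THEN mp, THEN mp, THEN mp, THEN mp, THEN mp, unfolded fy, folded hist_def])
    have m1: "coord_nondecreasing (length ?Ys) ?f" if "mono f"
      unfolding coord_nondecreasing_def using that by (auto intro!: monoD[OF that] list_all2_nthD)
    have m2: "coord_nonincreasing (length ?Ys) ?f" if "antimono f"
      unfolding coord_nonincreasing_def using that by (auto intro!: antimonoD[OF that] list_all2_nthD)
    have l: "length ?Xs = k" by (simp del: upt_Suc)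
    show "coord_nondecreasing (length ?Xs) \<phi> \<and> coord_nondecreasing (length ?Ys) ?f \<or>
        coord_nonincreasing (length ?Xs) \<phi> \<and> coord_nonincreasing (length ?Ys) ?f"
      unfolding l using mon m1 m2 by blast
    show "\<forall>w\<in>space M. 0 \<le> \<phi> (hist X k w)" using \<phi>(2) by simp
    show "0 \<le> E (\<lambda>w. f (X (k + 1) w))" using f(2) by (simp only: E_er[OF WL]) simp
  qed (use UL WL UWL in \<open>simp_all add: L1_def\<close>)
  thus ?thesis by (simp only: E_er[OF UL] E_er[OF WL] E_er[OF UWL] times_ereal.simps ereal_less_eq)
qed

text \<open>Reflection exchanges nondecreasing and nonincreasing functions, and negative dependence
  covers both kinds of pairs.\<close>

lemma neg_dep_uminus:
  assumes X: "\<And>n. n \<ge> 1 \<Longrightarrow> X n \<in> H" and neg: "negatively_dependent_seq M E X"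
  shows "neg_dep X" "neg_dep (\<lambda>n w. - X n w)"
proof -
  show "neg_dep X" unfolding neg_dep_def using neg_dep_er[OF X neg] by blast
  show "neg_dep (\<lambda>n w. - X n w)" unfolding neg_dep_def
  proof (intro allI ballI impI)
    fix k \<phi> f assume a: "\<phi> \<in> vBL k" "f \<in> BL" "coord_nondecreasing k \<phi>" "mono f" "\<forall>x. 0 \<le> \<phi> x"
      "0 \<le> er (\<lambda>w. f (- X (k + 1) w))"
    have fb: "(\<lambda>x. f (- x)) \<in> BL"
    proof -
      obtain C where "\<And>x. \<bar>f x\<bar> \<le> C" "\<And>x y. \<bar>f x - f y\<bar> \<le> C * \<bar>x - y\<bar>" using a(2) unfolding BL_def by blast
      note C = this
      show ?thesis
      proof (rule BL_I[of _ C C])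
        show "\<bar>f (- x) - f (- y)\<bar> \<le> C * \<bar>x - y\<bar>" for x y using C(2)[of "- x" "- y"] by (simp add: abs_minus_commute)
      qed (rule C)
    qed
    have "coord_nonincreasing k (\<lambda>x. \<phi> (map uminus x))"
      unfolding coord_nonincreasing_def
    proof (intro allI impI)
      fix x y :: "real list" assume "length x = k" "length y = k" "list_all2 (\<le>) x y"
      thus "\<phi> (map uminus y) \<le> \<phi> (map uminus x)"
        using a(3) unfolding coord_nondecreasing_def by (auto simp: list_all2_conv_all_nth)
    qed
    moreover have "antimono (\<lambda>x. f (- x))" using a(4) by (auto simp: antimono_def mono_def)
    ultimately show "er (\<lambda>w. \<phi> (hist (\<lambda>n w. - X n w) k w) * f (- X (k + 1) w))
        \<le> er (\<lambda>w. \<phi> (hist (\<lambda>n w. - X n w) k w)) * er (\<lambda>w. f (- X (k + 1) w))"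
      unfolding hist_uminus using a by (intro neg_dep_er[OF X neg vBL_uminus_arg[OF a(1)] _ fb]) auto
  qed
qed

lemma neg_depD:
  assumes "neg_dep X" "\<phi> \<in> vBL k" "f \<in> BL" "coord_nondecreasing k \<phi>" "mono f" "\<And>x. 0 \<le> \<phi> x" "0 \<le> er (\<lambda>w. f (X (k + 1) w))"
  shows "er (\<lambda>w. \<phi> (hist X k w) * f (X (k + 1) w)) \<le> er (\<lambda>w. \<phi> (hist X k w)) * er (\<lambda>w. f (X (k + 1) w))"
  using assms unfolding neg_dep_def by auto

lemma er_exp_clip:
  assumes Z: "Z \<in> H" and B: "0 \<le> B" and t: "0 \<le> t"
    and \<mu>: "er (\<lambda>w. clip B (Z w)) \<le> \<mu>" and s2: "er (\<lambda>w. (clip B (Z w))\<^sup>2) \<le> s2"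
    and m3: "er (\<lambda>w. \<bar>clip B (Z w)\<bar> ^ 3) \<le> m3"
  shows "er (\<lambda>w. exp (t * clip B (Z w))) \<le> 1 + (t * \<mu> + t\<^sup>2 * s2 / 2 + t ^ 3 * exp (t * B) * m3 / 6)"
proof -
  let ?c = "\<lambda>w. clip B (Z w)"
  have L: "?c \<in> L1" "(\<lambda>w. (?c w)\<^sup>2) \<in> L1" "(\<lambda>w. \<bar>?c w\<bar> ^ 3) \<in> L1" "(\<lambda>w. exp (t * ?c w)) \<in> L1"
    using Z B t by (auto intro: BL_L1[OF clip_BL] BL_L1[OF clip_sq_BL] BL_L1[OF clip_cube_BL] BL_L1[OF exp_clip_BL])
  let ?w = "\<lambda>w. (t * ?c w + t\<^sup>2 / 2 * (?c w)\<^sup>2) + t ^ 3 * exp (t * B) / 6 * \<bar>?c w\<bar> ^ 3"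
  have w1: "(\<lambda>w. t * ?c w) \<in> L1" "(\<lambda>w. t\<^sup>2 / 2 * (?c w)\<^sup>2) \<in> L1" "(\<lambda>w. t ^ 3 * exp (t * B) / 6 * \<bar>?c w\<bar> ^ 3) \<in> L1"
    by (intro L1_scale L)+
  have wL: "?w \<in> L1" by (intro L1_add w1)
  have "er (\<lambda>w. exp (t * ?c w)) \<le> er (\<lambda>w. ?w w + 1)"
  proof (rule er_mono[OF L(4) L1_add[OF wL L1_const]])
    fix w
    have tc: "\<bar>t * ?c w\<bar> \<le> t * B" using clip_bound[OF B, of "Z w"] t by (simp add: abs_mult mult_left_mono)
    have "exp (t * ?c w) \<le> 1 + t * ?c w + (t * ?c w)\<^sup>2 / 2 + \<bar>t * ?c w\<bar> ^ 3 * exp \<bar>t * ?c w\<bar> / 6"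
      by (rule exp_le_cubic)
    also have "\<bar>t * ?c w\<bar> ^ 3 * exp \<bar>t * ?c w\<bar> \<le> \<bar>t * ?c w\<bar> ^ 3 * exp (t * B)"
      using tc by (intro mult_left_mono) auto
    also have "\<bar>t * ?c w\<bar> ^ 3 = t ^ 3 * \<bar>?c w\<bar> ^ 3" using t by (simp add: abs_mult power_mult_distrib)
    finally show "exp (t * ?c w) \<le> ?w w + 1" by (simp add: power_mult_distrib algebra_simps)
  qed
  also have "\<dots> = er ?w + 1" by (rule er_shift[OF wL])
  also have "er ?w \<le> er (\<lambda>w. t * ?c w + t\<^sup>2 / 2 * (?c w)\<^sup>2) + er (\<lambda>w. t ^ 3 * exp (t * B) / 6 * \<bar>?c w\<bar> ^ 3)"
    by (intro er_add L1_add w1)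
  also have "er (\<lambda>w. t * ?c w + t\<^sup>2 / 2 * (?c w)\<^sup>2) \<le> er (\<lambda>w. t * ?c w) + er (\<lambda>w. t\<^sup>2 / 2 * (?c w)\<^sup>2)"
    by (intro er_add w1)
  also have "er (\<lambda>w. t * ?c w) \<le> t * \<mu>" using \<mu> t by (simp add: er_scale[OF L(1)] mult_left_mono)
  also have "er (\<lambda>w. t\<^sup>2 / 2 * (?c w)\<^sup>2) \<le> t\<^sup>2 / 2 * s2"
    using s2 by (subst er_scale[OF L(2)]) (auto intro: mult_left_mono)
  also have "er (\<lambda>w. t ^ 3 * exp (t * B) / 6 * \<bar>?c w\<bar> ^ 3) \<le> t ^ 3 * exp (t * B) / 6 * m3"
    using m3 t by (subst er_scale[OF L(3)]) (auto intro: mult_left_mono)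
  finally show ?thesis by simp
qed

text \<open>Chernoff bound. The newest variable is split off last, so the past enters through a
  nondecreasing nonnegative product.\<close>

lemma exp_ineq_sum:
  assumes X: "\<And>n. n \<ge> 1 \<Longrightarrow> X n \<in> H" and id: "identically_distributed E X" and neg_dep: "neg_dep X"
    and B: "0 \<le> B" and t: "0 \<le> t" and \<delta>: "er (\<lambda>w. exp (t * clip B (X 1 w))) \<le> 1 + \<delta>"
  shows "cap {w\<in>space M. x \<le> (\<Sum>i<n. clip B (X (i + 1) w))} \<le> exp (- t * x + real n * \<delta>)"
proof -
  let ?e = "\<lambda>x. exp (t * clip B x)"
  define F where "F = er (\<lambda>w. ?e (X 1 w))"
  have eb: "?e \<in> BL" by (rule exp_clip_BL[OF B t])
  have X1: "X 1 \<in> H" using X by simp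
  have F0: "0 \<le> F" unfolding F_def by (rule er_nonneg[OF BL_L1[OF eb X1]]) simp
  let ?P = "\<lambda>k xs. \<Prod>i<k. ?e (xs ! i)"
  have PB: "?P k \<in> vBL k" for k by (intro vBL_prod vBL_nth eb) auto
  have P: "?P k (hist X k w) = exp (t * (\<Sum>i<k. clip B (X (i + 1) w)))" for k w
  proof -
    have "?P k (hist X k w) = (\<Prod>i<k. ?e (X (i + 1) w))" by (intro prod.cong) (auto simp: hist_nth)
    thus ?thesis by (simp add: exp_sum sum_distrib_left)
  qed
  have "er (\<lambda>w. ?P k (hist X k w)) \<le> F ^ k" for k
  proof (induction k)
    case (Suc k)
    have mon: "coord_nondecreasing k (?P k)"
      unfolding coord_nondecreasing_def
      by (intro allI impI prod_mono) (auto simp: list_all2_conv_all_nth intro!: mult_left_mono clip_mono t)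
    have id': "er (\<lambda>w. ?e (X (k + 1) w)) = F" unfolding F_def by (rule BL_ident[OF id X eb]) auto
    have "?P (Suc k) (hist X (Suc k) w) = ?P k (hist X k w) * ?e (X (k + 1) w)" for w
      unfolding P by (simp add: distrib_left exp_add)
    hence "er (\<lambda>w. ?P (Suc k) (hist X (Suc k) w)) = er (\<lambda>w. ?P k (hist X k w) * ?e (X (k + 1) w))" by simp
    also have "\<dots> \<le> er (\<lambda>w. ?P k (hist X k w)) * er (\<lambda>w. ?e (X (k + 1) w))"
    proof (rule neg_depD[OF neg_dep PB eb mon])
      show "mono ?e" by (auto simp: mono_def intro!: mult_left_mono clip_mono t)
      show "0 \<le> er (\<lambda>w. ?e (X (k + 1) w))" using F0 id' by simp
    qed (auto intro: prod_nonneg)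
    also have "\<dots> = er (\<lambda>w. ?P k (hist X k w)) * F" unfolding id' ..
    also have "\<dots> \<le> F ^ k * F" using Suc F0 by (intro mult_right_mono)
    finally show ?case by (simp add: mult.commute)
  qed (simp add: er_const)
  hence Pn: "er (\<lambda>w. ?P n (hist X n w)) \<le> F ^ n" .
  have "cap {w\<in>space M. x \<le> (\<Sum>i<n. clip B (X (i + 1) w))} \<le> er (\<lambda>w. ?P n (hist X n w)) / exp (t * x)"
    by (rule cap_markov[OF hist_L1[OF X PB]]) (auto simp: P intro: mult_left_mono t)
  also have "\<dots> \<le> F ^ n / exp (t * x)" using Pn by (intro divide_right_mono) auto
  also have "\<dots> \<le> exp \<delta> ^ n / exp (t * x)"
  proof (intro divide_right_mono power_mono F0)
    show "F \<le> exp \<delta>" using \<delta> exp_ge_add_one_self[of \<delta>] unfolding F_def by linarith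
  qed simp
  also have "\<dots> = exp (- t * x + real n * \<delta>)" by (simp add: exp_diff exp_of_nat_mult flip: exp_minus)
  finally show ?thesis .
qed

text \<open>The expectations \<open>G k\<close> of the flat function at \<open>t * bmax\<close> grow
  by a factor at most \<open>exp (2 * \<delta> + t * \<mu>)\<close> per step. The 2 before
  \<open>\<delta>\<close> and the leading 2 both come from passing between \<open>exp a\<close> and
  \<open>exp a - a\<close>.\<close>

lemma exp_ineq_max:
  assumes X: "\<And>n. n \<ge> 1 \<Longrightarrow> X n \<in> H" and id: "identically_distributed E X" and neg_dep: "neg_dep X"
    and B: "0 \<le> B" and t: "0 \<le> t" and \<delta>: "er (\<lambda>w. exp (t * clip B (X 1 w))) \<le> 1 + \<delta>" "0 \<le> \<delta>"
    and \<mu>: "er (\<lambda>w. - clip B (X 1 w)) \<le> \<mu>" "0 \<le> \<mu>" and mn: "m \<le> n"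
  shows "cap {w\<in>space M. x \<le> bmax B m (\<lambda>i. X (i + 1) w) n} \<le> 2 * exp (- t * x + real (n - m) * (2 * \<delta> + t * \<mu>))"
proof -
  let ?g = "\<lambda>a::real. exp (t * a) - t * a"
  let ?b = "\<lambda>k xs. bmax B m ((!) xs) k"
  let ?e = "\<lambda>x. exp (t * clip B x)"
  have X1: "X 1 \<in> H" using X by simp
  have eb: "?e \<in> BL" by (rule exp_clip_BL[OF B t])
  have bB: "?b k \<in> vBL k" for k by (rule bmax_vBL[OF B]) simp
  have tb: "(\<lambda>xs. t * ?b k xs) \<in> vBL k" for k by (intro vBL_mult vBL_const bB)
  have exB: "(\<lambda>xs. exp (t * ?b k xs)) \<in> vBL k" for k
    by (rule vBL_comp[OF tb, of exp exp]) (rule exp_lipschitz)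
  have gB: "(\<lambda>xs. ?g (?b k xs)) \<in> vBL k" for k
    using vBL_add[OF exB vBL_uminus[OF tb]] by simp
  have bh: "?b k (hist X k w) = bmax B m (\<lambda>i. X (i + 1) w) k" for k w
    by (rule bmax_cong) (simp add: hist_nth)
  define G where "G = (\<lambda>k. er (\<lambda>w. ?g (?b k (hist X k w))))"
  have gL: "(\<lambda>w. ?g (?b k (hist X k w))) \<in> L1" for k by (rule hist_L1[OF X gB])
  have G1: "1 \<le> G k" for k
    unfolding G_def using er_mono[OF L1_const[of 1] gL[of k]] exp_ge_add_one_self by (simp add: er_const algebra_simps)
  have step: "G (Suc k) \<le> G k * exp (2 * \<delta> + t * \<mu>)" if "m \<le> k" for k
  proof -
    \<comment> \<open>The expectation of \<open>?e - 1\<close> may be negative, which negative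
      dependence excludes; the shift by \<open>d \<ge> 0\<close> makes it exactly
      \<open>\<delta>\<close>.\<close>
    define d where "d = \<delta> - (er (\<lambda>w. ?e (X 1 w)) - 1)"
    have d: "0 \<le> d" using \<delta> unfolding d_def by simp
    let ?f = "\<lambda>x. ?e x + (d - 1)"
    have fB: "?f \<in> BL"
      by (rule BL_lip_comp[OF eb, of "\<lambda>y. y + (d - 1)" "\<lambda>_. 1"]) auto
    have erf: "er (\<lambda>w. ?f (X (k + 1) w)) = \<delta>"
    proof -
      have "er (\<lambda>w. ?f (X (k + 1) w)) = er (\<lambda>w. ?f (X 1 w))" by (rule BL_ident[OF id X fB]) auto
      also have "\<dots> = \<delta>" using er_shift[OF BL_L1[OF eb X1], of "d - 1"] by (simp add: d_def)
      finally show ?thesis .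
    qed
    let ?U = "\<lambda>w. exp (t * ?b k (hist X k w))"
    have UL: "?U \<in> L1" by (rule hist_L1[OF X exB])
    have prodL: "(\<lambda>w. ?U w * ?f (X (k + 1) w)) \<in> L1" by (rule hist_mult_L1[OF X exB fB])
    have cL: "(\<lambda>w. clip B (X (k + 1) w)) \<in> L1" using B X by (intro BL_L1[OF clip_BL]) auto
    have ncL: "(\<lambda>w. t * - clip B (X (k + 1) w)) \<in> L1" by (intro L1_scale L1_uminus cL)
    have mon: "coord_nondecreasing k (\<lambda>xs. exp (t * ?b k xs))"
      unfolding coord_nondecreasing_def by (auto simp: list_all2_conv_all_nth intro!: mult_left_mono bmax_mono t)
    have "er (\<lambda>w. ?U w * ?f (X (k + 1) w)) \<le> er ?U * er (\<lambda>w. ?f (X (k + 1) w))"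
      by (rule neg_depD[OF neg_dep exB fB mon]) (use \<delta>(2) erf in \<open>auto simp: mono_def intro!: mult_left_mono clip_mono t\<close>)
    also have "\<dots> = er ?U * \<delta>" unfolding erf ..
    also have "er ?U \<le> er (\<lambda>w. 2 * ?g (?b k (hist X k w)))"
      by (rule er_mono[OF UL L1_scale[OF gL]]) (rule exp_le_twice_minus_id)
    also have "\<dots> = 2 * G k" unfolding G_def by (rule er_scale[OF gL]) simp
    finally have 1: "er (\<lambda>w. ?U w * ?f (X (k + 1) w)) \<le> 2 * G k * \<delta>" using \<delta>(2) by (simp add: mult_right_mono)
    have "er (\<lambda>w. t * - clip B (X (k + 1) w)) = t * er (\<lambda>w. - clip B (X (k + 1) w))" by (rule er_scale[OF L1_uminus[OF cL] t])
    also have "er (\<lambda>w. - clip B (X (k + 1) w)) = er (\<lambda>w. - clip B (X 1 w))"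
      by (rule BL_ident[OF id X BL_uminus[OF clip_BL[OF B]]]) auto
    finally have 2: "er (\<lambda>w. t * - clip B (X (k + 1) w)) \<le> t * \<mu>" using \<mu>(1) t by (simp add: mult_left_mono)
    have "G (Suc k) \<le> er (\<lambda>w. (?g (?b k (hist X k w)) + ?U w * ?f (X (k + 1) w)) + t * - clip B (X (k + 1) w))"
      unfolding G_def
    proof (rule er_mono[OF gL])
      show "(\<lambda>w. (?g (?b k (hist X k w)) + ?U w * ?f (X (k + 1) w)) + t * - clip B (X (k + 1) w)) \<in> L1"
        by (intro L1_add gL prodL ncL)
      fix w
      let ?a = "t * ?b k (hist X k w)" and ?w = "t * clip B (X (k + 1) w)"
      have "t * ?b (Suc k) (hist X (Suc k) w) = max 0 (?a + ?w)"
        unfolding bh using that t by (auto simp: max_def distrib_left[symmetric] mult_le_0_iff zero_le_mult_iff)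
      hence "?g (?b (Suc k) (hist X (Suc k) w)) \<le> (exp ?a - ?a) + exp ?a * (exp ?w - 1) - ?w"
        using exp_minus_id_reflect[of ?a ?w] by simp
      also have "exp ?a * (exp ?w - 1) \<le> ?U w * ?f (X (k + 1) w)" using d by (intro mult_left_mono) auto
      finally show "?g (?b (Suc k) (hist X (Suc k) w)) \<le> (?g (?b k (hist X k w)) + ?U w * ?f (X (k + 1) w)) + t * - clip B (X (k + 1) w)"
        by simp
    qed
    also have "\<dots> \<le> er (\<lambda>w. ?g (?b k (hist X k w)) + ?U w * ?f (X (k + 1) w)) + er (\<lambda>w. t * - clip B (X (k + 1) w))"
      by (intro er_add L1_add gL prodL ncL)
    also have "er (\<lambda>w. ?g (?b k (hist X k w)) + ?U w * ?f (X (k + 1) w)) \<le> G k + er (\<lambda>w. ?U w * ?f (X (k + 1) w))"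
      unfolding G_def by (intro er_add gL prodL)
    finally have "G (Suc k) \<le> G k + 2 * G k * \<delta> + t * \<mu> * 1" using 1 2 by simp
    \<comment> \<open>\<open>1 \<le> G k\<close> turns the additive error into a multiplicative
      one.\<close>
    also have "\<dots> \<le> G k + 2 * G k * \<delta> + t * \<mu> * G k" using G1[of k] t \<mu>(2) by (intro add_left_mono mult_left_mono) auto
    also have "\<dots> = G k * (1 + (2 * \<delta> + t * \<mu>))" by (simp add: algebra_simps)
    also have "\<dots> \<le> G k * exp (2 * \<delta> + t * \<mu>)" using G1[of k] by (intro mult_left_mono exp_ge_add_one_self) auto
    finally show ?thesis .
  qed
  \<comment> \<open>Up to \<open>m\<close> nothing has been summed, so only \<open>n - m\<close>
    steps count; this is the gain for a short block.\<close>
  have Gm: "G m = 1" unfolding G_def by (simp add: bmax_zero er_const)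
  have "G (m + j) \<le> exp (real j * (2 * \<delta> + t * \<mu>))" for j
  proof (induction j)
    case (Suc j)
    have "G (m + Suc j) \<le> G (m + j) * exp (2 * \<delta> + t * \<mu>)" using step[of "m + j"] by simp
    also have "\<dots> \<le> exp (real j * (2 * \<delta> + t * \<mu>)) * exp (2 * \<delta> + t * \<mu>)" using Suc by (intro mult_right_mono) auto
    also have "\<dots> = exp (real (Suc j) * (2 * \<delta> + t * \<mu>))" by (simp add: exp_add[symmetric] algebra_simps)
    finally show ?case .
  qed (simp add: Gm)
  from this[of "n - m"] have Gn: "G n \<le> exp (real (n - m) * (2 * \<delta> + t * \<mu>))" using mn by simp
  have "cap {w\<in>space M. x \<le> bmax B m (\<lambda>i. X (i + 1) w) n} \<le> er (\<lambda>w. 2 * ?g (?b n (hist X n w))) / exp (t * x)"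
  proof (rule cap_markov[OF L1_scale[OF gL]])
    fix w
    have "0 \<le> exp c - c" for c :: real using exp_ge_add_one_self[of c] by linarith
    thus "0 \<le> 2 * ?g (?b n (hist X n w))" by (intro mult_nonneg_nonneg) simp_all
    assume "w \<in> {w\<in>space M. x \<le> bmax B m (\<lambda>i. X (i + 1) w) n}"
    hence "exp (t * x) \<le> exp (t * ?b n (hist X n w))" unfolding bh using t by (auto intro: mult_left_mono)
    also have "\<dots> \<le> 2 * ?g (?b n (hist X n w))" by (rule exp_le_twice_minus_id)
    finally show "exp (t * x) \<le> 2 * ?g (?b n (hist X n w))" .
  qed simp
  also have "\<dots> = 2 * G n / exp (t * x)" unfolding G_def by (subst er_scale[OF gL]) auto
  also have "\<dots> \<le> 2 * exp (real (n - m) * (2 * \<delta> + t * \<mu>)) / exp (t * x)" using Gn by (intro divide_right_mono) auto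
  also have "\<dots> = 2 * exp (- t * x + real (n - m) * (2 * \<delta> + t * \<mu>))" by (simp add: exp_diff)
  finally show ?thesis .
qed

end

section \<open>Summability along geometric blocks\<close>

text \<open>\<open>l ^ 3 / 48\<close> is the cubic term of the exponential series at
  \<open>l / 2\<close>.\<close>

lemma cube_exp_bound: "0 \<le> l \<Longrightarrow> l ^ 3 * exp (- (l / 2)) \<le> 48" for l :: real
proof -
  assume l: "0 \<le> l"
  have "(l / 2) ^ 3 / fact 3 \<le> (\<Sum>n<4. (l / 2) ^ n / fact n)"
    using l by (intro member_le_sum[of 3 "{..<4}" "\<lambda>n. (l / 2) ^ n / fact n"]) auto
  also have "\<dots> \<le> exp (l / 2)"
  proof -
    obtain t where t: "exp (l / 2) = (\<Sum>m<4. (l / 2) ^ m / fact m) + exp t / fact 4 * (l / 2) ^ 4"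
      using Maclaurin_exp_le[of "l / 2" 4] by blast
    have "0 \<le> exp t / fact 4 * (l / 2) ^ 4" using l by simp
    thus ?thesis using t by linarith
  qed
  finally have "l ^ 3 \<le> 48 * exp (l / 2)" by (simp add: power_divide fact_numeral)
  thus ?thesis by (simp add: exp_minus field_simps)
qed

text \<open>The exponent is optimised at \<open>\<tau> = min (T * L k) (- ln (\<Lambda> k) / \<kappa>2)\<close>: the first value is the one of
  the Gaussian regime, the second keeps the cubic error term bounded and yields a bound of order \<open>\<Lambda> k\<close>.\<close>

lemma summable_exponential_bounds:
  fixes p \<epsilon> \<Lambda> L :: "nat \<Rightarrow> real"
  assumes p: "\<And>k. 0 \<le> p k"
    and bound: "\<forall>\<^sub>F k in sequentially. \<forall>\<tau>\<ge>0.
      p k \<le> 2 * exp (- \<tau> * \<kappa> + \<tau> * \<epsilon> k + D * \<tau>\<^sup>2 / L k + \<tau> ^ 3 * exp (\<eta> * \<tau>) * \<Lambda> k)"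
    and eps: "\<epsilon> \<longlonglongrightarrow> 0" and L: "\<And>k. 1 \<le> L k"
    and \<Lambda>: "\<And>k. 0 < \<Lambda> k" "summable \<Lambda>"
    and sumL: "\<And>\<beta>. 1 < \<beta> \<Longrightarrow> summable (\<lambda>k. exp (- \<beta> * L k))"
    and D: "0 \<le> D" and T: "0 < T" and \<kappa>: "1 < (\<kappa> - D * T) * T" and \<eta>: "0 \<le> \<eta>" "\<eta> \<le> (\<kappa> - D * T) / 4"
  shows "summable p"
proof -
  \<comment> \<open>\<open>\<kappa>1\<close> is the drift that survives the quadratic term when
    \<open>\<tau> \<le> T * L k\<close>. The midpoint \<open>\<kappa>2\<close> leaves room for
    \<open>\<epsilon> k\<close>, keeps \<open>\<kappa>2 * T\<close> above 1 and is at least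
    \<open>\<kappa>1 / 2\<close>.\<close>
  define \<kappa>1 where "\<kappa>1 = \<kappa> - D * T"
  define \<kappa>2 where "\<kappa>2 = (\<kappa>1 + 1 / T) / 2"
  have k1: "1 / T < \<kappa>1" using \<kappa> T unfolding \<kappa>1_def by (simp add: field_simps)
  have mid: "0 < (x + u) / 2 \<and> (x + u) / 2 < x \<and> x / 2 \<le> (x + u) / 2 \<and> u < (x + u) / 2"
    if "0 < u" "u < x" for u x :: real using that by (simp add: field_simps)
  have "0 < 1 / T" using T by simp
  from mid[OF this k1] have k2: "0 < \<kappa>2" "\<kappa>2 < \<kappa>1" "\<kappa>1 / 2 \<le> \<kappa>2" "1 < \<kappa>2 * T"
    unfolding \<kappa>2_def[symmetric] using T by (simp_all add: field_simps)
  define c where "c = 1 / \<kappa>2"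
  have c: "0 < c" "\<kappa>2 * c = 1" using k2 unfolding c_def by auto
  define C where "C = 2 * exp (48 * c ^ 3)"
  have ev: "\<forall>\<^sub>F k in sequentially. p k \<le> C * (exp (- (\<kappa>2 * T) * L k) + \<Lambda> k)"
  proof -
    have "\<forall>\<^sub>F k in sequentially. \<epsilon> k < \<kappa>1 - \<kappa>2" using order_tendstoD(2)[OF eps] k2 by simp
    moreover have "\<forall>\<^sub>F k in sequentially. \<Lambda> k < 1" using order_tendstoD(2)[OF summable_LIMSEQ_zero[OF \<Lambda>(2)]] by simp
    ultimately show ?thesis using bound
    proof eventually_elim
      case (elim k)
      define l where "l = - ln (\<Lambda> k)"
      have l: "0 < l" "\<Lambda> k = exp (- l)" using elim(2) \<Lambda>(1)[of k] unfolding l_def by auto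
      define \<tau> where "\<tau> = min (T * L k) (c * l)"
      have \<tau>: "0 \<le> \<tau>" "\<tau> \<le> T * L k" "\<tau> \<le> c * l" using T L[of k] c l unfolding \<tau>_def by auto
      have "D * \<tau>\<^sup>2 / L k = D * \<tau> * (\<tau> / L k)" by (simp add: power2_eq_square)
      also have "\<dots> \<le> D * \<tau> * T" using \<tau> D L[of k] by (intro mult_left_mono) (auto simp: field_simps)
      finally have 1: "D * \<tau>\<^sup>2 / L k \<le> D * \<tau> * T" .
      have "\<tau> ^ 3 * exp (\<eta> * \<tau>) * \<Lambda> k \<le> (c * l) ^ 3 * exp (l / 2) * exp (- l)"
        unfolding l(2)
      proof (intro mult_right_mono mult_mono power_mono \<tau>)
        \<comment> \<open>\<open>\<eta> \<le> \<kappa>1 / 4 \<le> \<kappa>2 / 2\<close> spends only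
          half of the decay \<open>exp (- l)\<close> of \<open>\<Lambda> k\<close>; the other half
          absorbs the cube.\<close>
        have "\<eta> * \<tau> \<le> (\<kappa>2 / 2) * (c * l)" using \<eta> k2 \<tau> l c unfolding \<kappa>1_def[symmetric] by (intro mult_mono) auto
        also have "\<dots> = (\<kappa>2 * c) * l / 2" by simp
        finally show "exp (\<eta> * \<tau>) \<le> exp (l / 2)" using c by simp
      qed (use c l in auto)
      also have "\<dots> = c ^ 3 * (l ^ 3 * exp (- (l / 2)))" by (simp add: power_mult_distrib mult.assoc flip: exp_add)
      also have "\<dots> \<le> c ^ 3 * 48" using c l by (intro mult_left_mono cube_exp_bound) auto
      finally have 2: "\<tau> ^ 3 * exp (\<eta> * \<tau>) * \<Lambda> k \<le> 48 * c ^ 3" by simp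
      have 3: "\<tau> * \<epsilon> k \<le> \<tau> * (\<kappa>1 - \<kappa>2)" using elim(1) \<tau> by (intro mult_left_mono) auto
      have "- \<tau> * \<kappa> + \<tau> * \<epsilon> k + D * \<tau>\<^sup>2 / L k + \<tau> ^ 3 * exp (\<eta> * \<tau>) * \<Lambda> k
          \<le> - \<tau> * \<kappa> + \<tau> * (\<kappa>1 - \<kappa>2) + D * \<tau> * T + 48 * c ^ 3" using 1 2 3 by linarith
      also have "\<dots> = - \<kappa>2 * \<tau> + 48 * c ^ 3" unfolding \<kappa>1_def by (simp add: algebra_simps)
      finally have "exp (- \<tau> * \<kappa> + \<tau> * \<epsilon> k + D * \<tau>\<^sup>2 / L k + \<tau> ^ 3 * exp (\<eta> * \<tau>) * \<Lambda> k) \<le> exp (- \<kappa>2 * \<tau> + 48 * c ^ 3)"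
        by simp
      hence "p k \<le> 2 * exp (- \<kappa>2 * \<tau> + 48 * c ^ 3)" using elim(3)[rule_format, OF \<tau>(1)] by linarith
      also have "\<dots> = C * exp (- \<kappa>2 * \<tau>)" unfolding C_def exp_add by simp
      also have "\<dots> \<le> C * (exp (- (\<kappa>2 * T) * L k) + \<Lambda> k)"
      proof (intro mult_left_mono)
        show "exp (- \<kappa>2 * \<tau>) \<le> exp (- (\<kappa>2 * T) * L k) + \<Lambda> k"
        proof (cases "T * L k \<le> c * l")
          case True
          hence e: "- \<kappa>2 * \<tau> = - (\<kappa>2 * T) * L k" unfolding \<tau>_def by simp
          show ?thesis unfolding e using l(2) by simp
        next
          case False
          hence "\<kappa>2 * \<tau> = (\<kappa>2 * c) * l" unfolding \<tau>_def by simp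
          hence e: "- \<kappa>2 * \<tau> = - l" using c(2) by simp
          show ?thesis unfolding e using l(2) by simp
        qed
      qed (simp add: C_def)
      finally show ?case .
    qed
  qed
  have "summable (\<lambda>k. C * (exp (- (\<kappa>2 * T) * L k) + \<Lambda> k))"
    by (intro summable_mult summable_add sumL k2 \<Lambda>)
  moreover have "\<forall>\<^sub>F k in sequentially. norm (p k) \<le> C * (exp (- (\<kappa>2 * T) * L k) + \<Lambda> k)"
    using ev by eventually_elim (simp add: p)
  ultimately show ?thesis by (rule summable_comparison_test_ev[rotated])
qed

text \<open>The even exponent makes the square roots of the block ends comparable to
  \<open>\<rho> ^ k\<close>.\<close>

definition geo :: "real \<Rightarrow> nat \<Rightarrow> nat" where
  "geo \<rho> k = nat \<lceil>\<rho> ^ (2 * k)\<rceil>"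

lemma geo_ge: "1 < \<rho> \<Longrightarrow> \<rho> ^ (2 * k) \<le> real (geo \<rho> k)"
  unfolding geo_def by (simp add: real_nat_ceiling_ge)

lemma geo_ge_1: "1 < \<rho> \<Longrightarrow> 1 \<le> geo \<rho> k"
  using geo_ge[of \<rho> k] one_le_power[of \<rho> "2 * k"] by linarith

lemma geo_le: "1 < \<rho> \<Longrightarrow> real (geo \<rho> k) \<le> \<rho> ^ (2 * k) + 1"
proof -
  assume r: "1 < \<rho>"
  have "0 \<le> \<rho> ^ (2 * k)" using r by simp
  hence "0 \<le> \<lceil>\<rho> ^ (2 * k)\<rceil>" by linarith
  hence "real (geo \<rho> k) = of_int \<lceil>\<rho> ^ (2 * k)\<rceil>" unfolding geo_def by simp
  thus ?thesis by linarith
qed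

lemma geo_le_2: "1 < \<rho> \<Longrightarrow> real (geo \<rho> k) \<le> 2 * \<rho> ^ (2 * k)"
  using geo_le[of \<rho> k] one_le_power[of \<rho> "2 * k"] by linarith

lemma geo_mono: "1 < \<rho> \<Longrightarrow> j \<le> k \<Longrightarrow> geo \<rho> j \<le> geo \<rho> k"
  unfolding geo_def by (intro nat_mono ceiling_mono power_increasing) auto

lemma geo_at_top: assumes "1 < \<rho>" shows "filterlim (geo \<rho>) at_top sequentially"
proof -
  have "filterlim (\<lambda>k. (\<rho>\<^sup>2) ^ k) at_top sequentially"
    using assms by (intro filterlim_at_infinity_imp_filterlim_at_top filterlim_realpow_sequentially_gt1) auto
  hence "filterlim (\<lambda>k. real (geo \<rho> k)) at_top sequentially"
    by (rule filterlim_at_top_mono) (use geo_ge[OF assms] in \<open>auto simp: power_mult\<close>)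
  thus ?thesis by (simp add: filterlim_sequentially_iff_filterlim_real)
qed

text \<open>Rounding adds at most 1, eventually less than another \<open>\<rho>\<^sup>2 - 1\<close>
  times the block end; hence the factor 2.\<close>

lemma geo_ratio:
  assumes "1 < \<rho>"
  shows "\<forall>\<^sub>F k in sequentially. real (geo \<rho> (Suc k)) \<le> (1 + 2 * (\<rho>\<^sup>2 - 1)) * real (geo \<rho> k)"
proof -
  have r: "0 < \<rho>\<^sup>2 - 1" using assms by simp
  have "\<forall>\<^sub>F k in sequentially. nat \<lceil>1 / (\<rho>\<^sup>2 - 1)\<rceil> \<le> geo \<rho> k"
    using geo_at_top[OF assms] unfolding filterlim_at_top by blast
  thus ?thesis
  proof eventually_elim
    case (elim k)
    have "1 / (\<rho>\<^sup>2 - 1) \<le> real (geo \<rho> k)" using elim by linarith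
    hence "1 \<le> (\<rho>\<^sup>2 - 1) * real (geo \<rho> k)" using r by (simp add: field_simps)
    moreover have "real (geo \<rho> (Suc k)) \<le> \<rho>\<^sup>2 * \<rho> ^ (2 * k) + 1" using geo_le[OF assms, of "Suc k"] by (simp add: power2_eq_square)
    moreover have "\<rho>\<^sup>2 * \<rho> ^ (2 * k) \<le> \<rho>\<^sup>2 * real (geo \<rho> k)" using geo_ge[OF assms] by (intro mult_left_mono) auto
    ultimately show ?case by (simp add: algebra_simps)
  qed
qed

text \<open>The iterated logarithm of a block end is at least \<open>ln (c * k)\<close>, so the
  terms are at most a constant times \<open>k powr (- \<beta>)\<close>.\<close>

lemma geo_summable:
  assumes "1 < \<rho>" "1 < \<beta>"
  shows "summable (\<lambda>k. exp (- \<beta> * log_e (log_e (real (geo \<rho> k)))))"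
proof -
  define c where "c = 2 * ln \<rho>"
  have c: "0 < c" using assms unfolding c_def by simp
  have "summable (\<lambda>k. c powr (- \<beta>) * real k powr (- \<beta>))"
    using assms(2) by (intro summable_mult) (simp add: summable_real_powr_iff)
  moreover have "norm (exp (- \<beta> * log_e (log_e (real (geo \<rho> k))))) \<le> c powr (- \<beta>) * real k powr (- \<beta>)" if "1 \<le> k" for k
  proof -
    have k: "0 < c * real k" using c that by simp
    have "c * real k = ln (\<rho> ^ (2 * k))" using assms by (simp add: c_def ln_realpow)
    also have "\<dots> \<le> ln (max (real (geo \<rho> k)) (exp 1))" using geo_ge[OF assms(1), of k] assms by (intro ln_mono) auto
    finally have "ln (c * real k) \<le> ln (max (log_e (real (geo \<rho> k))) (exp 1))" using k unfolding log_e_def by (intro ln_mono) auto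
    hence "ln (c * real k) \<le> log_e (log_e (real (geo \<rho> k)))" unfolding log_e_def .
    hence "exp (- \<beta> * log_e (log_e (real (geo \<rho> k)))) \<le> exp (- \<beta> * ln (c * real k))" using assms by simp
    also have "\<dots> = c powr (- \<beta>) * real k powr (- \<beta>)" using k c that by (simp add: powr_def ln_mult algebra_simps flip: exp_add)
    finally show ?thesis by simp
  qed
  ultimately show ?thesis by (rule summable_comparison_test'[where N = 1])
qed

lemma lil_norm_sqrt_ratio:
  assumes "1 \<le> m" "m \<le> n" shows "lil_norm m * sqrt (real n) \<le> lil_norm n * sqrt (real m)"
proof -
  have "(lil_norm m * sqrt (real n))\<^sup>2 = 2 * real m * real n * log_e (log_e (real m))"
    by (simp add: power_mult_distrib lil_norm_sq)
  also have "\<dots> \<le> 2 * real m * real n * log_e (log_e (real n))" using assms by (intro mult_left_mono log_e_mono) auto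
  also have "\<dots> = (lil_norm n * sqrt (real m))\<^sup>2" by (simp add: power_mult_distrib lil_norm_sq)
  finally show ?thesis by (rule power2_le_imp_le) (intro mult_nonneg_nonneg lil_norm_nonneg, simp)
qed

text \<open>As \<open>lil_norm n / sqrt n\<close> is nondecreasing, the left side is at most
  \<open>geo \<rho> j\<close> times the square root of the ratio of the block ends, which decays
  geometrically in \<open>k - j\<close>.\<close>

lemma geo_cube_ratio:
  assumes r: "1 < \<rho>" and jk: "j \<le> k"
  shows "real (geo \<rho> k) * (lil_norm (geo \<rho> j) / lil_norm (geo \<rho> k)) ^ 3 \<le> 4 * \<rho> ^ (2 * j) * (1 / \<rho>) ^ (k - j)"
proof -
  let ?m = "geo \<rho> j" and ?n = "geo \<rho> k"
  have sqrt_even_power: "sqrt (\<rho> ^ (2 * i)) = \<rho> ^ i" for i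
    by (rule real_sqrt_unique) (use r in \<open>simp_all flip: power_mult add: mult.commute\<close>)
  have mn: "1 \<le> ?m" "?m \<le> ?n" "1 \<le> ?n" using geo_ge_1[OF r] geo_mono[OF r jk] by auto
  let ?q = "sqrt (real ?m) / sqrt (real ?n)"
  have a: "0 < lil_norm ?n" by (rule lil_norm_pos[OF mn(3)])
  have "lil_norm ?m / lil_norm ?n \<le> ?q" using lil_norm_sqrt_ratio[OF mn(1,2)] a mn by (simp add: field_simps)
  hence "(lil_norm ?m / lil_norm ?n) ^ 3 \<le> ?q ^ 3" using lil_norm_nonneg by (intro power_mono divide_nonneg_nonneg) auto
  hence "real ?n * (lil_norm ?m / lil_norm ?n) ^ 3 \<le> real ?n * ?q ^ 3" by (intro mult_left_mono) auto
  also have "\<dots> = real ?m * ?q"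
  proof -
    have "?q ^ 2 = real ?m / real ?n" by (simp add: power_divide)
    hence "?q ^ 3 = real ?m / real ?n * ?q" by (simp add: power3_eq_cube power2_eq_square)
    thus ?thesis using mn by simp
  qed
  also have "\<dots> \<le> (2 * \<rho> ^ (2 * j)) * (2 * (1 / \<rho>) ^ (k - j))"
  proof (intro mult_mono geo_le_2[OF r])
    have "sqrt (real ?m) \<le> sqrt (2 * \<rho> ^ (2 * j))" using geo_le_2[OF r] by simp
    also have "\<dots> = sqrt 2 * \<rho> ^ j" using r by (simp only: real_sqrt_mult sqrt_even_power)
    also have "\<dots> \<le> 2 * \<rho> ^ j" using r real_sqrt_le_mono[of 2 4] by (intro mult_right_mono) auto
    finally have 1: "sqrt (real ?m) \<le> 2 * \<rho> ^ j" .
    have "\<rho> ^ k = sqrt (\<rho> ^ (2 * k))" using r by (simp only: sqrt_even_power)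
    also have "\<dots> \<le> sqrt (real ?n)" using geo_ge[OF r] by simp
    finally have 2: "\<rho> ^ k \<le> sqrt (real ?n)" .
    have "?q \<le> 2 * \<rho> ^ j / \<rho> ^ k" using 1 2 r by (intro frac_le) auto
    also have "\<rho> ^ j / \<rho> ^ k = (1 / \<rho>) ^ (k - j)"
    proof -
      have "\<rho> ^ k = \<rho> ^ j * \<rho> ^ (k - j)" using jk by (simp flip: power_add)
      thus ?thesis using r by (simp add: power_one_over)
    qed
    hence "2 * \<rho> ^ j / \<rho> ^ k = 2 * (1 / \<rho>) ^ (k - j)" by simp
    finally show "?q \<le> 2 * (1 / \<rho>) ^ (k - j)" .
  qed (use r in auto)
  finally show ?thesis by simp
qed

context sublinear_expectation_space
begin

text \<open>The reverse integral test on the grid \<open>c * \<rho> ^ (2 * k)\<close>. The threshold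
  is halved in advance for later use with \<open>soft_ind\<close>.\<close>

lemma geo_tail_summable:
  assumes mom: "lil_moment_cond M H E Z" and Z: "Z \<in> H" and r: "1 < \<rho>" and \<eta>: "0 < \<eta>"
  shows "summable (\<lambda>k. \<rho> ^ (2 * k) * cap (tail Z (\<eta> * lil_norm (geo \<rho> k) / 2)))"
proof -
  define c where "c = min 1 (2 * (\<eta> / 2)\<^sup>2)"
  define b where "b = (\<lambda>k::nat. c / \<rho>\<^sup>2 * \<rho> ^ (2 * k))"
  have c: "0 < c" using \<eta> by (simp add: c_def)
  have r2: "1 < \<rho>\<^sup>2" using r by simp
  have bS: "b (Suc k) = c * \<rho> ^ (2 * k)" for k using r by (simp add: b_def power2_eq_square)
  have "incseq b" unfolding b_def using c r by (intro incseq_SucI mult_left_mono power_increasing) auto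
  hence "summable (\<lambda>k. (b (Suc k) - b k) * cap (weight_tail Z (b (Suc k))))"
    using mom c r by (intro choquet_summable) (auto simp: lil_weight_nonneg lil_moment_cond_iff b_def)
  moreover have "b (Suc k) - b k = c * (1 - 1 / \<rho>\<^sup>2) * \<rho> ^ (2 * k)" for k
    unfolding bS unfolding b_def by (simp add: algebra_simps)
  ultimately have "summable (\<lambda>k. (c * (1 - 1 / \<rho>\<^sup>2)) * (\<rho> ^ (2 * k) * cap (weight_tail Z (b (Suc k)))))"
    by (simp add: mult.assoc)
  moreover have "1 / \<rho>\<^sup>2 < 1" by (subst divide_less_eq_1_pos) (use r2 in linarith)+
  hence "c * (1 - 1 / \<rho>\<^sup>2) \<noteq> 0" using c by (metis less_irrefl mult_eq_0_iff right_minus_eq)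
  ultimately have s: "summable (\<lambda>k. \<rho> ^ (2 * k) * cap (weight_tail Z (b (Suc k))))"
    by (simp only: summable_cmult_iff) simp
  show ?thesis
  proof (rule summable_comparison_test'[OF s, where N = 0])
    fix k
    have "tail Z (\<eta> * lil_norm (geo \<rho> k) / 2) \<inter> space M \<subseteq> weight_tail Z (b (Suc k))"
    proof safe
      fix w assume "\<eta> * lil_norm (geo \<rho> k) / 2 \<le> \<bar>Z w\<bar>"
      hence "c * real (geo \<rho> k) \<le> lil_weight (Z w)"
        unfolding c_def using \<eta> by (intro lil_weight_ge geo_ge_1 r) auto
      moreover have "c * \<rho> ^ (2 * k) \<le> c * real (geo \<rho> k)" using geo_ge[OF r] c by (intro mult_left_mono) auto
      ultimately show "b (Suc k) \<le> lil_weight (Z w)" unfolding bS by linarith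
    qed
    hence "cap (tail Z (\<eta> * lil_norm (geo \<rho> k) / 2)) \<le> cap (weight_tail Z (b (Suc k)))" by (rule cap_mono)
    thus "norm (\<rho> ^ (2 * k) * cap (tail Z (\<eta> * lil_norm (geo \<rho> k) / 2)))
        \<le> \<rho> ^ (2 * k) * cap (weight_tail Z (b (Suc k)))"
      using r cap_nonneg by (simp add: mult_left_mono)
  qed
qed

text \<open>Raising the clipping level from \<open>B j\<close> to \<open>B (j + 1)\<close> adds at
  most \<open>B (j + 1) ^ 3\<close> on the event \<open>\<bar>Z\<bar> \<ge> B j / 2\<close>. After
  normalization the increments form a convolution of the summable \<open>f\<close> with a geometric
  sequence, and a Cauchy product of summable nonnegative sequences is summable.\<close>

lemma geo_third_moment_summable:
  assumes mom: "lil_moment_cond M H E Z" and Z: "Z \<in> H" and r: "1 < \<rho>" and \<eta>: "0 < \<eta>"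
  shows "summable (\<lambda>k. real (geo \<rho> k) * er (\<lambda>w. \<bar>clip (\<eta> * lil_norm (geo \<rho> k)) (Z w)\<bar> ^ 3) / lil_norm (geo \<rho> k) ^ 3)"
proof -
  define a where "a = (\<lambda>k. lil_norm (geo \<rho> k))"
  define B where "B = (\<lambda>k. \<eta> * a k)"
  define v where "v = (\<lambda>k. er (\<lambda>w. soft_ind (B k) (Z w)))"
  have a0: "0 < a k" for k unfolding a_def by (intro lil_norm_pos geo_ge_1 r)
  have B0: "0 < B k" for k unfolding B_def using a0 \<eta> by simp
  have Bm: "B k \<le> B (Suc k)" for k
    unfolding B_def a_def using \<eta> by (intro mult_left_mono lil_norm_mono geo_mono r) auto
  have sL: "(\<lambda>w. soft_ind (B k) (Z w)) \<in> L1" for k by (intro BL_L1 soft_ind_BL B0 Z)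
  have v0: "0 \<le> v k" for k unfolding v_def by (rule er_nonneg[OF sL]) (rule soft_ind_01)
  have vle: "v k \<le> cap (tail Z (B k / 2))" for k
    unfolding v_def
  proof (rule cap_lower_er[OF sL])
    show "w \<in> space M \<Longrightarrow> soft_ind (B k) (Z w) \<le> indicator (tail Z (B k / 2)) w" for w
      using soft_ind_01[of "B k" "Z w"] soft_ind_zero[of "B k" "Z w"] B0[of k] by (auto simp: indicator_def)
  qed
  have cL: "(\<lambda>w. \<bar>clip (B k) (Z w)\<bar> ^ 3) \<in> L1" for k
    using B0 by (intro BL_L1[OF clip_cube_BL] Z) (simp add: less_imp_le)
  have m3: "er (\<lambda>w. \<bar>clip (B k) (Z w)\<bar> ^ 3) \<le> B 0 ^ 3 + (\<Sum>j<k. B (Suc j) ^ 3 * v j)" for k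
  proof (induction k)
    case 0
    have "er (\<lambda>w. \<bar>clip (B 0) (Z w)\<bar> ^ 3) \<le> er (\<lambda>_. B 0 ^ 3)"
      using clip_bound B0[of 0] by (intro er_mono cL L1_const power_mono) (auto simp: less_imp_le)
    thus ?case by (simp add: er_const)
  next
    case (Suc k)
    have "er (\<lambda>w. \<bar>clip (B (Suc k)) (Z w)\<bar> ^ 3) \<le> er (\<lambda>w. \<bar>clip (B k) (Z w)\<bar> ^ 3 + B (Suc k) ^ 3 * soft_ind (B k) (Z w))"
    proof (rule er_mono[OF cL L1_add[OF cL L1_scale[OF sL]]])
      fix w
      show "\<bar>clip (B (Suc k)) (Z w)\<bar> ^ 3 \<le> \<bar>clip (B k) (Z w)\<bar> ^ 3 + B (Suc k) ^ 3 * soft_ind (B k) (Z w)"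
      proof (cases "B k \<le> \<bar>Z w\<bar>")
        case True
        have "\<bar>clip (B (Suc k)) (Z w)\<bar> ^ 3 \<le> B (Suc k) ^ 3" using clip_bound B0[of "Suc k"] by (intro power_mono) (auto simp: less_imp_le)
        thus ?thesis using soft_ind_one[OF B0 True] by (simp add: add_increasing)
      next
        case False
        hence "clip (B k) (Z w) = Z w" "clip (B (Suc k)) (Z w) = Z w" using Bm[of k] by (auto intro!: clip_id)
        thus ?thesis using B0[of "Suc k"] soft_ind_01 by simp
      qed
    qed
    also have "\<dots> \<le> er (\<lambda>w. \<bar>clip (B k) (Z w)\<bar> ^ 3) + er (\<lambda>w. B (Suc k) ^ 3 * soft_ind (B k) (Z w))"
      by (intro er_add cL L1_scale sL)
    also have "er (\<lambda>w. B (Suc k) ^ 3 * soft_ind (B k) (Z w)) = B (Suc k) ^ 3 * v k"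
      unfolding v_def using B0[of "Suc k"] by (intro er_scale sL) auto
    finally show ?case using Suc by simp
  qed
  define f where "f = (\<lambda>j. \<rho> ^ (2 * j) * v j)"
  define g where "g = (\<lambda>i::nat. (1 / \<rho>) ^ i)"
  have sg: "summable g" unfolding g_def using r by (intro summable_geometric) auto
  have sf: "summable f"
  proof (rule summable_comparison_test'[OF geo_tail_summable[OF mom Z r \<eta>], where N = 0])
    fix k show "norm (f k) \<le> \<rho> ^ (2 * k) * cap (tail Z (\<eta> * lil_norm (geo \<rho> k) / 2))"
      using vle[of k] v0[of k] r unfolding f_def B_def a_def by (simp add: mult_left_mono)
  qed
  have fg0: "0 \<le> f j" "0 \<le> g j" for j using v0 r unfolding f_def g_def by auto
  have sfg: "summable (\<lambda>k. \<Sum>i\<le>k. f i * g (k - i))"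
    using sf sg fg0 by (intro summable_Cauchy_product) auto
  have bound: "real (geo \<rho> k) * er (\<lambda>w. \<bar>clip (B k) (Z w)\<bar> ^ 3) / a k ^ 3
      \<le> \<eta> ^ 3 * (4 * g k + 4 * \<rho> ^ 3 * (\<Sum>i\<le>k. f i * g (k - i)))" for k
  proof -
    let ?n = "real (geo \<rho> k)"
    have ratio: "?n * (B j ^ 3 / a k ^ 3) \<le> \<eta> ^ 3 * (4 * \<rho> ^ (2 * j) * (1 / \<rho>) ^ (k - j))" if "j \<le> k" for j
    proof -
      have "?n * (B j ^ 3 / a k ^ 3) = \<eta> ^ 3 * (?n * (a j / a k) ^ 3)" by (simp add: B_def power_mult_distrib power_divide)
      also have "\<dots> \<le> \<eta> ^ 3 * (4 * \<rho> ^ (2 * j) * (1 / \<rho>) ^ (k - j))"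
        using geo_cube_ratio[OF r that] \<eta> unfolding a_def by (intro mult_left_mono) auto
      finally show ?thesis .
    qed
    have "?n * er (\<lambda>w. \<bar>clip (B k) (Z w)\<bar> ^ 3) / a k ^ 3 \<le> ?n * (B 0 ^ 3 + (\<Sum>j<k. B (Suc j) ^ 3 * v j)) / a k ^ 3"
      using m3[of k] a0[of k] by (intro divide_right_mono mult_left_mono) auto
    also have "\<dots> = ?n * (B 0 ^ 3 / a k ^ 3) + (\<Sum>j<k. ?n * (B (Suc j) ^ 3 / a k ^ 3) * v j)"
      by (simp add: distrib_left add_divide_distrib sum_distrib_left sum_divide_distrib mult_ac)
    also have "\<dots> \<le> \<eta> ^ 3 * (4 * g k) + (\<Sum>j<k. \<eta> ^ 3 * (4 * \<rho> ^ 3) * (f j * g (k - j)))"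
    proof (rule add_mono)
      show "?n * (B 0 ^ 3 / a k ^ 3) \<le> \<eta> ^ 3 * (4 * g k)" using ratio[of 0] by (simp add: g_def)
      show "(\<Sum>j<k. ?n * (B (Suc j) ^ 3 / a k ^ 3) * v j) \<le> (\<Sum>j<k. \<eta> ^ 3 * (4 * \<rho> ^ 3) * (f j * g (k - j)))"
      proof (rule sum_mono)
        fix j assume j: "j \<in> {..<k}"
        have "?n * (B (Suc j) ^ 3 / a k ^ 3) * v j \<le> \<eta> ^ 3 * (4 * \<rho> ^ (2 * Suc j) * (1 / \<rho>) ^ (k - Suc j)) * v j"
          using ratio[of "Suc j"] j v0[of j] by (intro mult_right_mono) auto
        \<comment> \<open>The index shift costs \<open>\<rho> ^ 3\<close>: a square from the block
          end and one factor from the geometric decay.\<close>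
        also have "(1 / \<rho>) ^ (k - Suc j) = \<rho> * (1 / \<rho>) ^ (k - j)"
        proof -
          have "k - j = Suc (k - Suc j)" using j by auto
          thus ?thesis using r by simp
        qed
        also have "\<eta> ^ 3 * (4 * \<rho> ^ (2 * Suc j) * (\<rho> * (1 / \<rho>) ^ (k - j))) * v j = \<eta> ^ 3 * (4 * \<rho> ^ 3) * (f j * g (k - j))"
          by (simp add: f_def g_def power3_eq_cube)
        finally show "?n * (B (Suc j) ^ 3 / a k ^ 3) * v j \<le> \<eta> ^ 3 * (4 * \<rho> ^ 3) * (f j * g (k - j))" .
      qed
    qed
    also have "(\<Sum>j<k. \<eta> ^ 3 * (4 * \<rho> ^ 3) * (f j * g (k - j))) \<le> (\<Sum>j\<le>k. \<eta> ^ 3 * (4 * \<rho> ^ 3) * (f j * g (k - j)))"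
      using fg0 r \<eta> by (intro sum_mono2) auto
    also have "\<dots> = \<eta> ^ 3 * (4 * \<rho> ^ 3 * (\<Sum>j\<le>k. f j * g (k - j)))" by (simp add: sum_distrib_left mult_ac)
    finally show ?thesis by (simp add: distrib_left)
  qed
  have "summable (\<lambda>k. \<eta> ^ 3 * (4 * g k + 4 * \<rho> ^ 3 * (\<Sum>i\<le>k. f i * g (k - i))))"
    by (intro summable_mult summable_add sg sfg)
  hence "summable (\<lambda>k. real (geo \<rho> k) * er (\<lambda>w. \<bar>clip (B k) (Z w)\<bar> ^ 3) / a k ^ 3)"
  proof (rule summable_comparison_test'[where N = 0])
    fix k
    have "0 \<le> er (\<lambda>w. \<bar>clip (B k) (Z w)\<bar> ^ 3)" by (rule er_nonneg[OF cL]) simp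
    thus "norm (real (geo \<rho> k) * er (\<lambda>w. \<bar>clip (B k) (Z w)\<bar> ^ 3) / a k ^ 3)
        \<le> \<eta> ^ 3 * (4 * g k + 4 * \<rho> ^ 3 * (\<Sum>i\<le>k. f i * g (k - i)))" using bound[of k] a0[of k] by simp
  qed
  thus ?thesis unfolding B_def a_def .
qed

end

section \<open>Upper bound in the law of the iterated logarithm\<close>

lemma identically_distributed_uminus:
  assumes "identically_distributed E X" shows "identically_distributed E (\<lambda>n w. - X n w)"
  unfolding identically_distributed_def
proof (intro allI impI ballI)
  fix i \<phi>
  assume i: "1 \<le> (i::nat)" and p: "\<phi> \<in> C_l_Lip 1"
    and fin: "\<bar>E (\<lambda>w. \<phi> [- X i w])\<bar> \<noteq> \<infinity>" "\<bar>E (\<lambda>w. \<phi> [- X 1 w])\<bar> \<noteq> \<infinity>"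
  have vn: "vec_norm (map uminus x) = vec_norm x" for x
    unfolding vec_norm_def L2_set_def by (intro arg_cong[of _ _ sqrt] sum.cong) auto
  have md: "map2 (-) (map uminus x) (map uminus y) = map uminus (map2 (-) x y)" for x y :: "real list"
    by (rule nth_equalityI) auto
  obtain C m where "C > 0" and C: "\<And>x y. length x = 1 \<Longrightarrow> length y = 1 \<Longrightarrow>
      \<bar>\<phi> x - \<phi> y\<bar> \<le> C * (1 + vec_norm x ^ m + vec_norm y ^ m) * vec_norm (map2 (-) x y)"
    using p unfolding C_l_Lip_def by blast
  have "\<bar>\<phi> (map uminus x) - \<phi> (map uminus y)\<bar> \<le> C * (1 + vec_norm x ^ m + vec_norm y ^ m) * vec_norm (map2 (-) x y)"
    if "length x = 1" "length y = 1" for x y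
    using C[of "map uminus x" "map uminus y"] that unfolding md vn by simp
  hence "(\<lambda>x. \<phi> (map uminus x)) \<in> C_l_Lip 1" unfolding C_l_Lip_def using \<open>C > 0\<close> by blast
  with assms i fin show "E (\<lambda>w. \<phi> [- X i w]) = E (\<lambda>w. \<phi> [- X 1 w])"
    unfolding identically_distributed_def by fastforce
qed

lemma partial_sum_lessThan: "partial_sum X n w = (\<Sum>i<n. X (i + 1) w)"
  unfolding partial_sum_def by (rule sum.reindex_bij_witness[of _ "\<lambda>j. j + 1" "\<lambda>j. j - 1"]) auto

context sublinear_expectation_space
begin

text \<open>Clipping increases a value only below \<open>- B\<close>, there by
  \<open>- B - z \<le> (z\<^sup>2 - B\<^sup>2) / B\<close>. The bias of a centred variable is thus a
  vanishing multiple of \<open>1 / B\<close>.\<close>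

lemma clip_mean_le:
  assumes Z: "Z \<in> L1" and L: "(\<lambda>w. max ((Z w)\<^sup>2 - B\<^sup>2) 0) \<in> L1" and B: "0 < B"
  shows "er (\<lambda>w. clip B (Z w)) \<le> er Z + er (\<lambda>w. max ((Z w)\<^sup>2 - B\<^sup>2) 0) / B"
proof -
  have "er (\<lambda>w. clip B (Z w)) \<le> er (\<lambda>w. Z w + (1 / B) * max ((Z w)\<^sup>2 - B\<^sup>2) 0)"
  proof (rule er_mono)
    show "(\<lambda>w. clip B (Z w)) \<in> L1" using B Z by (intro BL_L1[OF clip_BL]) (auto simp: L1_H)
    show "(\<lambda>w. Z w + (1 / B) * max ((Z w)\<^sup>2 - B\<^sup>2) 0) \<in> L1" by (intro L1_add L1_scale Z L)
    fix w
    have "clip B z \<le> z + (1 / B) * max (z\<^sup>2 - B\<^sup>2) 0" for z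
    proof (cases "z < - B")
      case True
      have "B * (- B - z) \<le> (- B - z) * (B - z)" using True B by (simp add: mult.commute mult_left_mono)
      also have "\<dots> = z\<^sup>2 - B\<^sup>2" by (simp add: power2_eq_square algebra_simps)
      finally have "- B - z \<le> (1 / B) * (z\<^sup>2 - B\<^sup>2)" using B by (simp add: field_simps)
      also have "\<dots> \<le> (1 / B) * max (z\<^sup>2 - B\<^sup>2) 0" using B by (intro mult_left_mono) auto
      finally show ?thesis using True B by (simp add: clip_def)
    next
      case False
      hence "clip B z \<le> z" by (simp add: clip_def)
      moreover have "0 \<le> (1 / B) * max (z\<^sup>2 - B\<^sup>2) 0" using B by simp
      ultimately show ?thesis by linarith
    qed
    thus "clip B (Z w) \<le> Z w + (1 / B) * max ((Z w)\<^sup>2 - B\<^sup>2) 0" .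
  qed
  also have "\<dots> \<le> er Z + er (\<lambda>w. (1 / B) * max ((Z w)\<^sup>2 - B\<^sup>2) 0)" by (intro er_add Z L1_scale L)
  also have "er (\<lambda>w. (1 / B) * max ((Z w)\<^sup>2 - B\<^sup>2) 0) = (1 / B) * er (\<lambda>w. max ((Z w)\<^sup>2 - B\<^sup>2) 0)"
    using B by (intro er_scale L) simp
  finally show ?thesis by simp
qed

text \<open>Going backwards from the block end \<open>N\<close> gives sums that end at a fixed
  index, the form controlled by \<open>bmax\<close>.\<close>

lemma partial_sum_le_if_good:
  assumes good: "\<And>i. 1 \<le> i \<Longrightarrow> i \<le> N \<Longrightarrow> \<bar>X i w\<bar> < B"
    and A: "(\<Sum>i<N. clip B (X (i + 1) w)) < u" and Q: "bmax B m (\<lambda>i. - X (i + 1) w) N < v"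
    and n: "m \<le> n" "n \<le> N" and B: "0 < B"
  shows "partial_sum X n w \<le> u + v"
proof -
  have c: "clip B (X (i + 1) w) = X (i + 1) w" if "i < N" for i
    using good[of "i + 1"] that by (intro clip_id) auto
  have "partial_sum X n w = (\<Sum>i<n. clip B (X (i + 1) w))"
    unfolding partial_sum_lessThan using n c by (intro sum.cong) auto
  also have "\<dots> = (\<Sum>i<N. clip B (X (i + 1) w)) + (\<Sum>i=n..<N. clip B (- X (i + 1) w))"
  proof -
    have "{..<N} = {..<n} \<union> {n..<N}" using n by auto
    hence "(\<Sum>i<N. clip B (X (i + 1) w)) = (\<Sum>i<n. clip B (X (i + 1) w)) + (\<Sum>i=n..<N. clip B (X (i + 1) w))"
      by (simp add: sum.union_disjoint ivl_disj_int)
    thus ?thesis using B by (simp add: clip_uminus sum_negf)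
  qed
  also have "\<dots> \<le> u + v"
    using A Q bmax_ge_sum[of m n N B "\<lambda>i. - X (i + 1) w"] n by linarith
  finally show ?thesis .
qed

text \<open>Outside the exceptional sets the sum is at most \<open>s + 3 * e\<close> times the
  norming constant of the block end; the fourth \<open>e\<close> pays for replacing the block end by
  \<open>n\<close>.\<close>

lemma lil_upper:
  assumes X: "\<And>n. n \<ge> 1 \<Longrightarrow> X n \<in> H" and id: "identically_distributed E X"
    and neg_dep: "neg_dep X" "neg_dep (\<lambda>n w. - X n w)"
    and mean: "E (X 1) = 0" "E (\<lambda>w. - X 1 w) = 0"
    and lim: "((\<lambda>c::real. E (\<lambda>w. max ((X 1 w)\<^sup>2 - c) 0)) \<longlongrightarrow> 0) at_top"
    and mom: "lil_moment_cond M H E (X 1)"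
    and s: "0 \<le> s" "er (\<lambda>w. (X 1 w)\<^sup>2) \<le> s\<^sup>2" and e: "0 < e"
  shows "Vs {w\<in>space M. \<not> (\<forall>\<^sub>F n in sequentially. partial_sum X n w \<le> (s + 4 * e) * lil_norm n)} = 0"
proof -
  define Z where "Z = X 1"
  define Y where "Y = (\<lambda>n w. - X n w)"
  have ZH: "Z \<in> H" using X by (simp add: Z_def)
  have YH: "Y n \<in> H" if "n \<ge> 1" for n unfolding Y_def by (intro H_uminus X that)
  have idY: "identically_distributed E Y" unfolding Y_def by (rule identically_distributed_uminus[OF id])
  have lim': "((\<lambda>c::real. E (\<lambda>w. max (\<bar>(Z w)\<^sup>2\<bar> - c) 0)) \<longlongrightarrow> 0) at_top" using lim by (simp add: Z_def)
  note sq = tail_L1[OF H_square[OF ZH] lim', simplified]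
  have ZL: "Z \<in> L1"
  proof (rule L1_mono[OF L1_add[OF sq(1) L1_const[of 1]] ZH])
    fix w
    have "0 \<le> (\<bar>Z w\<bar> - 1)\<^sup>2" by simp
    hence "2 * \<bar>Z w\<bar> \<le> (Z w)\<^sup>2 + 1" unfolding power2_diff power2_abs by simp
    hence "\<bar>Z w\<bar> \<le> (Z w)\<^sup>2 + 1" by linarith
    thus "\<bar>Z w\<bar> \<le> \<bar>(Z w)\<^sup>2 + 1\<bar>" by linarith
  qed
  have er0: "er Z = 0" "er (\<lambda>w. - Z w) = 0" using mean unfolding er_def Z_def by auto
  \<comment> \<open>Positive even for \<open>s = 0\<close>, so that division by
    \<open>\<sigma>\<close> is possible.\<close>
  define \<sigma> where "\<sigma> = s + e"
  define \<kappa> where "\<kappa> = \<sigma> + e"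
  \<comment> \<open>The first bound makes the variance inside a block at most
    \<open>e\<^sup>2 / 8\<close> in the exponent; the second gives
    \<open>(s + 3 * e) * (1 + \<zeta>) \<le> s + 4 * e\<close>.\<close>
  define \<zeta> where "\<zeta> = min (e\<^sup>2 / (4 * \<sigma>\<^sup>2)) (e / (s + 3 * e))"
  \<comment> \<open>Chosen so that the bound in \<open>geo_ratio\<close> is exactly
    \<open>1 + \<zeta>\<close>.\<close>
  define \<rho> where "\<rho> = sqrt (1 + \<zeta> / 2)"
  define \<eta> where "\<eta> = e / 8"
  have \<sigma>: "0 < \<sigma>" unfolding \<sigma>_def using s e by simp
  have \<zeta>: "0 < \<zeta>" "\<zeta> * \<sigma>\<^sup>2 / 2 \<le> e\<^sup>2 / 8" "(s + 3 * e) * (1 + \<zeta>) \<le> s + 4 * e"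
  proof -
    show "0 < \<zeta>" unfolding \<zeta>_def using \<sigma> e s by (simp add: divide_pos_pos)
    have "\<zeta> * (4 * \<sigma>\<^sup>2) \<le> e\<^sup>2 / (4 * \<sigma>\<^sup>2) * (4 * \<sigma>\<^sup>2)" unfolding \<zeta>_def by (intro mult_right_mono) auto
    thus "\<zeta> * \<sigma>\<^sup>2 / 2 \<le> e\<^sup>2 / 8" using \<sigma> by simp
    have "\<zeta> * (s + 3 * e) \<le> e / (s + 3 * e) * (s + 3 * e)" unfolding \<zeta>_def using s e by (intro mult_right_mono) auto
    hence "\<zeta> * (s + 3 * e) \<le> e" using s e by simp
    thus "(s + 3 * e) * (1 + \<zeta>) \<le> s + 4 * e" by (simp add: algebra_simps)
  qed
  have \<rho>: "1 < \<rho>" "2 * (\<rho>\<^sup>2 - 1) = \<zeta>" unfolding \<rho>_def using \<zeta>(1) by auto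
  have \<eta>: "0 < \<eta>" unfolding \<eta>_def using e by simp
  define N where "N = geo \<rho>"
  define a where "a = (\<lambda>k. lil_norm (N k))"
  define L where "L = (\<lambda>k. log_e (log_e (real (N k))))"
  define B where "B = (\<lambda>k. \<eta> * a k)"
  define T2 where "T2 = (\<lambda>k. er (\<lambda>w. max ((Z w)\<^sup>2 - (B k)\<^sup>2) 0))"
  define m3 where "m3 = (\<lambda>k. er (\<lambda>w. \<bar>clip (B k) (Z w)\<bar> ^ 3))"
  \<comment> \<open>The geometric summand keeps \<open>\<Lambda> k\<close> positive, since its
    logarithm is taken.\<close>
  define \<Lambda> where "\<Lambda> = (\<lambda>k. real (N k) * m3 k / a k ^ 3 + (1/2) ^ k)"
  \<comment> \<open>The factor 3 is due to the maximal inequality, where the bias occurs twice in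
    \<open>2 * \<delta>\<close> and once in \<open>t * \<mu>\<close>.\<close>
  define \<epsilon> where "\<epsilon> = (\<lambda>k. 3 * T2 k / (2 * \<eta>))"
  have N1: "1 \<le> N k" for k unfolding N_def by (rule geo_ge_1[OF \<rho>(1)])
  have L1': "1 \<le> L k" for k unfolding L_def by (rule log_e_ge_1)
  have a0: "0 < a k" for k unfolding a_def by (rule lil_norm_pos[OF N1])
  have a2: "(a k)\<^sup>2 = 2 * real (N k) * L k" for k unfolding a_def L_def by (rule lil_norm_sq)
  have B0: "0 < B k" for k unfolding B_def using \<eta> a0 by simp
  have T2L: "(\<lambda>w. max ((Z w)\<^sup>2 - c) 0) \<in> L1" for c using sq(3)[of c] by simp
  have T20: "0 \<le> T2 k" for k unfolding T2_def by (rule er_nonneg[OF T2L]) simp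
  have m3L: "(\<lambda>w. \<bar>clip (B k) (Z w)\<bar> ^ 3) \<in> L1" for k
    using B0[of k] by (intro BL_L1[OF clip_cube_BL] ZH) simp
  have m30: "0 \<le> m3 k" for k unfolding m3_def by (rule er_nonneg[OF m3L]) simp
  have \<Lambda>0: "0 < \<Lambda> k" for k unfolding \<Lambda>_def using m30[of k] a0[of k] by (intro add_nonneg_pos) auto
  have \<Lambda>s: "summable \<Lambda>"
  proof -
    have "summable (\<lambda>k. real (N k) * m3 k / a k ^ 3)"
      unfolding N_def m3_def a_def B_def
      by (rule geo_third_moment_summable[OF _ ZH \<rho>(1) \<eta>]) (use mom in \<open>simp add: Z_def\<close>)
    thus ?thesis unfolding \<Lambda>_def by (intro summable_add summable_geometric) auto
  qed
  have \<epsilon>0: "\<epsilon> \<longlonglongrightarrow> 0"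
  proof -
    have "filterlim (\<lambda>k. \<eta>\<^sup>2 * real (N k)) at_top sequentially"
      using \<eta> geo_at_top[OF \<rho>(1)] unfolding N_def
      by (intro filterlim_tendsto_pos_mult_at_top[OF tendsto_const] filterlim_compose[OF filterlim_real_sequentially]) auto
    hence B_top: "filterlim (\<lambda>k. (B k)\<^sup>2) at_top sequentially"
    proof (rule filterlim_at_top_mono)
      have "\<eta>\<^sup>2 * real (N k) \<le> (B k)\<^sup>2" for k
      proof -
        have "real (N k) * 1 \<le> (2 * real (N k)) * L k" using L1'[of k] by (intro mult_mono) auto
        thus ?thesis unfolding B_def power_mult_distrib a2 by (intro mult_left_mono) auto
      qed
      thus "\<forall>\<^sub>F k in sequentially. \<eta>\<^sup>2 * real (N k) \<le> (B k)\<^sup>2" by simp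
    qed
    have "T2 \<longlonglongrightarrow> 0"
    proof (rule order_tendstoI)
      fix c :: real assume "c < 0"
      thus "\<forall>\<^sub>F k in sequentially. c < T2 k" using T20 by (intro always_eventually allI) (rule less_le_trans)
    next
      fix c :: real assume "0 < c"
      hence "\<forall>\<^sub>F x in at_top. er (\<lambda>w. max ((Z w)\<^sup>2 - x) 0) < c" using sq(2) by simp
      thus "\<forall>\<^sub>F k in sequentially. T2 k < c" using B_top unfolding filterlim_iff T2_def by blast
    qed
    hence "(\<lambda>k. (3 / (2 * \<eta>)) * T2 k) \<longlonglongrightarrow> (3 / (2 * \<eta>)) * 0" by (intro tendsto_mult_left)
    thus ?thesis unfolding \<epsilon>_def by simp
  qed
  define \<delta> where "\<delta> = (\<lambda>k t. t * (T2 k / B k) + t\<^sup>2 * \<sigma>\<^sup>2 / 2 + t ^ 3 * exp (t * B k) * m3 k / 6)"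
  have erc: "er (\<lambda>w. clip (B k) (Z w)) \<le> T2 k / B k" for k
    using clip_mean_le[OF ZL T2L B0[of k]] er0 unfolding T2_def by simp
  have erc': "er (\<lambda>w. clip (B k) (- Z w)) \<le> T2 k / B k" for k
    using clip_mean_le[OF L1_uminus[OF ZL] _ B0[of k]] T2L er0 unfolding T2_def by simp
  have ers: "er (\<lambda>w. (clip (B k) (Z w))\<^sup>2) \<le> \<sigma>\<^sup>2" for k
  proof -
    have "er (\<lambda>w. (clip (B k) (Z w))\<^sup>2) \<le> er (\<lambda>w. (Z w)\<^sup>2)"
    proof (rule er_mono[OF _ sq(1)])
      show "(\<lambda>w. (clip (B k) (Z w))\<^sup>2) \<in> L1" using B0[of k] by (intro BL_L1[OF clip_sq_BL] ZH) simp
      show "(clip (B k) (Z w))\<^sup>2 \<le> (Z w)\<^sup>2" for w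
        using clip_abs_le[of "B k" "Z w"] B0[of k] by (simp add: abs_le_square_iff)
    qed
    also have "\<dots> \<le> s\<^sup>2" using s(2) unfolding Z_def .
    also have "\<dots> \<le> \<sigma>\<^sup>2" unfolding \<sigma>_def using s e by (intro power_mono) auto
    finally show ?thesis .
  qed
  have cu: "clip (B k) (- x) = - clip (B k) x" for k x using B0[of k] by (simp add: clip_uminus)
  have expX: "er (\<lambda>w. exp (t * clip (B k) (Z w))) \<le> 1 + \<delta> k t" if "0 \<le> t" for k t
    unfolding \<delta>_def using B0[of k] that by (intro er_exp_clip[OF ZH] erc ers) (auto simp: m3_def)
  have expY: "er (\<lambda>w. exp (t * clip (B k) (- Z w))) \<le> 1 + \<delta> k t" if "0 \<le> t" for k t
    unfolding \<delta>_def using B0[of k] that ers[of k]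
    by (intro er_exp_clip[OF H_uminus[OF ZH]] erc') (auto simp: cu m3_def)
  have term1: "real (N k) * (\<tau> / a k * (T2 k / B k)) \<le> \<tau> * \<epsilon> k / 3" if "0 \<le> \<tau>" for k \<tau>
  proof -
    have "real (N k) * (\<tau> / a k * (T2 k / B k)) = \<tau> * T2 k / \<eta> * (real (N k) / (a k)\<^sup>2)"
      unfolding B_def by (simp add: power2_eq_square field_simps)
    also have "\<dots> \<le> \<tau> * T2 k / \<eta> * (1 / 2)"
    proof (rule mult_left_mono)
      show "real (N k) / (a k)\<^sup>2 \<le> 1 / 2" unfolding a2 using N1[of k] L1'[of k] by (simp add: field_simps)
    qed (use that T20[of k] \<eta> in simp)
    also have "\<dots> = \<tau> * \<epsilon> k / 3" unfolding \<epsilon>_def by simp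
    finally show ?thesis .
  qed
  have term2: "real (N k) * ((\<tau> / a k)\<^sup>2 * \<sigma>\<^sup>2 / 2) = \<sigma>\<^sup>2 / 4 * \<tau>\<^sup>2 / L k" for k \<tau>
    unfolding power_divide a2 using N1[of k] L1'[of k] by (simp add: field_simps)
  have term3: "real (N k) * ((\<tau> / a k) ^ 3 * exp (\<tau> / a k * B k) * m3 k / 6) \<le> \<tau> ^ 3 * exp (\<eta> * \<tau>) * \<Lambda> k / 6"
    if "0 \<le> \<tau>" for k \<tau>
  proof -
    have "\<tau> / a k * B k = \<eta> * \<tau>" unfolding B_def using a0[of k] by simp
    hence "real (N k) * ((\<tau> / a k) ^ 3 * exp (\<tau> / a k * B k) * m3 k / 6)
        = \<tau> ^ 3 * exp (\<eta> * \<tau>) * (real (N k) * m3 k / a k ^ 3) / 6" by (simp add: power_divide)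
    also have "\<dots> \<le> \<tau> ^ 3 * exp (\<eta> * \<tau>) * \<Lambda> k / 6"
      unfolding \<Lambda>_def using that by (intro divide_right_mono mult_left_mono) auto
    finally show ?thesis .
  qed
  have nonneg3: "0 \<le> \<tau> ^ 3 * exp (\<eta> * \<tau>) * \<Lambda> k" if "0 \<le> \<tau>" for k \<tau>
    using that \<Lambda>0[of k] by simp
  have \<epsilon>nn: "0 \<le> \<epsilon> k" for k unfolding \<epsilon>_def using T20 \<eta> by simp
  \<comment> \<open>Exceptional events of a block: the clipped sum at its end is large, some
    backward sum inside is large, or some clipping is active.\<close>
  define A where "A = (\<lambda>k. {w\<in>space M. \<kappa> * a k \<le> (\<Sum>i<N k. clip (B k) (X (i + 1) w))})"
  define Q where "Q = (\<lambda>k. {w\<in>space M. e * a k \<le> bmax (B k) (N (k - 1)) (\<lambda>i. Y (i + 1) w) (N k)})"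
  define J where "J = (\<lambda>k. \<Union>i\<in>{1..N k}. tail (X i) (B k))"
  let ?R = "\<lambda>\<kappa> D k \<tau>. 2 * exp (- \<tau> * \<kappa> + \<tau> * \<epsilon> k + D * \<tau>\<^sup>2 / L k + \<tau> ^ 3 * exp (\<eta> * \<tau>) * \<Lambda> k)"
  have sumA: "summable (\<lambda>k. cap (A k))"
  \<comment> \<open>For \<open>\<kappa> = \<sigma>\<close> the choice
    \<open>T = 2 / \<sigma>\<close> is optimal and gives exactly 1; the additional \<open>e\<close>
    in \<open>\<kappa>\<close> makes the product exceed 1.\<close>
  proof (rule summable_exponential_bounds[where L = L and \<Lambda> = \<Lambda> and \<epsilon> = \<epsilon> and \<kappa> = \<kappa> and D = "\<sigma>\<^sup>2 / 4" and T = "2 / \<sigma>" and \<eta> = \<eta>])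
    show "\<forall>\<^sub>F k in sequentially. \<forall>\<tau>\<ge>0. cap (A k) \<le>
        ?R \<kappa> (\<sigma>\<^sup>2 / 4) k \<tau>"
    proof (intro always_eventually allI impI)
      fix k \<tau> assume \<tau>: "0 \<le> (\<tau>::real)"
      let ?t = "\<tau> / a k"
      have t: "0 \<le> ?t" using \<tau> a0[of k] by simp
      have "cap (A k) \<le> exp (- ?t * (\<kappa> * a k) + real (N k) * \<delta> k ?t)"
        unfolding A_def using B0[of k] t expX[OF t, of k] by (intro exp_ineq_sum[OF X id neg_dep(1)]) (auto simp: Z_def)
      also have "- ?t * (\<kappa> * a k) = - \<tau> * \<kappa>" using a0[of k] by simp
      also have "exp (- \<tau> * \<kappa> + real (N k) * \<delta> k ?t) \<le>
          exp (- \<tau> * \<kappa> + \<tau> * \<epsilon> k + \<sigma>\<^sup>2 / 4 * \<tau>\<^sup>2 / L k + \<tau> ^ 3 * exp (\<eta> * \<tau>) * \<Lambda> k)"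
      proof -
        have "real (N k) * \<delta> k ?t \<le> \<tau> * \<epsilon> k / 3 + \<sigma>\<^sup>2 / 4 * \<tau>\<^sup>2 / L k + \<tau> ^ 3 * exp (\<eta> * \<tau>) * \<Lambda> k / 6"
          unfolding \<delta>_def distrib_left using term1[OF \<tau>, of k] term2[of k \<tau>] term3[OF \<tau>, of k] by linarith
        moreover have "0 \<le> \<tau> * \<epsilon> k" using \<tau> \<epsilon>nn by simp
        ultimately show ?thesis using nonneg3[OF \<tau>, of k] by simp
      qed
      also have "\<dots> \<le> 2 * \<dots>" by simp
      finally show "cap (A k) \<le> ?R \<kappa> (\<sigma>\<^sup>2 / 4) k \<tau>" .
    qed
    have "\<sigma>\<^sup>2 / 4 * (2 / \<sigma>) = \<sigma> / 2" using \<sigma> by (simp add: power2_eq_square)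
    hence kd: "\<kappa> - \<sigma>\<^sup>2 / 4 * (2 / \<sigma>) = \<sigma> / 2 + e" unfolding \<kappa>_def by simp
    show "1 < (\<kappa> - \<sigma>\<^sup>2 / 4 * (2 / \<sigma>)) * (2 / \<sigma>)" unfolding kd using \<sigma> e by (simp add: field_simps)
    show "\<eta> \<le> (\<kappa> - \<sigma>\<^sup>2 / 4 * (2 / \<sigma>)) / 4" unfolding kd \<eta>_def using \<sigma> e by simp
    show "summable (\<lambda>k. exp (- \<beta> * L k))" if "1 < \<beta>" for \<beta> unfolding L_def N_def by (rule geo_summable[OF \<rho>(1) that])
  qed (use cap_nonneg \<epsilon>0 L1' \<Lambda>0 \<Lambda>s \<sigma> \<eta> in auto)
  have ratio: "\<forall>\<^sub>F k in sequentially. real (N k) \<le> (1 + \<zeta>) * real (N (k - 1))"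
  proof -
    have "\<forall>\<^sub>F k in sequentially. real (N (Suc k)) \<le> (1 + \<zeta>) * real (N (Suc k - 1))"
      using geo_ratio[OF \<rho>(1)] unfolding \<rho>(2) N_def by simp
    thus ?thesis by (rule eventually_sequentially_Suc[THEN iffD1])
  qed
  have Nm: "j \<le> k \<Longrightarrow> N j \<le> N k" for j k unfolding N_def by (rule geo_mono[OF \<rho>(1)])
  have sumQ: "summable (\<lambda>k. cap (Q k))"
  \<comment> \<open>\<open>T = 4 / e\<close> is the optimum for this \<open>D\<close> and yields 2;
    the bound on \<open>\<eta>\<close> becomes an equality, which explains
    \<open>\<eta> = e / 8\<close>.\<close>
  proof (rule summable_exponential_bounds[where L = L and \<Lambda> = \<Lambda> and \<epsilon> = \<epsilon> and \<kappa> = e and D = "e\<^sup>2 / 8" and T = "4 / e" and \<eta> = \<eta>])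
    show "\<forall>\<^sub>F k in sequentially. \<forall>\<tau>\<ge>0. cap (Q k) \<le>
        ?R e (e\<^sup>2 / 8) k \<tau>"
      using ratio
    proof (eventually_elim, intro allI impI)
      fix k \<tau> assume r: "real (N k) \<le> (1 + \<zeta>) * real (N (k - 1))" and \<tau>: "0 \<le> (\<tau>::real)"
      let ?t = "\<tau> / a k" and ?n = "real (N k - N (k - 1))"
      have t: "0 \<le> ?t" using \<tau> a0[of k] by simp
      have mn: "N (k - 1) \<le> N k" by (rule Nm) simp
      have tb: "0 \<le> ?t * (T2 k / B k)" using T20[of k] B0[of k] by (intro mult_nonneg_nonneg t) simp
      have tm: "0 \<le> ?t ^ 3 * exp (?t * B k) * m3 k / 6" using m30[of k] zero_le_power[OF t, of 3] by simp
      have d0: "0 \<le> \<delta> k ?t" unfolding \<delta>_def using tb tm by (intro add_nonneg_nonneg) simp_all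
      have "cap (Q k) \<le> 2 * exp (- ?t * (e * a k) + ?n * (2 * \<delta> k ?t + ?t * (T2 k / B k)))"
        unfolding Q_def
      proof (rule exp_ineq_max[OF YH idY])
        show "neg_dep Y" unfolding Y_def by (rule neg_dep(2))
        show "er (\<lambda>w. exp (?t * clip (B k) (Y 1 w))) \<le> 1 + \<delta> k ?t" using expY[OF t, of k] by (simp add: Y_def Z_def)
        show "er (\<lambda>w. - clip (B k) (Y 1 w)) \<le> T2 k / B k" using erc[of k] by (simp add: Y_def Z_def cu)
      qed (use B0[of k] t d0 T20[of k] mn in auto)
      also have "- ?t * (e * a k) = - \<tau> * e" using a0[of k] by simp
      also have "2 * exp (- \<tau> * e + ?n * (2 * \<delta> k ?t + ?t * (T2 k / B k)))
          \<le> ?R e (e\<^sup>2 / 8) k \<tau>"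
      proof -
        let ?u1 = "?t * (T2 k / B k)" and ?u2 = "?t\<^sup>2 * \<sigma>\<^sup>2 / 2" and ?u3 = "?t ^ 3 * exp (?t * B k) * m3 k / 6"
        have u: "0 \<le> ?u1" "0 \<le> ?u2" "0 \<le> ?u3" using tb tm by simp_all
        have nN: "?n \<le> real (N k)" by simp
        have "\<zeta> * real (N (k - 1)) \<le> \<zeta> * real (N k)" using \<zeta>(1) mn by (intro mult_left_mono) auto
        hence n\<zeta>: "?n \<le> \<zeta> * real (N k)" using r mn by (simp add: of_nat_diff algebra_simps)
        \<comment> \<open>Only the quadratic part needs the shortness of the block,
          \<open>?n \<le> \<zeta> * N k\<close>; for the other parts \<open>?n \<le> N k\<close> is
          enough.\<close>
        have "?n * (2 * \<delta> k ?t + ?u1) = 3 * (?n * ?u1) + 2 * (?n * ?u2) + 2 * (?n * ?u3)"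
          unfolding \<delta>_def by (simp add: algebra_simps)
        also have "\<dots> \<le> 3 * (real (N k) * ?u1) + 2 * (\<zeta> * real (N k) * ?u2) + 2 * (real (N k) * ?u3)"
          using mult_right_mono[OF nN u(1)] mult_right_mono[OF n\<zeta> u(2)] mult_right_mono[OF nN u(3)] by linarith
        also have "\<dots> \<le> \<tau> * \<epsilon> k + \<zeta> * \<sigma>\<^sup>2 / 2 * (\<tau>\<^sup>2 / L k) + \<tau> ^ 3 * exp (\<eta> * \<tau>) * \<Lambda> k / 3"
        proof -
          have "2 * (\<zeta> * real (N k) * ?u2) = 2 * \<zeta> * (real (N k) * ?u2)" by simp
          also have "\<dots> = \<zeta> * \<sigma>\<^sup>2 / 2 * (\<tau>\<^sup>2 / L k)" unfolding term2 by simp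
          finally show ?thesis using term1[OF \<tau>, of k] term3[OF \<tau>, of k] by linarith
        qed
        also have "\<zeta> * \<sigma>\<^sup>2 / 2 * (\<tau>\<^sup>2 / L k) \<le> e\<^sup>2 / 8 * (\<tau>\<^sup>2 / L k)"
          using \<zeta>(2) L1'[of k] by (intro mult_right_mono) auto
        finally have "?n * (2 * \<delta> k ?t + ?u1) \<le> \<tau> * \<epsilon> k + e\<^sup>2 / 8 * \<tau>\<^sup>2 / L k + \<tau> ^ 3 * exp (\<eta> * \<tau>) * \<Lambda> k"
          using nonneg3[OF \<tau>, of k] by simp
        thus ?thesis by simp
      qed
      finally show "cap (Q k) \<le> ?R e (e\<^sup>2 / 8) k \<tau>" .
    qed
    have kd: "e - e\<^sup>2 / 8 * (4 / e) = e / 2" using e by (simp add: power2_eq_square field_simps)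
    show "1 < (e - e\<^sup>2 / 8 * (4 / e)) * (4 / e)" unfolding kd using e by simp
    show "\<eta> \<le> (e - e\<^sup>2 / 8 * (4 / e)) / 4" unfolding kd \<eta>_def using e by simp
    show "summable (\<lambda>k. exp (- \<beta> * L k))" if "1 < \<beta>" for \<beta> unfolding L_def N_def by (rule geo_summable[OF \<rho>(1) that])
  qed (use cap_nonneg \<epsilon>0 L1' \<Lambda>0 \<Lambda>s e \<eta> in auto)
  have sumJ: "summable (\<lambda>k. cap (J k))"
  proof -
    have mom': "lil_moment_cond M H E Z" using mom by (simp add: Z_def)
    have "summable (\<lambda>k. 2 * (\<rho> ^ (2 * k) * cap (tail Z (\<eta> * lil_norm (geo \<rho> k) / 2))))"
      by (intro summable_mult geo_tail_summable[OF mom' ZH \<rho>(1) \<eta>])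
    thus ?thesis
    proof (rule summable_comparison_test'[where N = 0])
      fix k
      let ?p = "cap (tail Z (\<eta> * lil_norm (geo \<rho> k) / 2))"
      have "cap (J k) \<le> (\<Sum>i=1..N k. cap (tail (X i) (B k)))" unfolding J_def by (intro cap_UN) simp
      also have "\<dots> \<le> (\<Sum>i=1..N k. ?p)"
      proof (rule sum_mono)
        fix i assume "i \<in> {1..N k}"
        thus "cap (tail (X i) (B k)) \<le> ?p"
          using tail_ident[OF id X _ B0[of k], of i] unfolding B_def a_def N_def Z_def by (auto intro: order_trans)
      qed
      also have "\<dots> = real (N k) * ?p" by simp
      also have "\<dots> \<le> (2 * \<rho> ^ (2 * k)) * ?p" unfolding N_def by (intro mult_right_mono geo_le_2[OF \<rho>(1)] cap_nonneg)
      finally show "norm (cap (J k)) \<le> 2 * (\<rho> ^ (2 * k) * ?p)" using cap_nonneg[of "J k"] by simp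
    qed
  qed
  define C where "C = (\<lambda>k. (A k \<union> Q k) \<union> J k)"
  have "A k \<in> sets M" for k unfolding A_def
  proof (rule sets_ge, rule H_sum)
    fix i show "(\<lambda>w. clip (B k) (X (i + 1) w)) \<in> H"
      by (rule L1_H[OF BL_L1[OF clip_BL X]]) (use B0[of k] in auto)
  qed simp
  moreover have "Q k \<in> sets M" for k unfolding Q_def
  proof (rule sets_ge)
    have "(\<lambda>w. bmax (B k) (N (k - 1)) ((!) (hist Y (N k) w)) (N k)) \<in> H"
      using B0[of k] by (intro L1_H hist_L1[OF YH] bmax_vBL) auto
    moreover have "bmax (B k) (N (k - 1)) ((!) (hist Y (N k) w)) (N k) = bmax (B k) (N (k - 1)) (\<lambda>i. Y (i + 1) w) (N k)" for w
      by (rule bmax_cong) (simp add: hist_nth)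
    ultimately show "(\<lambda>w. bmax (B k) (N (k - 1)) (\<lambda>i. Y (i + 1) w) (N k)) \<in> H" by simp
  qed
  moreover have "J k \<in> sets M" for k unfolding J_def by (rule UN_tail_sets) (use X in auto)
  ultimately have Cs: "C k \<in> sets M" for k unfolding C_def by blast
  have sumC: "summable (\<lambda>k. cap (C k))"
  proof (rule summable_comparison_test'[OF summable_add[OF summable_add[OF sumA sumQ] sumJ], where N = 0])
    fix k show "norm (cap (C k)) \<le> cap (A k) + cap (Q k) + cap (J k)"
      using cap_Un[of "A k \<union> Q k" "J k"] cap_Un[of "A k" "Q k"] cap_nonneg[of "C k"] unfolding C_def by simp
  qed
  show ?thesis
  proof (rule Vs_limsup_null[OF Cs sumC], rule subsetI, rule ccontr)
    fix K w
    assume w: "w \<in> {w\<in>space M. \<not> (\<forall>\<^sub>F n in sequentially. partial_sum X n w \<le> (s + 4 * e) * lil_norm n)}"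
      and nC: "w \<notin> (\<Union>k\<in>{K..}. C k)"
    obtain K1 where K1: "\<And>k. K1 \<le> k \<Longrightarrow> real (N k) \<le> (1 + \<zeta>) * real (N (k - 1))"
      using ratio by (auto simp: eventually_sequentially)
    define K' where "K' = max K K1"
    have "partial_sum X n w \<le> (s + 4 * e) * lil_norm n" if n: "N K' < n" for n
    proof -
      define k where "k = (LEAST k. n \<le> N k)"
      have "\<exists>k. n \<le> N k"
        using geo_at_top[OF \<rho>(1)] unfolding filterlim_at_top N_def by (meson eventually_happens' sequentially_bot)
      hence nk: "n \<le> N k" unfolding k_def by (metis LeastI_ex)
      have kK: "K' < k" using nk n Nm[of k K'] by (meson leD le_less_trans not_le order.strict_trans2)
      have "\<not> n \<le> N (k - 1)" using kK not_less_Least[of "k - 1" "\<lambda>k. n \<le> N k"] unfolding k_def[symmetric] by simp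
      hence kn: "N (k - 1) \<le> n" by simp
      have "w \<notin> C k" using nC kK unfolding K'_def by auto
      hence nA: "(\<Sum>i<N k. clip (B k) (X (i + 1) w)) < \<kappa> * a k"
        and nQ: "bmax (B k) (N (k - 1)) (\<lambda>i. - X (i + 1) w) (N k) < e * a k"
        and nJ: "\<And>i. 1 \<le> i \<Longrightarrow> i \<le> N k \<Longrightarrow> \<bar>X i w\<bar> < B k"
        using w unfolding C_def A_def Q_def J_def Y_def by (auto simp: not_le)
      have n1: "1 \<le> n" using n by simp
      have "partial_sum X n w \<le> \<kappa> * a k + e * a k"
        by (rule partial_sum_le_if_good[of "N k" X w "B k" _ "N (k - 1)", OF nJ nA nQ kn nk B0[of k]])
      also have "\<dots> = (s + 3 * e) * a k" unfolding \<kappa>_def \<sigma>_def by (simp add: algebra_simps)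
      also have "\<dots> \<le> (s + 3 * e) * ((1 + \<zeta>) * lil_norm n)"
      proof (intro mult_left_mono)
        have "a k \<le> real (N k) / real n * lil_norm n" unfolding a_def by (rule lil_norm_ratio[OF n1 nk])
        also have "\<dots> \<le> (1 + \<zeta>) * lil_norm n"
        proof (intro mult_right_mono lil_norm_nonneg)
          have "real (N k) \<le> (1 + \<zeta>) * real (N (k - 1))" using K1[of k] kK unfolding K'_def by simp
          also have "\<dots> \<le> (1 + \<zeta>) * real n" using kn \<zeta>(1) by (intro mult_left_mono) auto
          finally show "real (N k) / real n \<le> 1 + \<zeta>" using n1 by (simp add: field_simps)
        qed
        finally show "a k \<le> (1 + \<zeta>) * lil_norm n" .
      qed (use s e in simp)
      also have "\<dots> = (s + 3 * e) * (1 + \<zeta>) * lil_norm n" by simp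
      also have "\<dots> \<le> (s + 4 * e) * lil_norm n" by (intro mult_right_mono \<zeta>(3) lil_norm_nonneg)
      finally show ?thesis .
    qed
    hence "\<forall>\<^sub>F n in sequentially. partial_sum X n w \<le> (s + 4 * e) * lil_norm n"
      unfolding eventually_sequentially by (intro exI[of _ "Suc (N K')"]) auto
    thus False using w by blast
  qed
qed

lemma lil_limsup:
  assumes X: "\<And>n. n \<ge> 1 \<Longrightarrow> X n \<in> H" and id: "identically_distributed E X"
    and neg_dep: "neg_dep X" "neg_dep (\<lambda>n w. - X n w)"
    and mean: "E (X 1) = 0" "E (\<lambda>w. - X 1 w) = 0"
    and lim: "((\<lambda>c::real. E (\<lambda>w. max ((X 1 w)\<^sup>2 - c) 0)) \<longlongrightarrow> 0) at_top"
    and mom: "lil_moment_cond M H E (X 1)"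
    and s: "0 \<le> s" "er (\<lambda>w. (X 1 w)\<^sup>2) \<le> s\<^sup>2"
  shows "Vs {w\<in>space M. limsup (\<lambda>n. ereal (partial_sum X n w / lil_norm n)) > ereal s} = 0"
proof -
  let ?A = "\<lambda>m::nat. {w\<in>space M. \<not> (\<forall>\<^sub>F n in sequentially. partial_sum X n w \<le> (s + 4 * (1 / (real m + 1))) * lil_norm n)}"
  have "Vs (\<Union>m. ?A m) = 0"
    by (intro Vs_UN_null lil_upper[OF X id neg_dep mean lim mom s]) auto
  moreover have "{w\<in>space M. limsup (\<lambda>n. ereal (partial_sum X n w / lil_norm n)) > ereal s} \<subseteq> (\<Union>m. ?A m)"
  proof (rule subsetI, rule ccontr)
    fix w
    assume w: "w \<in> {w\<in>space M. limsup (\<lambda>n. ereal (partial_sum X n w / lil_norm n)) > ereal s}" and n: "w \<notin> (\<Union>m. ?A m)"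
    have "ereal s < limsup (\<lambda>n. ereal (partial_sum X n w / lil_norm n))" using w by simp
    then obtain r where r: "s < r" "ereal r < limsup (\<lambda>n. ereal (partial_sum X n w / lil_norm n))"
      using ereal_dense2 by fastforce
    obtain m :: nat where m: "4 / (r - s) < real m" using reals_Archimedean2 by blast
    have "4 * (1 / (real m + 1)) \<le> r - s"
    proof -
      have "4 / (r - s) \<le> real m + 1" using m by linarith
      thus ?thesis using r(1) by (simp add: field_simps)
    qed
    hence sr: "s + 4 * (1 / (real m + 1)) \<le> r" by linarith
    have "\<forall>\<^sub>F n in sequentially. partial_sum X n w \<le> (s + 4 * (1 / (real m + 1))) * lil_norm n" using n w by blast
    hence "\<forall>\<^sub>F n in sequentially. ereal (partial_sum X n w / lil_norm n) \<le> ereal r"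
      using eventually_ge_at_top[of 1]
    proof eventually_elim
      case (elim n)
      have "partial_sum X n w / lil_norm n \<le> s + 4 * (1 / (real m + 1))"
        using elim lil_norm_pos[of n] by (simp add: pos_divide_le_eq)
      thus ?case using sr by simp
    qed
    hence "limsup (\<lambda>n. ereal (partial_sum X n w / lil_norm n)) \<le> ereal r" by (rule Limsup_bounded)
    thus False using r(2) by simp
  qed
  ultimately show ?thesis by (rule Vs_null_subset)
qed

end

theorem theorem3p11:
  fixes M :: "'a measure" and H :: "('a \<Rightarrow> real) set" and E :: "('a \<Rightarrow> real) \<Rightarrow> ereal"
    and X :: "nat \<Rightarrow> 'a \<Rightarrow> real" and \<sigma> :: ereal
  assumes "sublinear_expectation_space M H E"
    and "\<And>n. n \<ge> 1 \<Longrightarrow> X n \<in> H"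
    and "identically_distributed E X"
    and "\<sigma> \<ge> 0" and "\<sigma>\<^sup>2 = E (\<lambda>\<omega>. (X 1 \<omega>)\<^sup>2)"
  shows
    "(negatively_dependent_seq M E X \<and>
      E (X 1) = 0 \<and> E (\<lambda>\<omega>. - X 1 \<omega>) = 0 \<and>
      ((\<lambda>c::real. E (\<lambda>\<omega>. max ((X 1 \<omega>)\<^sup>2 - c) 0)) \<longlongrightarrow> 0) at_top \<and>
      lil_moment_cond M H E (X 1)
      \<longrightarrow>
      outer_cap M H E
        ({\<omega>\<in>space M. liminf (\<lambda>n. ereal (partial_sum X n \<omega> / lil_norm n)) < - \<sigma>} \<union>
         {\<omega>\<in>space M. limsup (\<lambda>n. ereal (partial_sum X n \<omega> / lil_norm n)) > \<sigma>}) = 0)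
     \<and>
     (independent_seq H E X \<and>
      continuous_cap M (outer_cap M H E) \<and>
      countably_subadd_exp M H E \<and>
      lil_bounded_cond M H E X
      \<longrightarrow>
      E (X 1) = 0 \<and> E (\<lambda>\<omega>. - X 1 \<omega>) = 0 \<and> lil_moment_cond M H E (X 1))
     \<and>
     (independent_seq H E X \<and>
      continuous_cap M (upper_cap M H E) \<and>
      lil_bounded_cond M H E X
      \<longrightarrow>
      lil_moment_cond M H E (X 1) \<and>
      (((\<lambda>c::real. E (\<lambda>\<omega>. max (\<bar>X 1 \<omega>\<bar> - c) 0)) \<longlongrightarrow> 0) at_top \<longrightarrow>
        E (X 1) = 0 \<and> E (\<lambda>\<omega>. - X 1 \<omega>) = 0))"
proof -
  interpret sublinear_expectation_space M H E by (rule assms(1))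
  note X = assms(2) and id = assms(3)
  have X1: "X 1 \<in> H" using X by simp
  show ?thesis
  proof (rule conjI[OF _ conjI]; rule impI; elim conjE)
    assume neg: "negatively_dependent_seq M E X"
      and mean: "E (X 1) = 0" "E (\<lambda>w. - X 1 w) = 0"
      and lim: "((\<lambda>c::real. E (\<lambda>w. max ((X 1 w)\<^sup>2 - c) 0)) \<longlongrightarrow> 0) at_top"
      and mom: "lil_moment_cond M H E (X 1)"
    let ?Y = "\<lambda>n w. - X n w"
    have lim': "((\<lambda>c::real. E (\<lambda>w. max (\<bar>(X 1 w)\<^sup>2\<bar> - c) 0)) \<longlongrightarrow> 0) at_top" using lim by simp
    have sqL: "(\<lambda>w. (X 1 w)\<^sup>2) \<in> L1" by (rule tail_L1(1)[OF H_square[OF X1] lim'])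
    have \<sigma>2: "\<sigma>\<^sup>2 = ereal (er (\<lambda>w. (X 1 w)\<^sup>2))" using assms(5) E_er[OF sqL] by simp
    \<comment> \<open>An infinite \<open>\<sigma>\<close> would have an infinite square, but the
      square of \<open>X 1\<close> is integrable.\<close>
    then obtain s where s: "\<sigma> = ereal s" using assms(4) by (cases \<sigma>) (auto simp: power2_eq_square)
    have s0: "0 \<le> s" and s2: "er (\<lambda>w. (X 1 w)\<^sup>2) \<le> s\<^sup>2" using assms(4) \<sigma>2 unfolding s by (auto simp: power2_eq_square)
    note neg_dep = neg_dep_uminus[OF X neg]
    have up: "Vs {w\<in>space M. limsup (\<lambda>n. ereal (partial_sum X n w / lil_norm n)) > \<sigma>} = 0"
      unfolding s by (rule lil_limsup[OF X id neg_dep mean lim mom s0 s2])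
    have neg_dep': "neg_dep (\<lambda>n w. - ?Y n w)" using neg_dep(1) by simp
    have mom': "lil_moment_cond M H E (?Y 1)" using mom by (simp add: lil_moment_cond_def)
    \<comment> \<open>The lower half is the upper half for \<open>- X\<close>, whose hypotheses are
      symmetric.\<close>
    have "Vs {w\<in>space M. limsup (\<lambda>n. ereal (partial_sum ?Y n w / lil_norm n)) > \<sigma>} = 0"
      unfolding s
      by (rule lil_limsup[OF H_uminus[OF X] identically_distributed_uminus[OF id] neg_dep(2) neg_dep' _ _ _ mom' s0])
         (use mean lim s2 in simp_all)
    moreover have "{w\<in>space M. limsup (\<lambda>n. ereal (partial_sum ?Y n w / lil_norm n)) > \<sigma>}
        = {w\<in>space M. liminf (\<lambda>n. ereal (partial_sum X n w / lil_norm n)) < - \<sigma>}"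
    proof -
      have "limsup (\<lambda>n. ereal (partial_sum ?Y n w / lil_norm n)) = - liminf (\<lambda>n. ereal (partial_sum X n w / lil_norm n))" for w
        using ereal_Limsup_uminus[of sequentially "\<lambda>n. ereal (partial_sum X n w / lil_norm n)"]
        by (simp add: partial_sum_def sum_negf)
      thus ?thesis by (simp add: ereal_less_uminus_reorder)
    qed
    ultimately have lo: "Vs {w\<in>space M. liminf (\<lambda>n. ereal (partial_sum X n w / lil_norm n)) < - \<sigma>} = 0" by simp
    let ?P = "{w\<in>space M. liminf (\<lambda>n. ereal (partial_sum X n w / lil_norm n)) < - \<sigma>}"
    let ?Q = "{w\<in>space M. limsup (\<lambda>n. ereal (partial_sum X n w / lil_norm n)) > \<sigma>}"
    have "Vs (\<Union>m::nat. if m = 0 then ?P else ?Q) = 0" using up lo by (intro Vs_UN_null) simp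
    moreover have "?P \<union> ?Q \<subseteq> (\<Union>m::nat. if m = 0 then ?P else ?Q)"
      using UN_upper[of 0 UNIV "\<lambda>m::nat. if m = 0 then ?P else ?Q"] UN_upper[of 1 UNIV "\<lambda>m::nat. if m = 0 then ?P else ?Q"] by simp
    ultimately show "Vs (?P \<union> ?Q) = 0" by (rule Vs_null_subset)
  next
    assume ind: "independent_seq H E X" and cont: "continuous_cap M Vs"
      and cs: "countably_subadd_exp M H E" and bdd: "lil_bounded_cond M H E X"
    note dom = dominated_countably_subadd[OF cs]
    have mom: "lil_moment_cond M H E (X 1)" by (rule moment_cond_if_bounded[OF X id ind dom cont bdd])
    with mean_zero[OF X id ind dom cont bdd mom tail_if_countably_subadd[OF X1 cs mom]]
    show "E (X 1) = 0 \<and> E (\<lambda>w. - X 1 w) = 0 \<and> lil_moment_cond M H E (X 1)" by blast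
  next
    assume ind: "independent_seq H E X" and cV: "continuous_cap M V" and bdd: "lil_bounded_cond M H E X"
    note dom = dominated_continuous[OF cV] and cont = continuous_V_Vs[OF cV]
    have mom: "lil_moment_cond M H E (X 1)" by (rule moment_cond_if_bounded[OF X id ind dom cont bdd])
    with mean_zero[OF X id ind dom cont bdd mom]
    show "lil_moment_cond M H E (X 1) \<and>
      (((\<lambda>c::real. E (\<lambda>w. max (\<bar>X 1 w\<bar> - c) 0)) \<longlongrightarrow> 0) at_top \<longrightarrow>
        E (X 1) = 0 \<and> E (\<lambda>w. - X 1 w) = 0)" by blast
  qed
qed

end
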